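(* For any $q\in H^{-1}(\mathbb{T})$ and any real $\alpha$ with $-1\le\alpha\le0$, the potential $q$ is in $H^\alpha(\mathbb{T})$ if and only if its sequence of gap lengths $(\gamma_k(q))_{k\ge1}$ is in $\mathfrak{h}^\alpha$, i.e. if and only if $\sum_{k\ge1}k^{2\alpha}\gamma_k(q)^2<\infty$.
   Context: $\mathbb{T}=\mathbb{R}/\mathbb{Z}$; for $\alpha\in\mathbb{R}$, $H^\alpha(\mathbb{T})$ is the Sobolev space of real valued ($1$-periodic) distributions on $\mathbb{T}$. For $q\in H^{-1}(\mathbb{T})$ the periodic spectrum of Hill's operator $-\frac{d^2}{dx^2}+q$ on the interval $[0,2]$ (i.e. of the self-adjoint operator on $L^2(\mathbb{R}/2\mathbb{Z})$ defined by the quadratic form $\int|f'|^2dx+\langle q,|f|^2\rangle$ on $H^1(\mathbb{R}/2\mathbb{Z})$, with $q$ viewed as a $2$-periodic distribution) is discrete. Listed in increasing order with multiplicities, the eigenvalues satisfy $\lambda_0<\lambda_1\le\lambda_2<\lambda_3\le\lambda_4<\dots$. The gap lengths are $\gamma_k(q)=\lambda_{2k}-\lambda_{2k-1}$, $k\ge1$. The space $\mathfrak{h}^\alpha$ is the weighted $\ell^2$ space of sequences with weights $k^{2\alpha}$; for a real sequence $(a_k)_{k\ge1}$, $(a_k)\in\mathfrak{h}^\alpha$ means $\sum_{k\ge1}k^{2\alpha}a_k^2<\infty$. *)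

theory Defs
  imports "HOL-Analysis.Analysis" "HOL-Library.Function_Algebras"
begin

text \<open>
  Test functions are the smooth 1-periodic real functions.  A real valued distribution on
  the circle is a HOL function that is linear and continuous on test functions; its values
  elsewhere are irrelevant, and no notion below depends on them.
\<close>

definition test_function :: "(real \<Rightarrow> real) \<Rightarrow> bool" where
  "test_function \<phi> \<longleftrightarrow>
     (\<forall>x. \<phi> (x + 1) = \<phi> x) \<and> (\<forall>n x. (deriv ^^ n) \<phi> differentiable at x)"

definition distribution :: "((real \<Rightarrow> real) \<Rightarrow> real) \<Rightarrow> bool" where
  "distribution q \<longleftrightarrow>
     (\<forall>\<phi> \<psi> a b. test_function \<phi> \<longrightarrow> test_function \<psi> \<longrightarrow>
        q (\<lambda>x. a * \<phi> x + b * \<psi> x) = a * q \<phi> + b * q \<psi>) \<and>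
     (\<exists>C N. \<forall>\<phi>. test_function \<phi> \<longrightarrow>
        \<bar>q \<phi>\<bar> \<le> C * (\<Sum>n\<le>N. SUP x\<in>{0..1}. \<bar>(deriv ^^ n) \<phi> x\<bar>))"

text \<open>The Fourier coefficient is the pairing of \<open>q\<close> with \<open>exp (- 2 \<pi> i k x)\<close>.\<close>

definition fourier_coeff :: "((real \<Rightarrow> real) \<Rightarrow> real) \<Rightarrow> int \<Rightarrow> complex" where
  "fourier_coeff q k =
     Complex (q (\<lambda>x. cos (2 * pi * of_int k * x))) (- q (\<lambda>x. sin (2 * pi * of_int k * x)))"

definition sobolev :: "real \<Rightarrow> ((real \<Rightarrow> real) \<Rightarrow> real) set" where
  "sobolev \<alpha> = {q. distribution q \<and>
     (\<lambda>k::int. (1 + (of_int k)\<^sup>2) powr \<alpha> * (cmod (fourier_coeff q k))\<^sup>2) summable_on UNIV}"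

definition L2_fun :: "(real \<Rightarrow> complex) \<Rightarrow> bool" where
  "L2_fun u \<longleftrightarrow> set_borel_measurable lborel {0..2} u \<and>
     set_integrable lborel {0..2} (\<lambda>x. (cmod (u x))\<^sup>2)"

text \<open>
  Elements of \<open>H\<^sup>1(\<real>/2\<int>)\<close> are represented by their absolutely continuous 2-periodic
  representatives, so that equality in the Sobolev space is equality of functions.
  The derivative is determined almost everywhere on \<open>[0, 2]\<close>.
\<close>

definition has_L2_deriv :: "(real \<Rightarrow> complex) \<Rightarrow> (real \<Rightarrow> complex) \<Rightarrow> bool" where
  "has_L2_deriv f f' \<longleftrightarrow> L2_fun f' \<and>
     (\<forall>x\<in>{0..2}. f x = f 0 + (LINT t:{0..x}|lborel. f' t))"

definition H1 :: "(real \<Rightarrow> complex) set" where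
  "H1 = {f. (\<forall>x. f (x + 2) = f x) \<and> (\<exists>f'. has_L2_deriv f f')}"

definition L2_deriv :: "(real \<Rightarrow> complex) \<Rightarrow> real \<Rightarrow> complex" where
  "L2_deriv f = (SOME f'. has_L2_deriv f f')"

text \<open>
  The pairing on \<open>\<real>/2\<int>\<close> of \<open>q \<in> H\<^sup>-\<^sup>1\<close>, viewed as a 2-periodic distribution, with
  \<open>h \<in> H\<^sup>1(\<real>/2\<int>)\<close>.  It extends \<open>\<integral> q(x) h(x) dx\<close> over \<open>[0, 2]\<close> by continuity, obtained by
  inserting the Fourier series of \<open>q\<close>; the series converges absolutely.
\<close>

definition pairing :: "((real \<Rightarrow> real) \<Rightarrow> real) \<Rightarrow> (real \<Rightarrow> complex) \<Rightarrow> complex" where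
  "pairing q h =
     (\<Sum>\<^sub>\<infinity>k::int. fourier_coeff q k * (LINT x:{0..2}|lborel. h x * cis (2 * pi * of_int k * x)))"

definition L2_inner :: "(real \<Rightarrow> complex) \<Rightarrow> (real \<Rightarrow> complex) \<Rightarrow> complex" where
  "L2_inner u v = (LINT x:{0..2}|lborel. u x * cnj (v x))"

text \<open>The sesquilinear form whose diagonal is the quadratic form \<open>\<integral> |f'|\<^sup>2 + \<langle>q, |f|\<^sup>2\<rangle>\<close>.\<close>

definition hill_form ::
    "((real \<Rightarrow> real) \<Rightarrow> real) \<Rightarrow> (real \<Rightarrow> complex) \<Rightarrow> (real \<Rightarrow> complex) \<Rightarrow> complex" where
  "hill_form q f g = L2_inner (L2_deriv f) (L2_deriv g) + pairing q (\<lambda>x. f x * cnj (g x))"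

text \<open>
  The graph of the self-adjoint operator associated with the form: \<open>f\<close> lies in the domain
  and is mapped to \<open>u\<close>.
\<close>

definition hill_operator ::
    "((real \<Rightarrow> real) \<Rightarrow> real) \<Rightarrow> (real \<Rightarrow> complex) \<Rightarrow> (real \<Rightarrow> complex) \<Rightarrow> bool" where
  "hill_operator q f u \<longleftrightarrow> f \<in> H1 \<and> L2_fun u \<and> (\<forall>g\<in>H1. hill_form q f g = L2_inner u g)"

definition eigenspace :: "((real \<Rightarrow> real) \<Rightarrow> real) \<Rightarrow> real \<Rightarrow> (real \<Rightarrow> complex) set" where
  "eigenspace q \<mu> = {f. hill_operator q f (\<lambda>x. of_real \<mu> * f x)}"

definition scale_fun :: "complex \<Rightarrow> (real \<Rightarrow> complex) \<Rightarrow> real \<Rightarrow> complex" where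
  "scale_fun c f = (\<lambda>x. c * f x)"

global_interpretation cfun: vector_space scale_fun
  by unfold_locales (auto simp: scale_fun_def fun_eq_iff algebra_simps)

definition multiplicity_of :: "((real \<Rightarrow> real) \<Rightarrow> real) \<Rightarrow> real \<Rightarrow> nat" where
  "multiplicity_of q \<mu> = cfun.dim (eigenspace q \<mu>)"

definition lists_spectrum :: "((real \<Rightarrow> real) \<Rightarrow> real) \<Rightarrow> (nat \<Rightarrow> real) \<Rightarrow> bool" where
  "lists_spectrum q l \<longleftrightarrow>
     mono l \<and> (\<forall>\<mu>. finite {n. l n = \<mu>} \<and> card {n. l n = \<mu>} = multiplicity_of q \<mu>)"

text \<open>
  A nondecreasing sequence with prescribed finite multiplicities is unique, so the
  description is definite whenever the spectrum is discrete, as it is for \<open>q \<in> H\<^sup>-\<^sup>1\<close>.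
\<close>

definition periodic_eigenvalue :: "((real \<Rightarrow> real) \<Rightarrow> real) \<Rightarrow> nat \<Rightarrow> real" where
  "periodic_eigenvalue q = (THE l. lists_spectrum q l)"

text \<open>Meaningful for \<open>k \<ge> 1\<close>.\<close>

definition gap_length :: "((real \<Rightarrow> real) \<Rightarrow> real) \<Rightarrow> nat \<Rightarrow> real" where
  "gap_length q k = periodic_eigenvalue q (2 * k) - periodic_eigenvalue q (2 * k - 1)"

text \<open>Sequences are indexed from 1; the value at 0 is ignored.\<close>

definition weighted_l2 :: "real \<Rightarrow> (nat \<Rightarrow> real) set" where
  "weighted_l2 \<alpha> = {a. (\<lambda>k. real k powr (2 * \<alpha>) * (a k)\<^sup>2) summable_on {1..}}"

end

theory Submission
  imports Defs "HOL-Complex_Analysis.Great_Picard"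
begin

text \<open>
  \<^bold>\<open>Reduction to a matrix.\<close>  In the exponentials \<open>exp (\<i> \<pi> m x)\<close> of period \<open>2\<close> the Hill operator is the
  infinite matrix \<open>\<pi>\<^sup>2 m\<^sup>2 \<delta>(m, k) + v(m - k)\<close>, where \<open>v(2 k)\<close> is the \<open>k\<close>-th Fourier coefficient of \<open>q\<close> and
  \<open>v\<close> vanishes at odd integers, since \<open>q\<close> has period \<open>1\<close>.  That \<open>q\<close> lies in \<open>H\<^sup>-\<^sup>1\<close> says that
  \<open>w(j) = |v(j)| / max(1, |j|)\<close> is square summable.  With \<open>s = \<alpha> + 1\<close>, a number between \<open>0\<close> and \<open>1\<close>, the claim
  becomes: \<open>max(1, |j|)\<^sup>s w(j)\<close> is square summable if and only if \<open>n\<^sup>s \<gamma>\<^sub>n / n\<close> is.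

  \<^bold>\<open>Two eigenvalues near \<open>\<pi>\<^sup>2 n\<^sup>2\<close>.\<close>  For \<open>\<lambda>\<close> near \<open>\<pi>\<^sup>2 n\<^sup>2\<close> and \<open>m \<noteq> \<plusminus> n\<close>, the number
  \<open>|\<pi>\<^sup>2 m\<^sup>2 - \<lambda>|\<close> is at least \<open>||m| - n| (|m| + n)\<close>.  Measured against this diagonal the potential is a Hilbert-Schmidt
  kernel whose norm tends to \<open>0\<close> as \<open>n\<close> grows (\<open>kern_tendsto_0\<close>), although \<open>v\<close> itself may be unbounded.
  So the form is bounded below with compact sublevel sets.  Successive minimisation yields eigenvectors
  (\<open>spectral_sequence_exists\<close>), and comparing the form with \<open>\<pi>\<^sup>2 (n\<^sup>2 + n)\<close> on the modes \<open>|m| \<le> n\<close> and on the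
  remaining ones shows that, for large \<open>n\<close>, exactly \<open>2 n + 1\<close> eigenvalues lie below that number
  (\<open>eigenvalue_count\<close>).  Hence \<open>\<lambda>\<^sub>2\<^sub>n\<^sub>-\<^sub>1\<close> and \<open>\<lambda>\<^sub>2\<^sub>n\<close> are the only two eigenvalues between
  \<open>\<pi>\<^sup>2 (n\<^sup>2 - n)\<close> and \<open>\<pi>\<^sup>2 (n\<^sup>2 + n)\<close>.

  \<^bold>\<open>The gap as a matrix entry.\<close>  The span \<open>E\<close> of their eigenvectors is concentrated on the modes \<open>n\<close> and \<open>- n\<close>, so
  these two coordinates identify \<open>E\<close> with the complex plane \<open>\<complex>\<^sup>2\<close>.  The operator minus \<open>\<lambda>\<^sub>2\<^sub>n\<^sub>-\<^sub>1\<close> acts on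
  \<open>E\<close> with eigenvalues \<open>0\<close> and \<open>\<gamma>\<^sub>n\<close>.  As \<open>q\<close> is real, its matrix has the rows
  \<open>(a, b)\<close> and \<open>(cnj b, cnj a)\<close>; determinant \<open>0\<close> and trace \<open>\<gamma>\<^sub>n\<close> give \<open>|a| = |b|\<close> and
  \<open>\<gamma>\<^sub>n = 2 Re a\<close>.  Therefore \<open>\<gamma>\<^sub>n \<le> 2 |b|\<close>, and the concentration of \<open>E\<close> gives \<open>|b| \<le> 2 \<gamma>\<^sub>n\<close>.  Here
  \<open>b = v(2 n) + \<beta>\<^sub>n\<close>, where the correction \<open>\<beta>\<^sub>n\<close> collects the coupling of \<open>n\<close> and \<open>- n\<close> through all other modes
  (\<open>gap_structure_at\<close>, \<open>gap_expansion\<close>).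

  \<^bold>\<open>Absorbing the correction.\<close>  Let \<open>\<rho>\<close> be a bounded weight, increasing in \<open>|j|\<close> and such that \<open>\<rho>(j) / j\<close> does not
  increase for \<open>j \<ge> 1\<close>; then \<open>\<rho>\<close> is subadditive.  The squares of \<open>\<rho>(2 n) \<beta>\<^sub>n / n\<close>, summed over \<open>N \<le> n < M\<close>, are at most \<open>\<epsilon>\<close> times the sum of the squared
  norm of \<open>\<rho> w\<close> and of the squares of \<open>\<rho>(2 n) \<gamma>\<^sub>n / n\<close> over the same range, where \<open>\<epsilon>\<close> is small for large \<open>N\<close>
  and, decisively, independent of \<open>\<rho>\<close> (\<open>correction_sum_bound\<close>).  For the truncated powers
  \<open>\<rho>(j) = min(max(1, |j|), M)\<^sup>s\<close> all quantities are finite, so the correction can be absorbed in either direction, and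
  \<open>M\<close> may then tend to infinity (\<open>weighted_gap_characterization\<close>).

  \<^bold>\<open>Back to functions.\<close>  Completeness of the exponentials, with Parseval's identity, identifies the Sobolev space
  \<open>H\<^sup>1\<close>, the form and the eigenspaces of the Hill operator with their counterparts for sequences
  (\<open>H1_eq\<close>, \<open>hill_form_eq\<close>, \<open>eigenspace_eq\<close>).  A nondecreasing sequence is determined by its multiplicities, so the
  eigenvalues obtained by minimisation are the periodic eigenvalues (\<open>periodic_eigenvalue_eq\<close>).
\<close>

section \<open>Square summable families\<close>

definition l2 :: "('i \<Rightarrow> 'a::real_normed_vector) \<Rightarrow> bool" where
  "l2 f \<longleftrightarrow> (\<lambda>i. (norm (f i))\<^sup>2) summable_on UNIV"

definition l2norm :: "('i \<Rightarrow> 'a::real_normed_vector) \<Rightarrow> real" where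
  "l2norm f = sqrt (\<Sum>\<^sub>\<infinity>i. (norm (f i))\<^sup>2)"

lemma l2norm_nonneg [simp]: "0 \<le> l2norm f"
  by (simp add: l2norm_def infsum_nonneg)

lemma l2norm_power2: "(l2norm f)\<^sup>2 = (\<Sum>\<^sub>\<infinity>i. (norm (f i))\<^sup>2)"
  by (simp add: l2norm_def infsum_nonneg)

lemma l2I:
  assumes "\<And>F. finite F \<Longrightarrow> L2_set (\<lambda>i. norm (f i)) F \<le> B"
  shows "l2 f" "l2norm f \<le> B"
proof -
  have B0: "0 \<le> B" using assms[of "{}"] by simp
  have *: "(\<Sum>i\<in>F. (norm (f i))\<^sup>2) \<le> B\<^sup>2" if "finite F" for F
    using assms[OF that] unfolding L2_set_def by (metis real_le_lsqrt sqrt_le_D B0 power2_eq_square real_sqrt_abs abs_of_nonneg)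
  show l: "l2 f" unfolding l2_def
    by (rule nonneg_bdd_above_summable_on) (auto intro!: bdd_aboveI2 *)
  have "(\<Sum>\<^sub>\<infinity>i. (norm (f i))\<^sup>2) \<le> B\<^sup>2"
    by (rule infsum_le_finite_sums) (use l * in \<open>auto simp: l2_def\<close>)
  then show "l2norm f \<le> B" unfolding l2norm_def using B0 by (metis real_sqrt_le_iff real_sqrt_abs abs_of_nonneg)
qed

lemma sum_le_l2norm: "l2 f \<Longrightarrow> finite F \<Longrightarrow> (\<Sum>i\<in>F. (norm (f i))\<^sup>2) \<le> (l2norm f)\<^sup>2"
  unfolding l2norm_power2 l2_def by (rule finite_sum_le_infsum) auto

lemma L2_set_le_l2norm: "l2 f \<Longrightarrow> L2_set (\<lambda>i. norm (f i)) F \<le> l2norm f"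
  by (cases "finite F") (auto simp: L2_set_def intro!: real_le_lsqrt sum_le_l2norm sum_nonneg)

lemma norm_le_l2norm: "l2 f \<Longrightarrow> norm (f i) \<le> l2norm f"
  using L2_set_le_l2norm[of f "{i}"] by simp

lemma l2_mono:
  assumes "l2 g" "\<And>i. norm (f i) \<le> norm (g i)"
  shows "l2 f" "l2norm f \<le> l2norm g"
proof -
  have "L2_set (\<lambda>i. norm (f i)) F \<le> l2norm g" for F
    by (rule order_trans[OF L2_set_mono L2_set_le_l2norm[OF assms(1)]]) (use assms(2) in auto)
  then show "l2 f" "l2norm f \<le> l2norm g" by (auto intro: l2I)
qed

lemma l2_add:
  assumes "l2 f" "l2 g"
  shows "l2 (\<lambda>i. f i + g i)" "l2norm (\<lambda>i. f i + g i) \<le> l2norm f + l2norm g"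
proof -
  have "L2_set (\<lambda>i. norm (f i + g i)) F \<le> l2norm f + l2norm g" for F
  proof -
    have "L2_set (\<lambda>i. norm (f i + g i)) F \<le> L2_set (\<lambda>i. norm (f i) + norm (g i)) F"
      by (rule L2_set_mono) (auto intro: norm_triangle_ineq)
    also have "\<dots> \<le> L2_set (\<lambda>i. norm (f i)) F + L2_set (\<lambda>i. norm (g i)) F"
      by (rule L2_set_triangle_ineq)
    finally show ?thesis using L2_set_le_l2norm[OF assms(1), of F] L2_set_le_l2norm[OF assms(2), of F] by linarith
  qed
  then show "l2 (\<lambda>i. f i + g i)" "l2norm (\<lambda>i. f i + g i) \<le> l2norm f + l2norm g" by (auto intro: l2I)
qed

lemma l2_scale:
  fixes f :: "'i \<Rightarrow> 'a::real_normed_div_algebra"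
  assumes "l2 f" shows "l2 (\<lambda>i. c * f i)" "l2norm (\<lambda>i. c * f i) = norm c * l2norm f"
  using assms unfolding l2_def l2norm_def
  by (auto simp: norm_mult power_mult_distrib infsum_cmult_right real_sqrt_mult intro: summable_on_cmult_right)

lemma l2_norm [simp]: "l2 (\<lambda>i. norm (f i)) = l2 f" "l2norm (\<lambda>i. norm (f i)) = l2norm f"
  by (auto simp: l2_def l2norm_def)

lemma l2_CS:
  assumes "l2 f" "l2 g"
  shows "(\<lambda>i. norm (f i) * norm (g i)) summable_on UNIV"
    and "(\<Sum>\<^sub>\<infinity>i. norm (f i) * norm (g i)) \<le> l2norm f * l2norm g"
proof -
  have *: "(\<Sum>i\<in>F. norm (f i) * norm (g i)) \<le> l2norm f * l2norm g" for F
  proof -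
    have "(\<Sum>i\<in>F. norm (f i) * norm (g i)) \<le> L2_set (\<lambda>i. norm (f i)) F * L2_set (\<lambda>i. norm (g i)) F"
      using L2_set_mult_ineq[of "\<lambda>i. norm (f i)" "\<lambda>i. norm (g i)" F] by simp
    also have "\<dots> \<le> l2norm f * l2norm g"
      by (intro mult_mono L2_set_le_l2norm assms) auto
    finally show ?thesis .
  qed
  show s: "(\<lambda>i. norm (f i) * norm (g i)) summable_on UNIV"
    by (rule nonneg_bdd_above_summable_on) (auto intro!: bdd_aboveI2 *)
  show "(\<Sum>\<^sub>\<infinity>i. norm (f i) * norm (g i)) \<le> l2norm f * l2norm g"
    by (rule infsum_le_finite_sums) (use s * in auto)
qed

lemma l2_CS_complex:
  fixes f g :: "'i \<Rightarrow> complex"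
  assumes "l2 f" "l2 g"
  shows "(\<lambda>i. norm (f i * g i)) summable_on UNIV" "norm (\<Sum>\<^sub>\<infinity>i. f i * g i) \<le> l2norm f * l2norm g"
proof -
  show 1: "(\<lambda>i. norm (f i * g i)) summable_on UNIV"
    using l2_CS(1)[OF assms] by (simp add: norm_mult)
  show "norm (\<Sum>\<^sub>\<infinity>i. f i * g i) \<le> l2norm f * l2norm g"
    using norm_infsum_bound[OF 1] l2_CS(2)[OF assms] by (simp add: norm_mult)
qed

lemma l2_bij:
  assumes "bij h"
  shows "l2 (\<lambda>i. f (h i)) = l2 f" "l2norm (\<lambda>i. f (h i)) = l2norm f"
  unfolding l2_def l2norm_def
  using summable_on_reindex_bij_betw[OF assms, of "\<lambda>i. (norm (f i))\<^sup>2"]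
    infsum_reindex_bij_betw[OF assms, of "\<lambda>i. (norm (f i))\<^sup>2"] by auto

lemma bij_add_int: "bij (\<lambda>m::int. m + c)" "bij (\<lambda>m::int. c + m)" "bij (\<lambda>m::int. c - m)"
  "bij (\<lambda>m::int. m - c)" "bij (\<lambda>m::int. - m)"
  by (rule o_bij[where g="\<lambda>m. m - c"] o_bij[where g="\<lambda>m. c - m"] o_bij[where g="\<lambda>m. m + c"] o_bij[where g="\<lambda>m. -m"];
      auto simp: fun_eq_iff)+

lemma l2_row:
  assumes "l2 K" shows "l2 (\<lambda>k. K (m, k))"
proof (rule l2I(1))
  fix F :: "'b set" assume "finite F"
  have "(\<Sum>k\<in>F. (norm (K (m,k)))\<^sup>2) = (\<Sum>p\<in>{m}\<times>F. (norm (K p))\<^sup>2)"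
    by (simp add: sum.cartesian_product')
  also have "\<dots> \<le> (l2norm K)\<^sup>2" using assms \<open>finite F\<close> by (intro sum_le_l2norm) auto
  finally show "L2_set (\<lambda>k. norm (K (m,k))) F \<le> l2norm K"
    unfolding L2_set_def by (intro real_le_lsqrt) (auto intro: sum_nonneg)
qed

lemma l2_rows:
  assumes "l2 K" shows "l2 (\<lambda>m. l2norm (\<lambda>k. K (m, k)))" "l2norm (\<lambda>m. l2norm (\<lambda>k. K (m, k))) = l2norm K"
proof -
  have s: "(\<lambda>(m,k). (norm (K (m,k)))\<^sup>2) summable_on UNIV \<times> UNIV"
    using assms by (simp add: l2_def case_prod_unfold)
  show "l2 (\<lambda>m. l2norm (\<lambda>k. K (m, k)))"
    using summable_on_Sigma_banach[OF s] by (simp add: l2_def l2norm_power2)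
  show "l2norm (\<lambda>m. l2norm (\<lambda>k. K (m, k))) = l2norm K"
    using infsum_Sigma'_banach[OF s] by (simp add: l2norm_def[of K] l2norm_def[of "\<lambda>m. l2norm (\<lambda>k. K (m, k))"] l2norm_power2 case_prod_unfold)
qed

lemma l2_prodI:
  assumes "\<And>m. l2 (\<lambda>k. K (m, k))" "l2 (\<lambda>m. l2norm (\<lambda>k. K (m, k)))"
  shows "l2 K"
proof -
  have "(\<lambda>p. (norm (K p))\<^sup>2) summable_on (UNIV \<times> UNIV)"
    by (rule summable_on_SigmaI[where g="\<lambda>m. (l2norm (\<lambda>k. K (m, k)))\<^sup>2"])
      (use assms in \<open>auto simp: l2_def l2norm_power2\<close>)
  then show ?thesis by (simp add: l2_def)
qed

lemma l2_tensor:
  fixes f :: "'i \<Rightarrow> real" and g :: "'j \<Rightarrow> real"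
  assumes "l2 f" "l2 g"
  shows "l2 (\<lambda>(i,j). f i * g j)" "l2norm (\<lambda>(i,j). f i * g j) = l2norm f * l2norm g"
proof -
  have r: "l2 (\<lambda>k. f m * g k)" "l2norm (\<lambda>k. f m * g k) = l2norm g * \<bar>f m\<bar>" for m
    using l2_scale[OF assms(2), of "f m"] by auto
  have r2: "l2 (\<lambda>m. l2norm (\<lambda>k. f m * g k))" "l2norm (\<lambda>m. l2norm (\<lambda>k. f m * g k)) = l2norm g * l2norm f"
    unfolding r using l2_scale[of "\<lambda>m. \<bar>f m\<bar>" "l2norm g"] assms l2_norm[of f] by auto
  show 1: "l2 (\<lambda>(i,j). f i * g j)"
    by (rule l2_prodI) (use r r2 in auto)
  show "l2norm (\<lambda>(i,j). f i * g j) = l2norm f * l2norm g"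
    using l2_rows(2)[OF 1] r2(2) by (simp add: mult.commute)
qed

text \<open>Hilbert-Schmidt kernels act on square summable families with operator norm at most \<open>l2norm K\<close>: each row is
  treated by Cauchy-Schwarz, and the norms of the rows are square summable.\<close>

lemma l2_kernel:
  assumes "l2 K" "l2 f"
  shows "(\<lambda>k. norm (K (m,k)) * norm (f k)) summable_on UNIV"
    and "l2 (\<lambda>m. \<Sum>\<^sub>\<infinity>k. norm (K (m,k)) * norm (f k))"
    and "l2norm (\<lambda>m. \<Sum>\<^sub>\<infinity>k. norm (K (m,k)) * norm (f k)) \<le> l2norm K * l2norm f"
proof -
  note r = l2_rows[OF assms(1)]
  show "(\<lambda>k. norm (K (m,k)) * norm (f k)) summable_on UNIV"
    by (rule l2_CS(1)[OF l2_row[OF assms(1)] assms(2)])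
  have le: "norm (\<Sum>\<^sub>\<infinity>k. norm (K (m,k)) * norm (f k)) \<le> norm (l2norm f * l2norm (\<lambda>k. K (m, k)))" for m
    using l2_CS(2)[OF l2_row[OF assms(1)] assms(2)]
    by (simp add: infsum_nonneg mult.commute)
  note s = l2_scale[OF r(1), of "l2norm f"]
  show "l2 (\<lambda>m. \<Sum>\<^sub>\<infinity>k. norm (K (m,k)) * norm (f k))"
    by (rule l2_mono(1)[OF s(1) le])
  show "l2norm (\<lambda>m. \<Sum>\<^sub>\<infinity>k. norm (K (m,k)) * norm (f k)) \<le> l2norm K * l2norm f"
    using l2_mono(2)[OF s(1) le] s(2) r(2) by (simp add: mult.commute)
qed

text \<open>Dominated convergence: outside a finite set the sums are uniformly small, and on a finite set the limit may
  be taken termwise.\<close>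

lemma infsum_dominated_tendsto_0:
  fixes f :: "nat \<Rightarrow> 'i \<Rightarrow> real"
  assumes g: "g summable_on UNIV" and f: "\<And>n i. 0 \<le> f n i" "\<And>n i. f n i \<le> g i"
    and lim: "\<And>i. (\<lambda>n. f n i) \<longlonglongrightarrow> 0"
  shows "(\<lambda>n. \<Sum>\<^sub>\<infinity>i. f n i) \<longlonglongrightarrow> 0"
proof (rule LIMSEQ_I)
  fix e :: real assume e: "0 < e"
  have g0: "0 \<le> g i" for i using f order_trans by blast
  have fs: "f n summable_on A" for n A
    by (rule summable_on_subset_banach[of _ UNIV], rule summable_on_comparison_test[OF g]) (use f in auto)
  obtain F where F: "finite F" "dist (sum g F) (infsum g UNIV) \<le> e/4"
    using infsum_finite_approximation[OF g, of "e/4"] e by auto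
  have tail: "infsum g (-F) \<le> e/4"
  proof -
    have "infsum g UNIV = infsum g F + infsum g (-F)"
      using infsum_Un_disjoint[of g F "-F"] summable_on_subset_banach[OF g] by (auto simp: Un_commute)
    then show ?thesis using F by (auto simp: dist_real_def)
  qed
  have "(\<lambda>n. \<Sum>i\<in>F. f n i) \<longlonglongrightarrow> (\<Sum>i\<in>F. 0)" by (intro tendsto_sum lim)
  then obtain N where N: "\<And>n. n \<ge> N \<Longrightarrow> norm (\<Sum>i\<in>F. f n i) < e/2"
    using LIMSEQ_D[of "\<lambda>n. \<Sum>i\<in>F. f n i" 0 "e/2"] e by auto
  show "\<exists>no. \<forall>n\<ge>no. norm ((\<Sum>\<^sub>\<infinity>i. f n i) - 0) < e"
  proof (intro exI allI impI)
    fix n assume n: "n \<ge> N"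
    have "(\<Sum>\<^sub>\<infinity>i. f n i) = (\<Sum>i\<in>F. f n i) + infsum (f n) (-F)"
      using infsum_Un_disjoint[of "f n" F "-F"] fs F(1) by (auto simp: Un_commute)
    moreover have "infsum (f n) (-F) \<le> infsum g (-F)"
      by (rule infsum_mono) (use fs f summable_on_subset_banach[OF g] in auto)
    moreover have "0 \<le> (\<Sum>\<^sub>\<infinity>i. f n i)" using f by (auto intro: infsum_nonneg)
    ultimately show "norm ((\<Sum>\<^sub>\<infinity>i. f n i) - 0) < e" using N[OF n] tail e by auto
  qed
qed

section \<open>The kernel of a singular potential in Fourier space\<close>

definition bracket :: "int \<Rightarrow> real" where "bracket m = max 1 \<bar>of_int m\<bar>"

text \<open>The products \<open>resdist n m * ressum n m\<close> replace \<open>\<bar>m\<^sup>2 - n\<^sup>2\<bar>\<close>, the distance of the free eigenvalue of the mode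
  \<open>m\<close> from the resonant one; the maximum with \<open>1\<close> keeps them away from \<open>0\<close> at the resonant modes \<open>m = \<plusminus> n\<close>.\<close>

definition resdist :: "nat \<Rightarrow> int \<Rightarrow> real" where
  "resdist n m = max 1 \<bar>\<bar>of_int m\<bar> - of_nat n\<bar>"

definition ressum :: "nat \<Rightarrow> int \<Rightarrow> real" where
  "ressum n m = \<bar>of_int m\<bar> + of_nat n"

text \<open>With \<open>\<omega>(j) = \<bar>v(j)\<bar> / bracket j\<close> the numerator is \<open>\<bar>v(m - k)\<bar>\<close>.  The two factors of the resonance
  denominator are attached to different indices, \<open>ressum\<close> to \<open>m\<close> and \<open>resdist\<close> to \<open>k\<close>: only then can a numerator that
  grows like \<open>\<bar>m - k\<bar>\<close> be compensated.\<close>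

definition kern :: "nat \<Rightarrow> (int \<Rightarrow> real) \<Rightarrow> int \<times> int \<Rightarrow> real" where
  "kern n \<omega> = (\<lambda>(m,k). bracket (m - k) * \<omega> (m - k) / (ressum n m * resdist n k))"

text \<open>The part of \<open>\<omega>\<close> at frequencies small compared with \<open>n\<close> is suppressed; this is what makes the norm tend to
  \<open>0\<close> for a fixed square summable \<open>\<omega>\<close>.\<close>

definition damped :: "nat \<Rightarrow> (int \<Rightarrow> real) \<Rightarrow> int \<Rightarrow> real" where
  "damped n \<omega> j = \<omega> j * min 1 (bracket j / n)"

definition inv_bracket_norm :: real where "inv_bracket_norm = l2norm (\<lambda>m. 1 / bracket m)"

lemma bracket_pos [simp]: "0 < bracket m" "bracket m \<noteq> 0" "1 \<le> bracket m" "0 \<le> bracket m" by (auto simp: bracket_def)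
lemma resdist_pos [simp]: "0 < resdist n m" "resdist n m \<noteq> 0" "1 \<le> resdist n m" "0 \<le> resdist n m" by (auto simp: resdist_def)
lemma bracket_minus [simp]: "bracket (- m) = bracket m" by (simp add: bracket_def)
lemma ressum_pos: "0 < n \<Longrightarrow> 0 < ressum n m" by (simp add: ressum_def)
lemma ressum_ge: "real n \<le> ressum n m" by (simp add: ressum_def)

lemma l2_inv_bracket: "l2 (\<lambda>m. 1 / bracket m)"
proof -
  have s: "summable (\<lambda>n. (1 / bracket (int n))\<^sup>2)"
  proof (rule summable_comparison_test_ev)
    show "\<forall>\<^sub>F n in sequentially. norm ((1 / bracket (int n))\<^sup>2) \<le> inverse ((real n)\<^sup>2)"
      using eventually_gt_at_top[of 0] by eventually_elim (auto simp: bracket_def power2_eq_square field_simps)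
  qed (use inverse_power_summable[of 2, where 'a=real] in simp)
  then have s1: "(\<lambda>n. (1 / bracket (int n))\<^sup>2) summable_on UNIV"
    by (intro norm_summable_imp_summable_on) simp
  have 1: "(\<lambda>m. (1 / bracket m)\<^sup>2) summable_on (range int)"
    using s1 by (subst summable_on_reindex) (auto simp: o_def)
  have 2: "(\<lambda>m. (1 / bracket m)\<^sup>2) summable_on (range (\<lambda>n. - int n))"
    using s1 by (subst summable_on_reindex) (auto simp: o_def inj_on_def)
  have "UNIV = range int \<union> range (\<lambda>n. - int n)"
  proof -
    have "x \<in> range int \<union> range (\<lambda>n. - int n)" for x :: int
      by (cases "0 \<le> x") (auto intro: image_eqI[of _ _ "nat \<bar>x\<bar>"])
    then show ?thesis by auto
  qed
  then have "(\<lambda>m. (1 / bracket m)\<^sup>2) summable_on UNIV"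
    using summable_on_union[OF 1 2] by simp
  then show ?thesis by (simp add: l2_def)
qed

lemma inv_resdist_le: "1 / resdist n m \<le> 1 / bracket (m - int n) + 1 / bracket (m + int n)"
proof (cases "0 \<le> m")
  case True
  then have "resdist n m = bracket (m - int n)" by (simp add: resdist_def bracket_def)
  then show ?thesis by simp
next
  case False
  then have "resdist n m = bracket (m + int n)" by (simp add: resdist_def bracket_def)
  then show ?thesis by simp
qed

lemma l2_inv_resdist: "l2 (\<lambda>m. 1 / resdist n m)" "l2norm (\<lambda>m. 1 / resdist n m) \<le> 2 * inv_bracket_norm"
proof -
  have a: "l2 (\<lambda>m. 1 / bracket (m - int n))" "l2norm (\<lambda>m. 1 / bracket (m - int n)) = inv_bracket_norm"
    "l2 (\<lambda>m. 1 / bracket (m + int n))" "l2norm (\<lambda>m. 1 / bracket (m + int n)) = inv_bracket_norm"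
    using l2_bij[OF bij_add_int(4), of "\<lambda>m. 1 / bracket m" "int n"] 
      l2_bij[OF bij_add_int(1), of "\<lambda>m. 1 / bracket m" "int n"] l2_inv_bracket by (auto simp: inv_bracket_norm_def)
  note b = l2_add[OF a(1) a(3)]
  have le: "norm (1 / resdist n m) \<le> norm (1 / bracket (m - int n) + 1 / bracket (m + int n))" for m
    using inv_resdist_le[of n m] by (simp add: order_trans[OF _ abs_ge_self])
  show "l2 (\<lambda>m. 1 / resdist n m)" by (rule l2_mono(1)[OF b(1) le])
  show "l2norm (\<lambda>m. 1 / resdist n m) \<le> 2 * inv_bracket_norm" using l2_mono(2)[OF b(1) le] b(2) a by simp
qed

lemma l2_inv_ressum:
  assumes "0 < n" shows "l2 (\<lambda>m. 1 / ressum n m)" "l2norm (\<lambda>m. 1 / ressum n m) \<le> inv_bracket_norm"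
proof -
  have le: "norm (1 / ressum n m) \<le> norm (1 / bracket m)" for m
    using assms by (auto simp: ressum_def bracket_def field_simps)
  show "l2 (\<lambda>m. 1 / ressum n m)" "l2norm (\<lambda>m. 1 / ressum n m) \<le> inv_bracket_norm"
    using l2_mono[OF l2_inv_bracket le] by (auto simp: inv_bracket_norm_def)
qed

lemma inv_ressum_tendsto_0: "(\<lambda>n. l2norm (\<lambda>m. 1 / ressum n m)) \<longlonglongrightarrow> 0"
proof -
  have "(\<lambda>n. \<Sum>\<^sub>\<infinity>m. (1 / ressum (Suc n) m)\<^sup>2) \<longlonglongrightarrow> 0"
  proof (rule infsum_dominated_tendsto_0)
    show "(\<lambda>m. (1 / bracket m)\<^sup>2) summable_on UNIV" using l2_inv_bracket by (simp add: l2_def)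
    show "(1 / ressum (Suc n) m)\<^sup>2 \<le> (1 / bracket m)\<^sup>2" for n m
      by (intro power_mono divide_left_mono) (auto simp: ressum_def bracket_def)
    have "(\<lambda>n. 1 / ressum (Suc n) m) \<longlonglongrightarrow> 0" for m
    proof (rule Lim_null_comparison[OF always_eventually[OF allI] LIMSEQ_inverse_real_of_nat])
      show "norm (1 / ressum (Suc n) m) \<le> inverse (real (Suc n))" for n
        unfolding inverse_eq_divide using ressum_ge[of "Suc n" m] by (simp add: frac_le)
    qed
    from tendsto_power[OF this, where n=2] show "(\<lambda>n. (1 / ressum (Suc n) m)\<^sup>2) \<longlonglongrightarrow> 0" for m by simp
  qed auto
  from tendsto_real_sqrt[OF this] have "(\<lambda>n. l2norm (\<lambda>m. 1 / ressum (Suc n) m)) \<longlonglongrightarrow> 0"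
    by (simp add: l2norm_def power_divide)
  then show ?thesis by (simp add: filterlim_sequentially_Suc[of "\<lambda>n. l2norm (\<lambda>m. 1 / ressum n m)"])
qed

lemma l2_damped:
  assumes "l2 \<omega>" shows "l2 (damped n \<omega>)" "l2norm (damped n \<omega>) \<le> l2norm \<omega>"
proof -
  have le: "norm (damped n \<omega> j) \<le> norm (\<omega> j)" for j
    unfolding damped_def by (simp add: abs_mult mult_left_le)
  show "l2 (damped n \<omega>)" "l2norm (damped n \<omega>) \<le> l2norm \<omega>" using l2_mono[OF assms le] by auto
qed

lemma damped_tendsto_0:
  assumes "l2 \<omega>" shows "(\<lambda>n. l2norm (damped n \<omega>)) \<longlonglongrightarrow> 0"
proof -
  have "(\<lambda>n. \<Sum>\<^sub>\<infinity>j. (damped n \<omega> j)\<^sup>2) \<longlonglongrightarrow> 0"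
  proof (rule infsum_dominated_tendsto_0)
    show "(\<lambda>j. (\<omega> j)\<^sup>2) summable_on UNIV" using assms by (simp add: l2_def)
    show "(damped n \<omega> j)\<^sup>2 \<le> (\<omega> j)\<^sup>2" for n j
      unfolding damped_def power_mult_distrib by (rule mult_left_le) (auto intro!: power_le_one)
    have "(\<lambda>n. damped n \<omega> j) \<longlonglongrightarrow> 0" for j
    proof -
      have "(\<lambda>n. bracket j / real n) \<longlonglongrightarrow> 0" by (rule lim_const_over_n)
      then have "(\<lambda>n. \<omega> j * min 1 (bracket j / real n)) \<longlonglongrightarrow> \<omega> j * min 1 0"
        by (intro tendsto_intros)
      then show ?thesis by (simp add: damped_def)
    qed
    from tendsto_power[OF this, where n=2] show "(\<lambda>n. (damped n \<omega> j)\<^sup>2) \<longlonglongrightarrow> 0" for j by simp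
  qed auto
  from tendsto_real_sqrt[OF this] show ?thesis by (simp add: l2norm_def)
qed

text \<open>The numerator is absorbed by one of the two denominators, because
  \<open>\<bar>m - k\<bar> \<le> \<bar>m\<bar> + n + \<bar>\<bar>k\<bar> - n\<bar>\<close>.  For \<open>\<bar>m - k\<bar> \<le> n\<close> the cruder bound \<open>n \<le> ressum n m\<close> already gives the
  factor \<open>bracket (m - k) / n\<close>.  Each summand on the right is a product in the variables \<open>m - k\<close> and \<open>m\<close>, or \<open>m - k\<close>
  and \<open>k\<close>, whose Hilbert-Schmidt norm is a product of two norms.\<close>

lemma kern_le:
  assumes "0 < n" "0 \<le> \<omega> (m - k)"
  shows "kern n \<omega> (m,k) \<le> \<omega> (m - k) * (1 / ressum n m) + damped n \<omega> (m - k) * (1 / resdist n k)"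
proof -
  have r: "0 < ressum n m" using assms by (rule_tac ressum_pos)
  have "bracket (m - k) / (ressum n m * resdist n k) \<le> 1 / ressum n m + min 1 (bracket (m-k) / n) * (1 / resdist n k)"
  proof (cases "bracket (m - k) \<le> n")
    case True
    have "bracket (m - k) / (ressum n m * resdist n k) \<le> bracket (m - k) / (n * resdist n k)"
      using assms r ressum_ge[of n m] by (intro divide_left_mono mult_right_mono) auto
    also have "\<dots> = min 1 (bracket (m-k) / n) * (1 / resdist n k)"
      using True assms by (subst min_absorb2) (auto simp: field_simps)
    finally show ?thesis using r by (simp add: add_increasing)
  next
    case False
    have "bracket (m - k) \<le> ressum n m + resdist n k"
      using assms by (auto simp: bracket_def ressum_def resdist_def)
    then have "bracket (m - k) / (ressum n m * resdist n k) \<le> (ressum n m + resdist n k) / (ressum n m * resdist n k)"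
      using r by (intro divide_right_mono) auto
    also have "\<dots> = 1 / ressum n m + 1 / resdist n k" using r by (simp add: field_simps)
    finally show ?thesis using False assms by (simp add: min_def field_simps)
  qed
  then have "\<omega> (m - k) * (bracket (m - k) / (ressum n m * resdist n k)) \<le> \<omega> (m - k) * (1 / ressum n m + min 1 (bracket (m-k) / n) * (1 / resdist n k))"
    using assms by (intro mult_left_mono) auto
  then show ?thesis by (simp add: kern_def damped_def algebra_simps)
qed

lemma bij_shear: "bij (\<lambda>(m::int,k::int). (m - k, k))" "bij (\<lambda>(m::int,k::int). (m - k, m))"
  by (rule o_bij[where g="\<lambda>(j,k). (j + k, k)"] o_bij[where g="\<lambda>(j,m). (m, m - j)"]; auto simp: fun_eq_iff)+

lemma l2_kern:
  assumes "0 < n" "\<And>j. 0 \<le> \<omega> j" "l2 \<omega>"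
  shows "l2 (kern n \<omega>)"
    and "l2norm (kern n \<omega>) \<le> l2norm \<omega> * l2norm (\<lambda>m. 1 / ressum n m) + 2 * inv_bracket_norm * l2norm (damped n \<omega>)"
    and "l2norm (kern n \<omega>) \<le> 3 * inv_bracket_norm * l2norm \<omega>"
proof -
  note r = l2_inv_ressum[OF assms(1)]
  note d = l2_inv_resdist[of n]
  note c = l2_damped[OF assms(3), of n]
  have A: "l2 (\<lambda>(m,k). \<omega> (m - k) * (1 / ressum n m))" "l2norm (\<lambda>(m,k). \<omega> (m - k) * (1 / ressum n m)) = l2norm \<omega> * l2norm (\<lambda>m. 1 / ressum n m)"
    using l2_tensor[OF assms(3) r(1)] l2_bij[OF bij_shear(2), of "\<lambda>(j,m). \<omega> j * (1 / ressum n m)"]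
    by (auto simp: case_prod_unfold)
  have B: "l2 (\<lambda>(m,k). damped n \<omega> (m - k) * (1 / resdist n k))" 
    "l2norm (\<lambda>(m,k). damped n \<omega> (m - k) * (1 / resdist n k)) = l2norm (damped n \<omega>) * l2norm (\<lambda>m. 1 / resdist n m)"
    using l2_tensor[OF c(1) d(1)] l2_bij[OF bij_shear(1), of "\<lambda>(j,m). damped n \<omega> j * (1 / resdist n m)"]
    by (auto simp: case_prod_unfold)
  note AB = l2_add[OF A(1) B(1)]
  have le: "norm (kern n \<omega> p) \<le> norm ((\<lambda>(m,k). \<omega> (m - k) * (1 / ressum n m)) p + (\<lambda>(m,k). damped n \<omega> (m - k) * (1 / resdist n k)) p)" for p
  proof -
    obtain m k where p: "p = (m,k)" by (cases p)
    have "0 \<le> kern n \<omega> (m,k)" using assms ressum_pos[OF assms(1), of m] by (auto simp: kern_def)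
    then show ?thesis using kern_le[of n \<omega> m k] assms unfolding p by simp
  qed
  note L = l2_mono[OF AB(1) le]
  show "l2 (kern n \<omega>)" by (rule L(1))
  have *: "l2norm (damped n \<omega>) * l2norm (\<lambda>m. 1 / resdist n m) \<le> l2norm (damped n \<omega>) * (2 * inv_bracket_norm)"
    by (intro mult_left_mono d) auto
  show 1: "l2norm (kern n \<omega>) \<le> l2norm \<omega> * l2norm (\<lambda>m. 1 / ressum n m) + 2 * inv_bracket_norm * l2norm (damped n \<omega>)"
    using L(2) AB(2) A(2) B(2) * by (simp add: mult.commute)
  have "l2norm \<omega> * l2norm (\<lambda>m. 1 / ressum n m) \<le> l2norm \<omega> * inv_bracket_norm" by (intro mult_left_mono r) auto
  moreover have "0 \<le> inv_bracket_norm" by (simp add: inv_bracket_norm_def)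
  then have "inv_bracket_norm * l2norm (damped n \<omega>) \<le> inv_bracket_norm * l2norm \<omega>" by (intro mult_left_mono c)
  ultimately show "l2norm (kern n \<omega>) \<le> 3 * inv_bracket_norm * l2norm \<omega>" using 1 by (simp add: algebra_simps)
qed

text \<open>Square summability of \<open>\<omega>\<close> suffices, without a rate.  This is why potentials in \<open>H\<^sup>-\<^sup>1\<close> are small perturbations
  at high energy.\<close>

lemma kern_tendsto_0:
  assumes "\<And>j. 0 \<le> \<omega> j" "l2 \<omega>"
  shows "(\<lambda>n. l2norm (kern n \<omega>)) \<longlonglongrightarrow> 0"
proof (rule tendsto_sandwich[of "\<lambda>_. 0" _ _ "\<lambda>n. l2norm \<omega> * l2norm (\<lambda>m. 1 / ressum n m) + 2 * inv_bracket_norm * l2norm (damped n \<omega>)"])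
  show "\<forall>\<^sub>F n in sequentially. l2norm (kern n \<omega>) \<le> l2norm \<omega> * l2norm (\<lambda>m. 1 / ressum n m) + 2 * inv_bracket_norm * l2norm (damped n \<omega>)"
    using eventually_gt_at_top[of 0] by eventually_elim (use assms l2_kern(2) in auto)
  have "(\<lambda>n. l2norm \<omega> * l2norm (\<lambda>m. 1 / ressum n m) + 2 * inv_bracket_norm * l2norm (damped n \<omega>)) \<longlonglongrightarrow> l2norm \<omega> * 0 + 2 * inv_bracket_norm * 0"
    by (intro tendsto_intros inv_ressum_tendsto_0 damped_tendsto_0 assms)
  then show "(\<lambda>n. l2norm \<omega> * l2norm (\<lambda>m. 1 / ressum n m) + 2 * inv_bracket_norm * l2norm (damped n \<omega>)) \<longlonglongrightarrow> 0" by simp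
qed auto

section \<open>Hermitian forms with compact sublevel sets\<close>

text \<open>Elimination of one unknown; a dimension count for finitely many linear functionals that presupposes no
  ambient vector space structure.\<close>

lemma homogeneous_system_nontrivial:
  fixes a :: "nat \<Rightarrow> 'i \<Rightarrow> complex"
  assumes "finite I" "J < card I"
  shows "\<exists>c. (\<exists>i\<in>I. c i \<noteq> 0) \<and> (\<forall>j<J. (\<Sum>i\<in>I. a j i * c i) = 0)"
  using assms
proof (induction J arbitrary: I a)
  case 0
  then show ?case by (intro exI[of _ "\<lambda>_. 1"]) (auto simp: card_gt_0_iff)
next
  case (Suc J)
  show ?case
  proof (cases "\<forall>i\<in>I. a J i = 0")
    case True
    obtain c where "\<exists>i\<in>I. c i \<noteq> 0" "\<forall>j<J. (\<Sum>i\<in>I. a j i * c i) = 0"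
      using Suc.IH[of I a] Suc.prems by auto
    then show ?thesis using True by (intro exI[of _ c]) (auto simp: less_Suc_eq)
  next
    case False
    then obtain p where p: "p \<in> I" "a J p \<noteq> 0" by auto
    define I' where "I' = I - {p}"
    have I': "finite I'" "J < card I'" "p \<notin> I'" "I = insert p I'"
      using Suc.prems p by (auto simp: I'_def)
    obtain c where c: "\<exists>i\<in>I'. c i \<noteq> 0" 
      "\<And>j. j < J \<Longrightarrow> (\<Sum>i\<in>I'. (a j i - a j p * a J i / a J p) * c i) = 0"
      using Suc.IH[OF I'(1,2), of "\<lambda>j i. a j i - a j p * a J i / a J p"] by auto
    define c' where "c' = c(p := - (\<Sum>i\<in>I'. a J i * c i) / a J p)"
    have eq: "(\<Sum>i\<in>I. a j i * c' i) = (\<Sum>i\<in>I'. (a j i - a j p * a J i / a J p) * c i)" for j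
    proof -
      have "(\<Sum>i\<in>I. a j i * c' i) = a j p * c' p + (\<Sum>i\<in>I'. a j i * c i)"
        using I' by (auto simp: c'_def intro!: sum.cong)
      also have "a j p * c' p = - (\<Sum>i\<in>I'. a j p * a J i / a J p * c i)"
        by (simp add: c'_def sum_distrib_left sum_divide_distrib mult.assoc)
      finally show ?thesis by (simp add: algebra_simps sum_subtractf)
    qed
    have "(\<Sum>i\<in>I. a J i * c' i) = 0" unfolding eq using p by simp
    moreover have "\<exists>i\<in>I. c' i \<noteq> 0" using c(1) I' by (auto simp: c'_def)
    ultimately show ?thesis using c(2) eq by (intro exI[of _ c']) (auto simp: less_Suc_eq)
  qed
qed

locale sesquilinear =
  fixes X :: "('i \<Rightarrow> complex) set" and B :: "('i \<Rightarrow> complex) \<Rightarrow> ('i \<Rightarrow> complex) \<Rightarrow> complex"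
  assumes zero_mem: "(\<lambda>_. 0) \<in> X"
    and add_mem: "x \<in> X \<Longrightarrow> y \<in> X \<Longrightarrow> (\<lambda>i. x i + y i) \<in> X"
    and scale_mem: "x \<in> X \<Longrightarrow> (\<lambda>i. c * x i) \<in> X"
    and add_left: "x \<in> X \<Longrightarrow> y \<in> X \<Longrightarrow> z \<in> X \<Longrightarrow> B (\<lambda>i. x i + y i) z = B x z + B y z"
    and scale_left: "x \<in> X \<Longrightarrow> z \<in> X \<Longrightarrow> B (\<lambda>i. c * x i) z = c * B x z"
    and hermitian: "x \<in> X \<Longrightarrow> y \<in> X \<Longrightarrow> B y x = cnj (B x y)"
begin

lemma zero_left: "z \<in> X \<Longrightarrow> B (\<lambda>_. 0) z = 0"
  using scale_left[OF zero_mem, of z 0] by simp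

lemma sum_mem: "finite I \<Longrightarrow> (\<And>j. j \<in> I \<Longrightarrow> e j \<in> X) \<Longrightarrow> (\<lambda>i. \<Sum>j\<in>I. c j * e j i) \<in> X"
proof (induction I rule: finite_induct)
  case (insert j I)
  then show ?case using add_mem[OF scale_mem[of "e j" "c j"], of "\<lambda>i. \<Sum>j\<in>I. c j * e j i"] by auto
qed (use zero_mem in auto)

lemma sum_left: "finite I \<Longrightarrow> (\<And>j. j \<in> I \<Longrightarrow> e j \<in> X) \<Longrightarrow> z \<in> X \<Longrightarrow> 
  B (\<lambda>i. \<Sum>j\<in>I. c j * e j i) z = (\<Sum>j\<in>I. c j * B (e j) z)"
proof (induction I rule: finite_induct)
  case (insert j I)
  then show ?case
    using add_left[OF scale_mem[of "e j" "c j"] sum_mem[of I e c], of z] by (simp add: scale_left)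
qed (use zero_left in auto)

lemma scale_right: "x \<in> X \<Longrightarrow> z \<in> X \<Longrightarrow> B z (\<lambda>i. c * x i) = cnj c * B z x"
  by (subst hermitian[OF scale_mem[of x c], of z]) (auto simp: scale_left hermitian[of x z])

lemma add_right: "x \<in> X \<Longrightarrow> y \<in> X \<Longrightarrow> z \<in> X \<Longrightarrow> B z (\<lambda>i. x i + y i) = B z x + B z y"
  by (subst hermitian[OF add_mem[of x y], of z]) (auto simp: add_left hermitian[of x z] hermitian[of y z])

lemma diff_mem: "x \<in> X \<Longrightarrow> y \<in> X \<Longrightarrow> (\<lambda>i. x i - y i) \<in> X"
  using add_mem[of x "\<lambda>i. -1 * y i"] scale_mem[of y "-1"] by auto

lemma diff_left: "x \<in> X \<Longrightarrow> y \<in> X \<Longrightarrow> z \<in> X \<Longrightarrow> B (\<lambda>i. x i - y i) z = B x z - B y z"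
  using add_left[of x "\<lambda>i. -1 * y i" z] scale_mem[of y "-1"] scale_left[of y z "-1"] by auto

lemma diag_real: "x \<in> X \<Longrightarrow> Im (B x x) = 0"
  using hermitian[of x x] by (metis Im_complex_of_real cnj.simps(2) equal_neg_zero)

lemma diag_expand:
  assumes "x \<in> X" "y \<in> X"
  shows "Re (B (\<lambda>i. x i + c * y i) (\<lambda>i. x i + c * y i)) = Re (B x x) + 2 * Re (c * B y x) + (cmod c)\<^sup>2 * Re (B y y)"
proof -
  have m: "(\<lambda>i. c * y i) \<in> X" by (rule scale_mem[OF assms(2)])
  have m2: "(\<lambda>i. x i + c * y i) \<in> X" by (rule add_mem[OF assms(1) m])
  have "B (\<lambda>i. x i + c * y i) (\<lambda>i. x i + c * y i) = B x x + cnj c * B x y + (c * B y x + c * (cnj c * B y y))"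
    by (simp add: add_left[OF assms(1) m m2] scale_left[OF assms(2) m2] add_right assms m scale_right distrib_left)
  moreover have "cnj c * B x y = cnj (c * B y x)" using hermitian[OF assms(2,1)] by simp
  moreover have "c * (cnj c * B y y) = of_real ((cmod c)\<^sup>2) * B y y"
    by (simp add: complex_norm_square[of c] mult.assoc del: of_real_power)
  ultimately show ?thesis by simp
qed

text \<open>A nonnegative form vanishing on the diagonal at \<open>x\<close> has \<open>x\<close> in its radical: otherwise a
  small multiple of \<open>y\<close> would make the form negative.\<close>

lemma null_vector_in_radical:
  assumes "x \<in> X" "y \<in> X" "Re (B x x) = 0"
    and nonneg: "\<And>c. 0 \<le> Re (B (\<lambda>i. x i + c * y i) (\<lambda>i. x i + c * y i))"
  shows "B y x = 0"
proof (rule ccontr)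
  assume nz: "B y x \<noteq> 0"
  define N where "N = (cmod (B y x))\<^sup>2"
  have N: "N > 0" using nz by (simp add: N_def)
  have *: "0 \<le> - 2 * d * N + d\<^sup>2 * N * Re (B y y)" if "d > 0" for d :: real
  proof -
    have "Re (of_real (-d) * cnj (B y x) * B y x) = - d * N"
    proof -
      have "of_real (-d) * cnj (B y x) * B y x = of_real (- d * N)"
        unfolding N_def of_real_mult complex_norm_square by (simp add: mult.commute)
      then show ?thesis by (simp only: Re_complex_of_real)
    qed
    then show ?thesis
      using nonneg[of "of_real (-d) * cnj (B y x)"] that 
      by (subst (asm) diag_expand[OF assms(1,2)]) (simp add: assms(3) N_def norm_mult power_mult_distrib mult.assoc)
  qed
  define r where "r = max 1 (Re (B y y))"
  have "0 \<le> - 2 * (1/r) * N + (1/r)\<^sup>2 * N * Re (B y y)" by (rule *) (simp add: r_def)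
  also have "\<dots> \<le> - 2 * (1/r) * N + (1/r)\<^sup>2 * N * r"
    using N by (intro add_left_mono mult_left_mono) (auto simp: r_def)
  also have "\<dots> = - (N / r)"
  proof -
    have "r > 0" by (simp add: r_def)
    then show ?thesis by (simp add: power2_eq_square field_simps)
  qed
  also have "\<dots> < 0"
  proof -
    have "r > 0" by (simp add: r_def)
    then show ?thesis using N by simp
  qed
  finally show False by simp
qed

end

text \<open>An unbounded semibounded operator is represented by its form \<open>A\<close> on the form domain \<open>X\<close>.  The sequential
  condition is all that is needed of compactness of the resolvent: a normalised sequence with convergent energy
  clusters weakly at a normalised vector, and the form is lower semicontinuous along it.\<close>

locale compact_form = ip: sesquilinear X ip + form: sesquilinear X A
  for X :: "('i \<Rightarrow> complex) set" and ip A +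
  assumes ip_pos: "x \<in> X \<Longrightarrow> x \<noteq> (\<lambda>_. 0) \<Longrightarrow> 0 < Re (ip x x)"
    and bounded_below: "\<exists>c. \<forall>x\<in>X. c * Re (ip x x) \<le> Re (A x x)"
    and compact_sublevel: "(\<And>k::nat. xs k \<in> X) \<Longrightarrow> (\<And>k. ip (xs k) (xs k) = 1) \<Longrightarrow>
      (\<lambda>k. Re (A (xs k) (xs k))) \<longlonglongrightarrow> a \<Longrightarrow>
      \<exists>r x. strict_mono r \<and> x \<in> X \<and> ip x x = 1 \<and> Re (A x x) \<le> a \<and>
        (\<forall>y\<in>X. (\<lambda>k. ip (xs (r k)) y) \<longlonglongrightarrow> ip x y)"
    and infinite_dim: "(\<And>j. j < (n::nat) \<Longrightarrow> f j \<in> X) \<Longrightarrow> \<exists>x\<in>X. x \<noteq> (\<lambda>_. 0) \<and> (\<forall>j<n. ip x (f j) = 0)"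
begin

definition eigenpair :: "('i \<Rightarrow> complex) \<Rightarrow> real \<Rightarrow> bool" where
  "eigenpair x l \<longleftrightarrow> x \<in> X \<and> (\<forall>y\<in>X. A x y = of_real l * ip x y)"

lemma normalize:
  assumes "x \<in> X" "x \<noteq> (\<lambda>_. 0)"
  obtains c where "ip (\<lambda>i. c * x i) (\<lambda>i. c * x i) = 1" "c \<noteq> 0"
proof -
  define c where "c = complex_of_real (1 / sqrt (Re (ip x x)))"
  have p: "0 < Re (ip x x)" by (rule ip_pos[OF assms])
  have i: "ip x x = of_real (Re (ip x x))" using ip.diag_real[OF assms(1)] by (simp add: complex_eq_iff)
  have "ip (\<lambda>i. c * x i) (\<lambda>i. c * x i) = c * (cnj c * ip x x)"
    by (simp add: ip.scale_left ip.scale_right ip.scale_mem assms)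
  also have "\<dots> = of_real ((1 / sqrt (Re (ip x x))) * (1 / sqrt (Re (ip x x))) * Re (ip x x))"
    by (subst i) (simp only: c_def complex_cnj_complex_of_real of_real_mult mult.assoc)
  also have "\<dots> = 1" using p by (simp add: field_simps)
  finally show ?thesis using p by (intro that[of c]) (auto simp: c_def)
qed

text \<open>A minimiser \<open>x\<close> of the form on the orthogonal complement of the earlier eigenvectors exists by compactness.
  With \<open>a\<close> the minimum, \<open>A - a ip\<close> is nonnegative on that complement and vanishes at \<open>x\<close>, so \<open>x\<close> lies in its radical;
  on the earlier eigenvectors the eigenvalue equation for \<open>x\<close> holds because both of its sides vanish.\<close>

lemma next_eigenpair:
  fixes n :: nat
  assumes f: "\<And>j. j < n \<Longrightarrow> eigenpair (f j) (l j)"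
    and orthonormal: "\<And>i j. i < n \<Longrightarrow> j < n \<Longrightarrow> ip (f i) (f j) = (if i = j then 1 else 0)"
  shows "\<exists>x a. eigenpair x a \<and> ip x x = 1 \<and> (\<forall>j<n. ip x (f j) = 0) \<and>
    (\<forall>y\<in>X. (\<forall>j<n. ip y (f j) = 0) \<longrightarrow> a * Re (ip y y) \<le> Re (A y y))"
proof -
  define Y where "Y = {y\<in>X. \<forall>j<n. ip y (f j) = 0}"
  have fX: "f j \<in> X" if "j < n" for j using f[OF that] by (simp add: eigenpair_def)
  have YX: "y \<in> X" if "y \<in> Y" for y using that by (simp add: Y_def)
  have Ylin: "(\<lambda>i. x i + c * y i) \<in> Y" "(\<lambda>i. c * y i) \<in> Y" if "x \<in> Y" "y \<in> Y" for x y c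
    using that fX by (auto simp: Y_def ip.add_mem ip.scale_mem ip.add_left ip.scale_left)
  define S where "S = (\<lambda>y. Re (A y y)) ` {y\<in>Y. ip y y = 1}"
  obtain y0 where y0: "y0 \<in> Y" "y0 \<noteq> (\<lambda>_. 0)" using infinite_dim[of n f] fX by (auto simp: Y_def)
  obtain c0 where c0: "ip (\<lambda>i. c0 * y0 i) (\<lambda>i. c0 * y0 i) = 1" using normalize[of y0] y0 YX by blast
  have S0: "S \<noteq> {}" using Ylin(2)[OF y0(1) y0(1)] c0 by (auto simp: S_def)
  obtain c where c: "\<And>x. x \<in> X \<Longrightarrow> c * Re (ip x x) \<le> Re (A x x)" using bounded_below by blast
  have bdd: "bdd_below S" unfolding S_def
  proof (rule bdd_belowI2)
    fix y assume "y \<in> {y\<in>Y. ip y y = 1}"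
    then show "c \<le> Re (A y y)" using c[OF YX, of y] by auto
  qed
  define a where "a = Inf S"
  have "\<exists>y. y \<in> Y \<and> ip y y = 1 \<and> Re (A y y) < a + 1 / real (Suc k)" for k
  proof -
    have "Inf S < a + 1 / real (Suc k)" by (simp add: a_def)
    then show ?thesis unfolding cInf_less_iff[OF S0 bdd] by (auto simp: S_def)
  qed
  then obtain xs where xs: "\<And>k. xs k \<in> Y" "\<And>k. ip (xs k) (xs k) = 1" "\<And>k. Re (A (xs k) (xs k)) < a + 1 / real (Suc k)"
    by metis
  have lower: "a \<le> Re (A y y)" if "y \<in> Y" "ip y y = 1" for y
    unfolding a_def by (rule cInf_lower[OF _ bdd]) (use that in \<open>auto simp: S_def\<close>)
  have "(\<lambda>k. Re (A (xs k) (xs k))) \<longlonglongrightarrow> a"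
  proof (rule tendsto_sandwich[of "\<lambda>_. a" _ _ "\<lambda>k. a + 1 / real (Suc k)"])
    have "(\<lambda>k. a + 1 / real (Suc k)) \<longlonglongrightarrow> a + 0"
      by (intro tendsto_intros LIMSEQ_Suc[OF lim_1_over_n])
    then show "(\<lambda>k. a + 1 / real (Suc k)) \<longlonglongrightarrow> a" by simp
    show "\<forall>\<^sub>F k in sequentially. Re (A (xs k) (xs k)) \<le> a + 1 / real (Suc k)"
      using xs(3) by (intro always_eventually allI less_imp_le)
  qed (use xs lower in auto)
  from compact_sublevel[of xs, OF YX[OF xs(1)] xs(2) this]
  obtain r x where rx: "strict_mono r" "x \<in> X" "ip x x = 1" "Re (A x x) \<le> a"
    "\<And>y. y \<in> X \<Longrightarrow> (\<lambda>k. ip (xs (r k)) y) \<longlonglongrightarrow> ip x y" by blast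
  have xY: "x \<in> Y" unfolding Y_def
  proof (intro CollectI conjI rx allI impI)
    fix j assume j: "j < n"
    have "(\<lambda>k. ip (xs (r k)) (f j)) \<longlonglongrightarrow> ip x (f j)" by (rule rx(5)[OF fX[OF j]])
    moreover have "ip (xs (r k)) (f j) = 0" for k using xs(1)[of "r k"] j by (simp add: Y_def)
    ultimately show "ip x (f j) = 0" by (simp add: LIMSEQ_const_iff)
  qed
  have low2: "a * Re (ip y y) \<le> Re (A y y)" if y: "y \<in> Y" for y
  proof (cases "y = (\<lambda>_. 0)")
    case True
    then show ?thesis using ip.zero_left form.zero_left ip.zero_mem by simp
  next
    case False
    obtain c where c: "ip (\<lambda>i. c * y i) (\<lambda>i. c * y i) = 1" "c \<noteq> 0" using normalize[OF YX[OF y] False] by blast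
    have sc: "Re (B (\<lambda>i. c * y i) (\<lambda>i. c * y i)) = (cmod c)\<^sup>2 * Re (B y y)" if "sesquilinear X B" for B
    proof -
      interpret sesquilinear X B by fact
      have "B (\<lambda>i. c * y i) (\<lambda>i. c * y i) = of_real ((cmod c)\<^sup>2) * B y y"
        by (simp add: scale_left scale_right scale_mem YX[OF y] complex_norm_square[of c] mult.assoc del: of_real_power)
      then show ?thesis by simp
    qed
    have "a \<le> (cmod c)\<^sup>2 * Re (A y y)"
      using lower[OF Ylin(2)[OF y y] c(1)] sc[OF form.sesquilinear_axioms] by simp
    moreover have "(cmod c)\<^sup>2 * Re (ip y y) = 1" using sc[OF ip.sesquilinear_axioms] c(1) by simp
    ultimately have "(cmod c)\<^sup>2 * (a * Re (ip y y)) \<le> (cmod c)\<^sup>2 * Re (A y y)" by (metis mult.left_commute mult.right_neutral)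
    then show ?thesis using c(2) by simp
  qed
  have eqa: "Re (A x x) = a" using rx(3,4) lower[OF xY] by auto
  define B where "B = (\<lambda>x y. A x y - of_real a * ip x y)"
  interpret B: sesquilinear X B
  proof unfold_locales
    fix x y assume "x \<in> X" "y \<in> X"
    then show "B y x = cnj (B x y)"
      unfolding B_def by (subst ip.hermitian[of x y], simp_all, subst form.hermitian[of x y], simp_all)
  qed (auto simp: B_def ip.zero_mem ip.add_mem ip.scale_mem ip.add_left form.add_left
        ip.scale_left form.scale_left algebra_simps)
  have orth: "B y x = 0" if y: "y \<in> Y" for y
  proof (rule B.null_vector_in_radical[OF rx(2) YX[OF y]])
    show "Re (B x x) = 0" using eqa rx(3) by (simp add: B_def)
    fix c show "0 \<le> Re (B (\<lambda>i. x i + c * y i) (\<lambda>i. x i + c * y i))"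
      using low2[OF Ylin(1)[OF xY y, of c]] by (simp add: B_def)
  qed
  have "A x y = of_real a * ip x y" if y: "y \<in> X" for y
  proof -
    define p where "p = (\<lambda>i. \<Sum>j<n. ip y (f j) * f j i)"
    have pX: "p \<in> X" unfolding p_def by (rule ip.sum_mem) (use fX in auto)
    define y' where "y' = (\<lambda>i. y i - p i)"
    have y'X: "y' \<in> X" unfolding y'_def by (rule ip.diff_mem[OF y pX])
    have "ip y' (f j) = 0" if j: "j < n" for j
    proof -
      have "ip p (f j) = (\<Sum>i<n. ip y (f i) * ip (f i) (f j))"
        unfolding p_def by (rule ip.sum_left) (use fX j in auto)
      also have "\<dots> = (\<Sum>i<n. if i = j then ip y (f i) else 0)"
        by (intro sum.cong) (auto simp: orthonormal j)
      also have "\<dots> = ip y (f j)" using j by simp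
      finally show ?thesis unfolding y'_def using ip.diff_left[OF y pX fX[OF j]] by simp
    qed
    then have y'Y: "y' \<in> Y" using y'X by (simp add: Y_def)
    have "B p x = (\<Sum>j<n. ip y (f j) * B (f j) x)"
      unfolding p_def by (rule B.sum_left) (use fX rx in auto)
    also have "\<dots> = 0"
    proof (intro sum.neutral ballI)
      fix j assume "j \<in> {..<n}"
      then have j: "j < n" by simp
      have "ip (f j) x = 0" using xY j ip.hermitian[OF rx(2) fX[OF j]] by (simp add: Y_def)
      then show "ip y (f j) * B (f j) x = 0" using f[OF j] rx(2) by (simp add: B_def eigenpair_def)
    qed
    finally have "B y x = 0"
      using orth[OF y'Y] B.diff_left[OF y pX rx(2)] by (simp add: y'_def)
    then have "B x y = 0" using B.hermitian[OF y rx(2)] by simp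
    then show ?thesis by (simp add: B_def)
  qed
  then have "eigenpair x a" using rx by (auto simp: eigenpair_def)
  then show ?thesis using rx(3) xY low2 by (intro exI[of _ x] exI[of _ a]) (auto simp: Y_def)
qed

text \<open>The last clause is the extremal property from which the min-max bounds and the completeness of the eigenvectors
  below any given energy are read off.\<close>

definition spectral_sequence :: "(nat \<Rightarrow> real) \<Rightarrow> (nat \<Rightarrow> 'i \<Rightarrow> complex) \<Rightarrow> bool" where
  "spectral_sequence l e \<longleftrightarrow> mono l \<and> (\<forall>j. eigenpair (e j) (l j)) \<and>
     (\<forall>i j. ip (e i) (e j) = (if i = j then 1 else 0)) \<and>
     (\<forall>j. \<forall>y\<in>X. (\<forall>i<j. ip y (e i) = 0) \<longrightarrow> l j * Re (ip y y) \<le> Re (A y y))"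

theorem spectral_sequence_exists: "\<exists>l e. spectral_sequence l e"
proof -
  define good where "good = (\<lambda>n (s :: (('i \<Rightarrow> complex) \<times> real) list). length s = n \<and>
     (\<forall>j<n. eigenpair (fst (s!j)) (snd (s!j))) \<and>
     (\<forall>i<n. \<forall>j<n. ip (fst (s!i)) (fst (s!j)) = (if i = j then 1 else 0)) \<and>
     (\<forall>j<n. \<forall>y\<in>X. (\<forall>i<j. ip y (fst (s!i)) = 0) \<longrightarrow> snd (s!j) * Re (ip y y) \<le> Re (A y y)))"
  have "\<exists>f. \<forall>n. good n (f n) \<and> (\<exists>z. f (Suc n) = f n @ [z])"
  proof (rule dependent_nat_choice)
    show "\<exists>s. good 0 s" by (auto simp: good_def)
    fix s n assume g: "good n s"
    have "\<exists>x a. eigenpair x a \<and> ip x x = 1 \<and> (\<forall>j<n. ip x (fst (s!j)) = 0) \<and>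
        (\<forall>y\<in>X. (\<forall>j<n. ip y (fst (s!j)) = 0) \<longrightarrow> a * Re (ip y y) \<le> Re (A y y))"
      by (rule next_eigenpair[of n "\<lambda>j. fst (s!j)" "\<lambda>j. snd (s!j)"]) (use g in \<open>auto simp: good_def\<close>)
    then obtain x a where xa: "eigenpair x a" "ip x x = 1" "\<And>j. j < n \<Longrightarrow> ip x (fst (s!j)) = 0"
      "\<And>y. y \<in> X \<Longrightarrow> (\<forall>j<n. ip y (fst (s!j)) = 0) \<Longrightarrow> a * Re (ip y y) \<le> Re (A y y)"
      by blast
    have xa': "ip (fst (s!j)) x = 0" if "j < n" for j
      using xa(3)[OF that] ip.hermitian[of x "fst (s!j)"] xa(1) g that by (auto simp: good_def eigenpair_def)
    have "good (Suc n) (s @ [(x,a)])"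
      using g xa xa' by (auto simp: good_def nth_append less_Suc_eq)
    then show "\<exists>t. good (Suc n) t \<and> (\<exists>z. t = s @ [z])" by blast
  qed
  then obtain f where f: "\<And>n. good n (f n)" "\<And>n. \<exists>z. f (Suc n) = f n @ [z]" by blast
  define e where "e j = fst (f (Suc j) ! j)" for j
  define l where "l j = snd (f (Suc j) ! j)" for j
  have len: "length (f n) = n" for n using f(1)[of n] by (simp add: good_def)
  have nth: "f n ! j = f (Suc j) ! j" if "j < n" for n j
    using that
  proof (induction n)
    case (Suc n)
    show ?case
    proof (cases "j = n")
      case False
      then have "j < n" using Suc by simp
      then show ?thesis using Suc.IH f(2)[of n] len[of n] by (auto simp: nth_append)
    qed simp
  qed simp
  have eig: "eigenpair (e j) (l j)" for j using f(1)[of "Suc j"] by (auto simp: good_def e_def l_def)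
  have orth: "ip (e i) (e j) = (if i = j then 1 else 0)" for i j
  proof -
    define n where "n = Suc (max i j)"
    have ij: "i < n" "j < n" by (auto simp: n_def)
    have "ip (fst (f n ! i)) (fst (f n ! j)) = (if i = j then 1 else 0)"
      using f(1)[of n] ij unfolding good_def by blast
    then show ?thesis using nth[OF ij(1)] nth[OF ij(2)] by (simp add: e_def)
  qed
  have minl: "l j * Re (ip y y) \<le> Re (A y y)" if "y \<in> X" "\<And>i. i < j \<Longrightarrow> ip y (e i) = 0" for j y
  proof -
    have "\<forall>i<j. ip y (fst (f (Suc j) ! i)) = 0" using that(2) nth[of _ "Suc j"] by (auto simp: e_def)
    then show ?thesis using f(1)[of "Suc j"] that(1) unfolding good_def l_def by blast
  qed
  have "mono l"
  proof (rule incseq_SucI)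
    fix j
    have eX: "e (Suc j) \<in> X" using eig by (simp add: eigenpair_def)
    have "l j * Re (ip (e (Suc j)) (e (Suc j))) \<le> Re (A (e (Suc j)) (e (Suc j)))"
      by (rule minl[OF eX]) (simp add: orth)
    then show "l j \<le> l (Suc j)" using eig[of "Suc j"] eX by (simp add: orth eigenpair_def)
  qed
  then show ?thesis using eig orth minl unfolding spectral_sequence_def by blast
qed

context
  fixes l e assumes seq: "spectral_sequence l e"
begin

lemma seq_mono: "i \<le> j \<Longrightarrow> l i \<le> l j"
  using seq by (auto simp: spectral_sequence_def mono_def)

lemma seq_mem: "e j \<in> X" using seq by (auto simp: spectral_sequence_def eigenpair_def)

lemma seq_eigen: "y \<in> X \<Longrightarrow> A (e j) y = of_real (l j) * ip (e j) y"
  using seq by (auto simp: spectral_sequence_def eigenpair_def)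

lemma seq_orth: "ip (e i) (e j) = (if i = j then 1 else 0)"
  using seq by (auto simp: spectral_sequence_def)

lemma seq_min: "y \<in> X \<Longrightarrow> (\<And>i. i < j \<Longrightarrow> ip y (e i) = 0) \<Longrightarrow> l j * Re (ip y y) \<le> Re (A y y)"
  using seq unfolding spectral_sequence_def by blast

lemma ip_combination:
  assumes "finite I" "j \<in> I" shows "ip (\<lambda>i. \<Sum>j\<in>I. c j * e j i) (e j) = c j"
proof -
  have "ip (\<lambda>i. \<Sum>j\<in>I. c j * e j i) (e j) = (\<Sum>i\<in>I. c i * ip (e i) (e j))"
    by (rule ip.sum_left) (use assms seq_mem in auto)
  also have "\<dots> = (\<Sum>i\<in>I. if i = j then c i else 0)" by (intro sum.cong) (auto simp: seq_orth)
  finally show ?thesis using assms by simp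
qed

text \<open>Min-max from above: on a space of dimension \<open>N + 1\<close> some nonzero vector is orthogonal to the first \<open>N\<close>
  eigenvectors.\<close>

lemma eigenvalue_less:
  assumes f: "\<And>i. i \<le> N \<Longrightarrow> f i \<in> X"
    and neg: "\<And>c. (\<exists>i\<le>N. c i \<noteq> 0) \<Longrightarrow>
      Re (A (\<lambda>m. \<Sum>i\<le>N. c i * f i m) (\<lambda>m. \<Sum>i\<le>N. c i * f i m))
      < \<Lambda> * Re (ip (\<lambda>m. \<Sum>i\<le>N. c i * f i m) (\<lambda>m. \<Sum>i\<le>N. c i * f i m))"
  shows "l N < \<Lambda>"
proof -
  obtain c where c: "\<exists>i\<in>{..N}. c i \<noteq> 0" "\<And>j. j < N \<Longrightarrow> (\<Sum>i\<in>{..N}. ip (f i) (e j) * c i) = 0"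
    using homogeneous_system_nontrivial[of "{..N}" N "\<lambda>j i. ip (f i) (e j)"] by auto
  define y where "y = (\<lambda>m. \<Sum>i\<le>N. c i * f i m)"
  have yX: "y \<in> X" unfolding y_def by (rule ip.sum_mem) (use f in auto)
  have "ip y (e j) = 0" if "j < N" for j
    unfolding y_def using c(2)[OF that] by (subst ip.sum_left) (use f seq_mem in \<open>auto simp: mult.commute\<close>)
  then have "l N * Re (ip y y) \<le> Re (A y y)" by (intro seq_min yX)
  also have "\<dots> < \<Lambda> * Re (ip y y)" unfolding y_def by (rule neg) (use c in auto)
  finally have *: "l N * Re (ip y y) < \<Lambda> * Re (ip y y)" .
  have "y \<noteq> (\<lambda>_. 0)" using * ip.zero_left[OF ip.zero_mem] by auto
  from ip_pos[OF yX this] * show ?thesis by simp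
qed

text \<open>Min-max from below: some nonzero combination of the first \<open>N + 1\<close> eigenvectors is annihilated by the \<open>N\<close>
  functionals \<open>\<phi> j\<close>.\<close>

lemma eigenvalue_ge:
  assumes lin: "\<And>j c. j < N \<Longrightarrow> \<phi> j (\<lambda>m. \<Sum>i\<le>N. c i * e i m) = (\<Sum>i\<le>N. c i * \<phi> j (e i))"
    and pos: "\<And>y. y \<in> X \<Longrightarrow> (\<And>j. j < N \<Longrightarrow> \<phi> j y = 0) \<Longrightarrow> \<Lambda> * Re (ip y y) \<le> Re (A y y)"
  shows "\<Lambda> \<le> l N"
proof -
  obtain c where c: "\<exists>i\<in>{..N}. c i \<noteq> 0" "\<And>j. j < N \<Longrightarrow> (\<Sum>i\<in>{..N}. \<phi> j (e i) * c i) = (0::complex)"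
    using homogeneous_system_nontrivial[of "{..N}" N "\<lambda>j i. \<phi> j (e i)"] by auto
  define y where "y = (\<lambda>m. \<Sum>i\<le>N. c i * e i m)"
  have yX: "y \<in> X" unfolding y_def by (rule ip.sum_mem) (use seq_mem in auto)
  have "\<Lambda> * Re (ip y y) \<le> Re (A y y)"
    by (rule pos[OF yX]) (use lin c(2) in \<open>auto simp: y_def mult.commute\<close>)
  also have "A y y = (\<Sum>i\<le>N. c i * A (e i) y)"
    unfolding y_def by (rule form.sum_left) (use seq_mem yX in \<open>auto simp: y_def\<close>)
  also have "\<dots> = (\<Sum>i\<le>N. of_real (l i) * of_real ((cmod (c i))\<^sup>2))"
  proof (intro sum.cong refl)
    fix i assume i: "i \<in> {..N}"
    have "ip (e i) y = cnj (c i)"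
      using ip.hermitian[OF yX seq_mem[of i]] ip_combination[of "{..N}" i c] i by (simp add: y_def)
    then show "c i * A (e i) y = of_real (l i) * of_real ((cmod (c i))\<^sup>2)"
      using seq_eigen[OF yX, of i] by (simp add: complex_norm_square[of "c i"] del: of_real_power)
  qed
  also have "Re \<dots> = (\<Sum>i\<le>N. l i * (cmod (c i))\<^sup>2)" by simp
  also have "\<dots> \<le> (\<Sum>i\<le>N. l N * (cmod (c i))\<^sup>2)" by (intro sum_mono mult_right_mono seq_mono) auto
  also have "\<dots> = l N * (\<Sum>i\<le>N. (cmod (c i))\<^sup>2)" by (simp add: sum_distrib_left)
  also have "(\<Sum>i\<le>N. (cmod (c i))\<^sup>2) = Re (ip y y)"
  proof -
    have "ip y y = (\<Sum>i\<le>N. c i * ip (e i) y)"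
      unfolding y_def by (rule ip.sum_left) (use seq_mem yX in \<open>auto simp: y_def\<close>)
    also have "\<dots> = (\<Sum>i\<le>N. of_real ((cmod (c i))\<^sup>2))"
    proof (intro sum.cong refl)
      fix i assume i: "i \<in> {..N}"
      have "ip (e i) y = cnj (c i)"
        using ip.hermitian[OF yX seq_mem[of i]] ip_combination[of "{..N}" i c] i by (simp add: y_def)
      then show "c i * ip (e i) y = of_real ((cmod (c i))\<^sup>2)"
        by (simp add: complex_norm_square[of "c i"] del: of_real_power)
    qed
    finally show ?thesis by simp
  qed
  finally have *: "\<Lambda> * Re (ip y y) \<le> l N * Re (ip y y)" .
  obtain i where i: "i \<le> N" "c i \<noteq> 0" using c by auto
  have "y \<noteq> (\<lambda>_. 0)"
  proof
    assume "y = (\<lambda>_. 0)"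
    then show False using ip_combination[of "{..N}" i c] i ip.zero_left[OF seq_mem[of i]] by (simp add: y_def)
  qed
  from ip_pos[OF yX this] * show ?thesis by simp
qed

text \<open>The part of \<open>y\<close> orthogonal to all eigenvectors up to the energy \<open>l J > \<mu>\<close> has energy at least \<open>l J\<close>, but also
  satisfies the eigenvalue equation for \<open>\<mu>\<close>; hence it vanishes.\<close>

lemma eigenpair_expansion:
  assumes y: "eigenpair y \<mu>" and J: "\<mu> < l J"
  shows "finite {j. l j = \<mu>}" "y = (\<lambda>m. \<Sum>j\<in>{j. l j = \<mu>}. ip y (e j) * e j m)"
proof -
  have sub: "{j. l j = \<mu>} \<subseteq> {..<J}" using J seq_mono[of J] by (force simp: not_less[symmetric])
  then show fin: "finite {j. l j = \<mu>}" by (rule finite_subset) simp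
  have yX: "y \<in> X" using y by (simp add: eigenpair_def)
  have zero: "ip y (e j) = 0" if "l j \<noteq> \<mu>" for j
  proof -
    have "A (e j) y = cnj (A y (e j))" by (rule form.hermitian[OF yX seq_mem])
    also have "\<dots> = of_real \<mu> * ip (e j) y"
      using y seq_mem[of j] ip.hermitian[OF yX seq_mem[of j]] by (simp add: eigenpair_def)
    finally have "of_real (l j) * ip (e j) y = of_real \<mu> * ip (e j) y" using seq_eigen[OF yX, of j] by simp
    then have "ip (e j) y = 0" using that by simp
    then show ?thesis using ip.hermitian[OF seq_mem[of j] yX] by simp
  qed
  define p where "p = (\<lambda>m. \<Sum>j<J. ip y (e j) * e j m)"
  have pX: "p \<in> X" unfolding p_def by (rule ip.sum_mem) (use seq_mem in auto)
  define z where "z = (\<lambda>m. y m - p m)"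
  have zX: "z \<in> X" unfolding z_def by (rule ip.diff_mem[OF yX pX])
  have "ip z (e j) = 0" if "j < J" for j
    using ip.diff_left[OF yX pX seq_mem[of j]] ip_combination[of "{..<J}" j "\<lambda>j. ip y (e j)"] that
    by (simp add: z_def p_def)
  then have "l J * Re (ip z z) \<le> Re (A z z)" by (intro seq_min zX)
  moreover have "A z z = of_real \<mu> * ip z z"
  proof -
    have "A p z = of_real \<mu> * ip p z"
      unfolding p_def 
    proof (subst form.sum_left; (subst ip.sum_left)?)
      show "(\<Sum>j<J. ip y (e j) * A (e j) z) = of_real \<mu> * (\<Sum>j<J. ip y (e j) * ip (e j) z)"
        unfolding sum_distrib_left by (intro sum.cong refl) (use zero seq_eigen[OF zX] in \<open>auto simp: algebra_simps\<close>)
    qed (use zX seq_mem in auto)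
    moreover have "A y z = of_real \<mu> * ip y z" using y zX by (simp add: eigenpair_def)
    moreover have "A z z = A y z - A p z" "ip z z = ip y z - ip p z"
      using form.diff_left[OF yX pX zX] ip.diff_left[OF yX pX zX] by (simp_all add: z_def[symmetric])
    ultimately show ?thesis by (simp add: right_diff_distrib)
  qed
  ultimately have *: "l J * Re (ip z z) \<le> \<mu> * Re (ip z z)" by simp
  have "z = (\<lambda>_. 0)"
  proof (rule ccontr)
    assume "z \<noteq> (\<lambda>_. 0)"
    from ip_pos[OF zX this] * J show False by simp
  qed
  then have "y m = p m" for m by (simp add: z_def fun_eq_iff)
  also have "p m = (\<Sum>j\<in>{j. l j = \<mu>}. ip y (e j) * e j m)" for m
    unfolding p_def by (rule sum.mono_neutral_right) (use sub zero in auto)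
  finally show "y = (\<lambda>m. \<Sum>j\<in>{j. l j = \<mu>}. ip y (e j) * e j m)" by (simp add: fun_eq_iff)
qed

end

end

text \<open>A bounded family that converges to \<open>0\<close> at each index converges weakly: cut off a tail of \<open>c\<close> of small norm.\<close>

lemma weak_tendsto_0:
  fixes c :: "'i \<Rightarrow> real" and u :: "nat \<Rightarrow> 'i \<Rightarrow> real"
  assumes c: "l2 c" "\<And>i. 0 \<le> c i" and u: "\<And>n. l2 (u n)" "\<And>n i. 0 \<le> u n i" "\<And>n. l2norm (u n) \<le> C"
    and lim: "\<And>i. (\<lambda>n. u n i) \<longlonglongrightarrow> 0"
  shows "(\<lambda>n. \<Sum>\<^sub>\<infinity>i. c i * u n i) \<longlonglongrightarrow> 0"
proof (rule LIMSEQ_I)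
  fix e :: real assume e: "0 < e"
  have C0: "0 \<le> C" using u(3)[of 0] l2norm_nonneg[of "u 0"] by linarith
  define d where "d = e / (2 * (C + 1))"
  have d: "0 < d" "d * C < e / 2" using e C0 by (auto simp: d_def field_simps)
  have cs: "(\<lambda>i. (c i)\<^sup>2) summable_on UNIV" using c by (simp add: l2_def)
  obtain F where F: "finite F" "dist (\<Sum>i\<in>F. (c i)\<^sup>2) (\<Sum>\<^sub>\<infinity>i. (c i)\<^sup>2) \<le> d\<^sup>2"
    using infsum_finite_approximation[OF cs, of "d\<^sup>2"] d by auto
  define c1 where "c1 = (\<lambda>i. if i \<in> F then c i else 0)"
  define c2 where "c2 = (\<lambda>i. if i \<in> F then 0 else c i)"
  have c1: "l2 c1" by (rule l2_mono(1)[OF c(1)]) (auto simp: c1_def)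
  have c2: "l2 c2" by (rule l2_mono(1)[OF c(1)]) (auto simp: c2_def)
  have "(\<Sum>\<^sub>\<infinity>i. (c i)\<^sup>2) = (\<Sum>i\<in>F. (c i)\<^sup>2) + (\<Sum>\<^sub>\<infinity>i\<in>-F. (c i)\<^sup>2)"
    using infsum_Un_disjoint[of "\<lambda>i. (c i)\<^sup>2" F "-F"] summable_on_subset_banach[OF cs] F(1) by (auto simp: Un_commute)
  moreover have "(\<Sum>\<^sub>\<infinity>i\<in>-F. (c i)\<^sup>2) = (\<Sum>\<^sub>\<infinity>i. (c2 i)\<^sup>2)"
    by (rule infsum_cong_neutral) (auto simp: c2_def)
  ultimately have "(l2norm c2)\<^sup>2 \<le> d\<^sup>2" using F(2) by (auto simp: l2norm_power2 dist_real_def)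
  then have c2n: "l2norm c2 \<le> d" using d(1) by (metis power2_le_imp_le less_imp_le)
  have s1: "(\<lambda>i. c1 i * u n i) summable_on UNIV" and s2: "(\<lambda>i. c2 i * u n i) summable_on UNIV"
    and le: "(\<Sum>\<^sub>\<infinity>i. c2 i * u n i) \<le> l2norm c2 * l2norm (u n)" for n
    using l2_CS[OF c1 u(1)] l2_CS[OF c2 u(1)] c(2) u(2) by (simp_all add: c1_def c2_def if_distrib cong: if_cong)
  have "(\<lambda>n. \<Sum>i\<in>F. c i * u n i) \<longlonglongrightarrow> (\<Sum>i\<in>F. c i * 0)" by (intro tendsto_intros lim)
  then obtain N where N: "\<And>n. n \<ge> N \<Longrightarrow> norm (\<Sum>i\<in>F. c i * u n i) < e/2"
    using LIMSEQ_D[of "\<lambda>n. \<Sum>i\<in>F. c i * u n i" 0 "e/2"] e by auto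
  show "\<exists>no. \<forall>n\<ge>no. norm ((\<Sum>\<^sub>\<infinity>i. c i * u n i) - 0) < e"
  proof (intro exI allI impI)
    fix n assume n: "n \<ge> N"
    have "(\<Sum>\<^sub>\<infinity>i. c i * u n i) = (\<Sum>\<^sub>\<infinity>i. c1 i * u n i + c2 i * u n i)"
      by (intro infsum_cong) (auto simp: c1_def c2_def)
    also have "\<dots> = (\<Sum>\<^sub>\<infinity>i. c1 i * u n i) + (\<Sum>\<^sub>\<infinity>i. c2 i * u n i)" by (rule infsum_add[OF s1 s2])
    also have "(\<Sum>\<^sub>\<infinity>i. c1 i * u n i) = (\<Sum>\<^sub>\<infinity>i\<in>F. c i * u n i)" by (rule infsum_cong_neutral) (auto simp: c1_def)
    also have "\<dots> = (\<Sum>i\<in>F. c i * u n i)" using F(1) by simp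
    finally have eq: "(\<Sum>\<^sub>\<infinity>i. c i * u n i) = (\<Sum>i\<in>F. c i * u n i) + (\<Sum>\<^sub>\<infinity>i. c2 i * u n i)" .
    have "(\<Sum>\<^sub>\<infinity>i. c2 i * u n i) \<le> d * C"
      by (rule order_trans[OF le]) (use c2n u(3) d in \<open>auto intro: mult_mono\<close>)
    moreover have "0 \<le> (\<Sum>\<^sub>\<infinity>i. c i * u n i)" using c u by (auto intro: infsum_nonneg)
    ultimately show "norm ((\<Sum>\<^sub>\<infinity>i. c i * u n i) - 0) < e" using eq N[OF n] d by auto
  qed
qed

section \<open>The Hill operator as an infinite matrix\<close>

definition h1 :: "(int \<Rightarrow> complex) set" where "h1 = {x. l2 (\<lambda>m. bracket m * cmod (x m))}"

definition seq_inner :: "(int \<Rightarrow> complex) \<Rightarrow> (int \<Rightarrow> complex) \<Rightarrow> complex" where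
  "seq_inner x y = (\<Sum>\<^sub>\<infinity>m. x m * cnj (y m))"

text \<open>Its norm is the natural energy norm at the window \<open>n\<close>: the square root of the diagonal form with the entries
  \<open>resdist n m * ressum n m\<close>.\<close>

definition form_seq :: "nat \<Rightarrow> (int \<Rightarrow> complex) \<Rightarrow> int \<Rightarrow> real" where
  "form_seq n x = (\<lambda>m. sqrt (resdist n m * ressum n m) * cmod (x m))"

lemma h1_l2: "x \<in> h1 \<Longrightarrow> l2 x"
  unfolding h1_def mem_Collect_eq by (erule l2_mono(1)) (simp add: mult_le_cancel_right1 mult_left_le)

lemma h1_zero: "(\<lambda>_. 0) \<in> h1" by (simp add: h1_def l2_def)

lemma h1_scale: "x \<in> h1 \<Longrightarrow> (\<lambda>m. c * x m) \<in> h1"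
  using l2_scale(1)[of "\<lambda>m. bracket m * cmod (x m)" "cmod c"] by (simp add: h1_def norm_mult mult.left_commute)

lemma h1_add:
  assumes "x \<in> h1" "y \<in> h1" shows "(\<lambda>m. x m + y m) \<in> h1"
proof -
  have "l2 (\<lambda>m. bracket m * cmod (x m) + bracket m * cmod (y m))" using assms by (intro l2_add) (auto simp: h1_def)
  then show ?thesis unfolding h1_def mem_Collect_eq
    by (rule l2_mono(1)) (simp add: distrib_left[symmetric] mult_left_mono norm_triangle_ineq)
qed

lemma h1_finite_support:
  assumes "finite {m. x m \<noteq> 0}" shows "x \<in> h1"
  unfolding h1_def mem_Collect_eq l2_def
  by (rule finite_nonzero_values_imp_summable_on) (rule finite_subset[OF _ assms], auto)

lemma sq_le_bracket: "(real_of_int m)\<^sup>2 \<le> (bracket m)\<^sup>2"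
  by (rule power2_le_iff_abs_le[THEN iffD2]) (auto simp: bracket_def)

lemma resdist_le_ressum: "0 < n \<Longrightarrow> resdist n m \<le> ressum n m" by (auto simp: resdist_def ressum_def)

lemma l2_form_seq:
  assumes "x \<in> h1" "0 < n" shows "l2 (form_seq n x)" "l2norm (form_seq n x) \<le> (real n + 1) * l2norm (\<lambda>m. bracket m * cmod (x m))"
proof -
  have le: "norm (form_seq n x m) \<le> norm ((real n + 1) * (bracket m * cmod (x m)))" for m
  proof -
    have "sqrt (resdist n m * ressum n m) \<le> sqrt (ressum n m * ressum n m)"
      using resdist_le_ressum[OF assms(2), of m] ressum_pos[OF assms(2), of m] by (intro real_sqrt_le_mono mult_right_mono) auto
    also have "\<dots> = ressum n m" using ressum_pos[OF assms(2), of m] by simp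
    also have "\<dots> \<le> (real n + 1) * bracket m"
    proof -
      have "real n * 1 \<le> real n * bracket m" by (intro mult_left_mono) auto
      then show ?thesis by (simp add: ressum_def bracket_def algebra_simps)
    qed
    finally have "sqrt (resdist n m * ressum n m) * cmod (x m) \<le> (real n + 1) * bracket m * cmod (x m)"
      by (intro mult_right_mono) auto
    then show ?thesis using ressum_pos[OF assms(2), of m] by (simp add: form_seq_def mult.assoc)
  qed
  have s: "l2 (\<lambda>m. bracket m * cmod (x m))" using assms by (simp add: h1_def)
  note L = l2_mono[OF l2_scale(1)[OF s] le]
  show "l2 (form_seq n x)" "l2norm (form_seq n x) \<le> (real n + 1) * l2norm (\<lambda>m. bracket m * cmod (x m))"
    using L l2_scale(2)[OF s, of "real n + 1"] by auto
qed

lemma seq_inner_summable: "l2 x \<Longrightarrow> l2 y \<Longrightarrow> (\<lambda>m. x m * cnj (y m)) summable_on UNIV"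
  using l2_CS_complex(1)[of x "\<lambda>m. cnj (y m)"] abs_summable_summable by (auto simp: l2_def)

lemma l2_cnj [simp]: "l2 (\<lambda>m. cnj (x m)) = l2 x" "l2norm (\<lambda>m. cnj (x m)) = l2norm x"
  by (auto simp: l2_def l2norm_def)

abbreviation kinetic :: "(int \<Rightarrow> complex) \<Rightarrow> real" where
  "kinetic x \<equiv> (\<Sum>\<^sub>\<infinity>m. (of_int m)\<^sup>2 * (cmod (x m))\<^sup>2)"

abbreviation window_top :: "nat \<Rightarrow> real" where "window_top n \<equiv> pi\<^sup>2 * ((real n)\<^sup>2 + n)"
abbreviation window_bottom :: "nat \<Rightarrow> real" where "window_bottom n \<equiv> pi\<^sup>2 * ((real n)\<^sup>2 - n)"

lemma infsum_of_real: "(\<Sum>\<^sub>\<infinity>i\<in>S. complex_of_real (f i)) = of_real (\<Sum>\<^sub>\<infinity>i\<in>S. f i)"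
proof (cases "f summable_on S")
  case True
  then show ?thesis by (intro infsumI has_sum_of_real has_sum_infsum)
next
  case False
  then have "\<not> (\<lambda>i. complex_of_real (f i)) summable_on S"
    by (metis Re_complex_of_real summable_on_Re summable_on_cong)
  then show ?thesis using False by (simp add: infsum_not_exists)
qed

lemma seq_inner_self: "seq_inner x x = of_real ((l2norm x)\<^sup>2)"
proof -
  have "x m * cnj (x m) = of_real ((cmod (x m))\<^sup>2)" for m by (rule complex_norm_square[symmetric])
  then show ?thesis unfolding seq_inner_def l2norm_power2 by (simp add: infsum_of_real del: of_real_power)
qed

lemma seq_inner_bound: "l2 x \<Longrightarrow> l2 y \<Longrightarrow> cmod (seq_inner x y) \<le> l2norm x * l2norm y"
  unfolding seq_inner_def using l2_CS_complex(2)[of x "\<lambda>m. cnj (y m)"] by simp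

interpretation seq_inner: sesquilinear h1 seq_inner
proof unfold_locales
  fix x y z assume "x \<in> h1" "y \<in> h1" "z \<in> h1"
  then show "seq_inner (\<lambda>i. x i + y i) z = seq_inner x z + seq_inner y z"
    unfolding seq_inner_def distrib_right by (intro infsum_add seq_inner_summable h1_l2)
next
  fix x z c assume "x \<in> h1" "z \<in> h1"
  then show "seq_inner (\<lambda>i. c * x i) z = c * seq_inner x z"
    unfolding seq_inner_def mult.assoc by (intro infsum_cmult_right seq_inner_summable h1_l2)
next
  fix x y assume "x \<in> h1" "y \<in> h1"
  show "seq_inner y x = cnj (seq_inner x y)"
    unfolding seq_inner_def infsum_cnj[symmetric] by (intro infsum_cong) simp
qed (auto intro: h1_zero h1_add h1_scale)

locale singular_potential =
  fixes v :: "int \<Rightarrow> complex"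
  assumes v_minus: "v (- m) = cnj (v m)"
    and v_l2: "l2 (\<lambda>j. cmod (v j) / bracket j)"
begin

definition w :: "int \<Rightarrow> real" where "w j = cmod (v j) / bracket j"

lemma w_nonneg [simp]: "0 \<le> w j" by (simp add: w_def)
lemma l2_w: "l2 w" using v_l2 by (simp add: w_def[abs_def])
lemma cmod_v: "cmod (v j) = bracket j * w j" by (simp add: w_def)
lemma cmod_v_commute: "cmod (v (m - k)) = cmod (v (k - m))"
  using v_minus[of "m - k"] by (metis complex_mod_cnj minus_diff_eq)

text \<open>The bound of \<open>\<bar>v(m - k)\<bar>\<close> by the geometric mean of \<open>kern n w (m, k)\<close> and \<open>kern n w (k, m)\<close> distributes the
  diagonal evenly over both indices.  The arithmetic mean is used since its norm is easily estimated.\<close>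

definition sym_kern :: "nat \<Rightarrow> int \<times> int \<Rightarrow> real" where
  "sym_kern n p = (kern n w p + kern n w (prod.swap p)) / 2"

lemma kern_w_nonneg: "0 < n \<Longrightarrow> 0 \<le> kern n w p"
  using ressum_pos[of n "fst p"] by (auto simp: kern_def case_prod_unfold)

lemma l2_sym_kern:
  assumes "0 < n" shows "l2 (sym_kern n)" "l2norm (sym_kern n) \<le> l2norm (kern n w)"
proof -
  have b: "bij (prod.swap :: int \<times> int \<Rightarrow> _)" by simp
  note k = l2_kern(1)[OF assms w_nonneg l2_w]
  note s = l2_bij[OF b, of "kern n w"]
  note a = l2_add[of "kern n w" "\<lambda>p. kern n w (prod.swap p)"]
  note c = l2_scale[of "\<lambda>p. kern n w p + kern n w (prod.swap p)" "1/2"]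
  show "l2 (sym_kern n)" using c(1) a(1) k s(1) by (simp add: sym_kern_def[abs_def])
  show "l2norm (sym_kern n) \<le> l2norm (kern n w)" using c(2) a k s by (simp add: sym_kern_def[abs_def])
qed

lemma cmod_v_le_sym_kern:
  assumes "0 < n"
  shows "cmod (v (m - k)) \<le> sym_kern n (m,k) * (sqrt (resdist n m * ressum n m) * sqrt (resdist n k * ressum n k))"
proof -
  have r: "0 < ressum n m" "0 < ressum n k" using ressum_pos[OF assms] by auto
  let ?a = "kern n w (m,k)" let ?b = "kern n w (k,m)"
  have ab: "?a * ?b = (cmod (v (m-k)))\<^sup>2 / ((resdist n m * ressum n m) * (resdist n k * ressum n k))"
    using r cmod_v_commute[of m k] by (simp add: kern_def cmod_v[symmetric] power2_eq_square mult_ac)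
  have "sqrt (?a * ?b) \<le> sym_kern n (m,k)"
    unfolding sym_kern_def using arith_geo_mean_sqrt[of ?a ?b] kern_w_nonneg[OF assms] by simp
  moreover have "sqrt (?a * ?b) = cmod (v (m-k)) / (sqrt (resdist n m * ressum n m) * sqrt (resdist n k * ressum n k))"
    unfolding ab by (simp add: real_sqrt_divide real_sqrt_mult)
  ultimately show ?thesis using r by (simp add: divide_le_eq)
qed

definition vterm :: "(int \<Rightarrow> complex) \<Rightarrow> (int \<Rightarrow> complex) \<Rightarrow> int \<times> int \<Rightarrow> complex" where
  "vterm x y = (\<lambda>(m,k). v (m - k) * x k * cnj (y m))"

definition V :: "(int \<Rightarrow> complex) \<Rightarrow> (int \<Rightarrow> complex) \<Rightarrow> complex" where
  "V x y = (\<Sum>\<^sub>\<infinity>p. vterm x y p)"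

lemma vterm_le:
  assumes "0 < n"
  shows "cmod (vterm x y (m,k)) \<le> sym_kern n (m,k) * (form_seq n y m * form_seq n x k)"
proof -
  have "cmod (vterm x y (m,k)) = cmod (v (m - k)) * (cmod (x k) * cmod (y m))" by (simp add: vterm_def norm_mult)
  also have "\<dots> \<le> sym_kern n (m,k) * (sqrt (resdist n m * ressum n m) * sqrt (resdist n k * ressum n k)) * (cmod (x k) * cmod (y m))"
    by (intro mult_right_mono cmod_v_le_sym_kern assms) auto
  finally show ?thesis by (simp add: form_seq_def mult_ac)
qed

lemma sym_kern_nonneg: "0 < n \<Longrightarrow> 0 \<le> sym_kern n p" by (simp add: sym_kern_def kern_w_nonneg)
lemma form_seq_nonneg: "0 < n \<Longrightarrow> 0 \<le> form_seq n x m" using ressum_pos[of n m] by (simp add: form_seq_def)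

lemma vterm_summable:
  assumes x: "x \<in> h1" and y: "y \<in> h1" and n: "0 < n"
  shows "(\<lambda>p. cmod (vterm x y p)) summable_on UNIV"
    and "(\<lambda>p. sym_kern n p * (\<lambda>(m,k). form_seq n y m * form_seq n x k) p) summable_on UNIV"
    and "cmod (V x y) \<le> (\<Sum>\<^sub>\<infinity>p. sym_kern n p * (\<lambda>(m,k). form_seq n y m * form_seq n x k) p)"
    and "cmod (V x y) \<le> l2norm (kern n w) * (l2norm (form_seq n x) * l2norm (form_seq n y))"
proof -
  note t = l2_tensor[OF l2_form_seq(1)[OF y n] l2_form_seq(1)[OF x n]]
  note cs = l2_CS[OF l2_sym_kern(1)[OF n] t(1)]
  have nn: "norm (sym_kern n p) * norm ((\<lambda>(m,k). form_seq n y m * form_seq n x k) p) = sym_kern n p * (\<lambda>(m,k). form_seq n y m * form_seq n x k) p" for p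
    using sym_kern_nonneg[OF n, of p] form_seq_nonneg[OF n] by (simp add: case_prod_unfold)
  have le: "cmod (vterm x y p) \<le> sym_kern n p * (\<lambda>(m,k). form_seq n y m * form_seq n x k) p" for p
    using vterm_le[OF n, of x y "fst p" "snd p"] by (simp add: case_prod_unfold)
  show s: "(\<lambda>p. sym_kern n p * (\<lambda>(m,k). form_seq n y m * form_seq n x k) p) summable_on UNIV"
    using cs(1) unfolding nn .
  show s2: "(\<lambda>p. cmod (vterm x y p)) summable_on UNIV"
    by (rule summable_on_comparison_test[OF s le]) auto
  have "cmod (V x y) \<le> (\<Sum>\<^sub>\<infinity>p. cmod (vterm x y p))" unfolding V_def by (rule norm_infsum_bound[OF s2])
  also have "\<dots> \<le> (\<Sum>\<^sub>\<infinity>p. sym_kern n p * (\<lambda>(m,k). form_seq n y m * form_seq n x k) p)" by (rule infsum_mono[OF s2 s le])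
  finally show 1: "cmod (V x y) \<le> (\<Sum>\<^sub>\<infinity>p. sym_kern n p * (\<lambda>(m,k). form_seq n y m * form_seq n x k) p)" .
  also have "\<dots> \<le> l2norm (sym_kern n) * (l2norm (form_seq n y) * l2norm (form_seq n x))"
    using cs(2) unfolding nn t(2) .
  also have "\<dots> \<le> l2norm (kern n w) * (l2norm (form_seq n y) * l2norm (form_seq n x))"
    by (intro mult_right_mono l2_sym_kern n) auto
  finally show "cmod (V x y) \<le> l2norm (kern n w) * (l2norm (form_seq n x) * l2norm (form_seq n y))" by (simp add: mult.commute)
qed

lemma vterm_summable': "x \<in> h1 \<Longrightarrow> y \<in> h1 \<Longrightarrow> vterm x y summable_on UNIV"
  by (rule abs_summable_summable, rule vterm_summable(1)[of x y 1]) auto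

sublocale V: sesquilinear h1 V
proof unfold_locales
  fix x y z assume *: "x \<in> h1" "y \<in> h1" "z \<in> h1"
  have e: "vterm (\<lambda>i. x i + y i) z = (\<lambda>p. vterm x z p + vterm y z p)"
    by (simp add: vterm_def case_prod_unfold algebra_simps)
  show "V (\<lambda>i. x i + y i) z = V x z + V y z"
    unfolding V_def e using * by (intro infsum_add vterm_summable')
next
  fix x z c assume *: "x \<in> h1" "z \<in> h1"
  have e: "vterm (\<lambda>i. c * x i) z = (\<lambda>p. c * vterm x z p)"
    by (simp add: vterm_def case_prod_unfold algebra_simps)
  show "V (\<lambda>i. c * x i) z = c * V x z"
    unfolding V_def e using * by (intro infsum_cmult_right vterm_summable')
next
  fix x y assume *: "x \<in> h1" "y \<in> h1"
  have b: "bij (prod.swap :: int \<times> int \<Rightarrow> _)" by simp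
  have "cnj (v (m - k)) = v (k - m)" for m k using v_minus[of "m - k"] by simp
  then have "vterm y x (prod.swap p) = cnj (vterm x y p)" for p
    by (simp add: vterm_def case_prod_unfold mult_ac)
  then have "V y x = (\<Sum>\<^sub>\<infinity>p. cnj (vterm x y p))"
    unfolding V_def using infsum_reindex_bij_betw[OF b, of "vterm y x"] by simp
  then show "V y x = cnj (V x y)" unfolding V_def by simp
qed (auto intro: h1_zero h1_add h1_scale)

definition A :: "(int \<Rightarrow> complex) \<Rightarrow> (int \<Rightarrow> complex) \<Rightarrow> complex" where
  "A x y = (\<Sum>\<^sub>\<infinity>m. of_real (pi\<^sup>2 * (of_int m)\<^sup>2) * x m * cnj (y m)) + V x y"

lemma kinetic_summable:
  assumes "x \<in> h1" "y \<in> h1"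
  shows "(\<lambda>m. of_real (pi\<^sup>2 * (of_int m)\<^sup>2) * x m * cnj (y m)) summable_on UNIV"
proof (rule abs_summable_summable, rule summable_on_comparison_test)
  have s: "l2 (\<lambda>m. bracket m * cmod (x m))" "l2 (\<lambda>m. bracket m * cmod (y m))" using assms by (auto simp: h1_def)
  show "(\<lambda>m. pi\<^sup>2 * (norm (bracket m * cmod (x m)) * norm (bracket m * cmod (y m)))) summable_on UNIV"
    by (intro summable_on_cmult_right l2_CS s)
  fix m
  have "pi\<^sup>2 * (of_int m)\<^sup>2 * (cmod (x m) * cmod (y m)) \<le> pi\<^sup>2 * (bracket m)\<^sup>2 * (cmod (x m) * cmod (y m))"
    by (intro mult_right_mono mult_left_mono sq_le_bracket) auto
  then show "cmod (of_real (pi\<^sup>2 * (of_int m)\<^sup>2) * x m * cnj (y m)) \<le> pi\<^sup>2 * (norm (bracket m * cmod (x m)) * norm (bracket m * cmod (y m)))"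
    by (simp add: norm_mult power2_eq_square abs_mult mult_ac)
qed auto

sublocale A: sesquilinear h1 A
proof unfold_locales
  fix x y z assume *: "x \<in> h1" "y \<in> h1" "z \<in> h1"
  show "A (\<lambda>i. x i + y i) z = A x z + A y z"
    unfolding A_def distrib_right distrib_left V.add_left[OF *] 
    using infsum_add[OF kinetic_summable[OF *(1,3)] kinetic_summable[OF *(2,3)]] by simp
next
  fix x z c assume *: "x \<in> h1" "z \<in> h1"
  show "A (\<lambda>i. c * x i) z = c * A x z"
    unfolding A_def V.scale_left[OF *] 
    using infsum_cmult_right[OF kinetic_summable[OF *], of c] by (simp add: algebra_simps)
next
  fix x y assume *: "x \<in> h1" "y \<in> h1"
  show "A y x = cnj (A x y)"
    unfolding A_def complex_cnj_add infsum_cnj[symmetric] V.hermitian[OF *]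
    by (intro arg_cong2[where f="(+)"] infsum_cong) auto
qed (auto intro: h1_zero h1_add h1_scale)

lemma kinetic_summable': "x \<in> h1 \<Longrightarrow> (\<lambda>m. (of_int m)\<^sup>2 * (cmod (x m))\<^sup>2) summable_on UNIV"
  unfolding h1_def mem_Collect_eq l2_def
  by (erule summable_on_comparison_test) (auto simp: power_mult_distrib intro!: mult_right_mono sq_le_bracket)

lemma A_diag:
  assumes "x \<in> h1"
  shows "Re (A x x) = pi\<^sup>2 * kinetic x + Re (V x x)"
proof -
  have "of_real (pi\<^sup>2 * (of_int m)\<^sup>2) * x m * cnj (x m) = of_real (pi\<^sup>2 * ((of_int m)\<^sup>2 * (cmod (x m))\<^sup>2))" for m
    using complex_norm_square[of "x m"] by (simp add: mult.assoc)
  then show ?thesis unfolding A_def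
    using infsum_cmult_right[OF kinetic_summable'[OF assms], of "pi\<^sup>2"] by (simp only: infsum_of_real) simp
qed

lemma form_seq_power2: "0 < n \<Longrightarrow> (form_seq n x m)\<^sup>2 = resdist n m * ressum n m * (cmod (x m))\<^sup>2"
  using ressum_pos[of n m] by (simp add: form_seq_def power_mult_distrib)

lemma form_seq_norm:
  assumes "x \<in> h1" "0 < n"
  shows "(\<lambda>m. resdist n m * ressum n m * (cmod (x m))\<^sup>2) summable_on UNIV"
    and "(l2norm (form_seq n x))\<^sup>2 = (\<Sum>\<^sub>\<infinity>m. resdist n m * ressum n m * (cmod (x m))\<^sup>2)"
  using l2_form_seq(1)[OF assms] by (simp_all add: l2_def l2norm_power2 form_seq_power2[OF assms(2)])

lemma resdist_ressum_le: 
  assumes "0 < n" shows "resdist n m * ressum n m \<le> 2 * (of_int m)\<^sup>2 + 2 * (real n)\<^sup>2"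
proof -
  define p where "p = \<bar>real_of_int m\<bar>"
  define q where "q = real n"
  have q: "1 \<le> q" using assms by (simp add: q_def)
  have p: "p = real_of_int \<bar>m\<bar>" "0 \<le> p" by (auto simp: p_def)
  have pq: "p = q \<or> p \<ge> q + 1 \<or> p \<le> q - 1"
  proof -
    have "\<bar>m\<bar> = int n \<or> \<bar>m\<bar> \<ge> int n + 1 \<or> \<bar>m\<bar> \<le> int n - 1" by linarith
    then show ?thesis unfolding p q_def by auto
  qed
  have "max 1 \<bar>p - q\<bar> * (p + q) \<le> 2 * p\<^sup>2 + 2 * q\<^sup>2"
  proof -
    consider "p = q" | "p \<ge> q + 1" | "p \<le> q - 1" using pq by blast
    then show ?thesis
    proof cases
      case 1
      have "q * 1 \<le> q * q" using q by (intro mult_left_mono) auto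
      then show ?thesis using 1 q by (simp add: power2_eq_square)
    next
      case 2
      then have "max 1 \<bar>p - q\<bar> * (p + q) = p\<^sup>2 - q\<^sup>2" by (simp add: power2_eq_square algebra_simps max_def)
      then show ?thesis using zero_le_power2[of p] zero_le_power2[of q] by linarith
    next
      case 3
      then have "max 1 \<bar>p - q\<bar> * (p + q) = q\<^sup>2 - p\<^sup>2" by (simp add: power2_eq_square algebra_simps max_def)
      then show ?thesis using zero_le_power2[of p] zero_le_power2[of q] by linarith
    qed
  qed
  then show ?thesis by (simp add: resdist_def ressum_def p_def q_def)
qed

lemma pi2_ge: "4 \<le> pi\<^sup>2"
  using power_mono[OF pi_ge_two, of 2] by simp

lemma V_diag_bound:
  assumes "x \<in> h1" "0 < n" shows "\<bar>Re (V x x)\<bar> \<le> l2norm (kern n w) * (l2norm (form_seq n x))\<^sup>2"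
  using vterm_summable(4)[OF assms(1,1,2)] abs_Re_le_cmod[of "V x x"] by (simp add: power2_eq_square)

text \<open>At a window where the relative bound of the potential is at most \<open>1/2\<close>, the potential costs at most
  \<open>kinetic x + n\<^sup>2 (l2norm x)\<^sup>2\<close> out of the kinetic energy \<open>\<pi>\<^sup>2 kinetic x \<ge> 4 kinetic x\<close>.\<close>

lemma energy_lower:
  assumes x: "x \<in> h1" and n: "0 < n" "l2norm (kern n w) \<le> 1/2"
  shows "kinetic x - (real n)\<^sup>2 * (l2norm x)\<^sup>2 \<le> Re (A x x)"
proof -
  define E where "E = kinetic x"
  have E0: "0 \<le> E" unfolding E_def by (rule infsum_nonneg) auto
  have s1: "(\<lambda>m. (cmod (x m))\<^sup>2) summable_on UNIV" using h1_l2[OF x] by (simp add: l2_def)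
  note s2 = kinetic_summable'[OF x]
  have "(l2norm (form_seq n x))\<^sup>2 \<le> (\<Sum>\<^sub>\<infinity>m. 2 * ((of_int m)\<^sup>2 * (cmod (x m))\<^sup>2) + 2 * (real n)\<^sup>2 * (cmod (x m))\<^sup>2)"
    unfolding form_seq_norm(2)[OF x n(1)]
  proof (rule infsum_mono[OF form_seq_norm(1)[OF x n(1)]])
    show "(\<lambda>m. 2 * ((of_int m)\<^sup>2 * (cmod (x m))\<^sup>2) + 2 * (real n)\<^sup>2 * (cmod (x m))\<^sup>2) summable_on UNIV"
      by (intro summable_on_add summable_on_cmult_right s1 s2)
    show "resdist n m * ressum n m * (cmod (x m))\<^sup>2 \<le> 2 * ((of_int m)\<^sup>2 * (cmod (x m))\<^sup>2) + 2 * (real n)\<^sup>2 * (cmod (x m))\<^sup>2" for m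
      using mult_right_mono[OF resdist_ressum_le[OF n(1), of m], of "(cmod (x m))\<^sup>2"] by (simp add: algebra_simps)
  qed
  also have "\<dots> = 2 * E + 2 * (real n)\<^sup>2 * (l2norm x)\<^sup>2"
    unfolding E_def l2norm_power2
    by (subst infsum_add) (auto intro!: summable_on_cmult_right s1 s2 simp: infsum_cmult_right s1 s2)
  finally have 1: "(l2norm (form_seq n x))\<^sup>2 \<le> 2 * E + 2 * (real n)\<^sup>2 * (l2norm x)\<^sup>2" .
  have "l2norm (kern n w) * (l2norm (form_seq n x))\<^sup>2 \<le> 1/2 * (l2norm (form_seq n x))\<^sup>2"
    by (intro mult_right_mono n) auto
  moreover have "4 * E \<le> pi\<^sup>2 * E" by (intro mult_right_mono pi2_ge E0)
  ultimately show ?thesis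
    using V_diag_bound[OF x n(1)] 1 E0 unfolding A_diag[OF x] E_def[symmetric] by linarith
qed

lemma small_kernel: "e > 0 \<Longrightarrow> \<forall>\<^sub>F n in sequentially. 0 < n \<and> l2norm (kern n w) < e"
  using eventually_conj[OF eventually_gt_at_top[of "0::nat"] order_tendstoD(2)[OF kern_tendsto_0[OF w_nonneg l2_w], of e]]
  by simp

text \<open>The potential is form compact: it is dominated by the pairing of the fixed Hilbert-Schmidt kernel with the
  tensor product of \<open>xs j\<close> and \<open>ys j\<close>, which tends to \<open>0\<close> weakly.\<close>

lemma V_weakly_continuous:
  assumes "\<And>j. xs j \<in> h1" "\<And>j. ys j \<in> h1"
    and bd: "\<And>j. l2norm (\<lambda>m. bracket m * cmod (xs j m)) \<le> C" "\<And>j. l2norm (\<lambda>m. bracket m * cmod (ys j m)) \<le> C"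
    and lim: "\<And>m. (\<lambda>j. xs j m) \<longlonglongrightarrow> 0"
  shows "(\<lambda>j. V (xs j) (ys j)) \<longlonglongrightarrow> 0"
proof -
  have C0: "0 \<le> C" using bd(1)[of 0] l2norm_nonneg order_trans by blast
  have L: "l2 (form_seq 1 (xs j))" "l2norm (form_seq 1 (xs j)) \<le> 2 * C" "l2 (form_seq 1 (ys j))" "l2norm (form_seq 1 (ys j)) \<le> 2 * C" for j
    using l2_form_seq[of "xs j" 1] l2_form_seq[of "ys j" 1] assms(1,2)[of j] bd[of j] by auto
  have "(\<lambda>j. \<Sum>\<^sub>\<infinity>p. sym_kern 1 p * (\<lambda>(m,k). form_seq 1 (ys j) m * form_seq 1 (xs j) k) p) \<longlonglongrightarrow> 0"
  proof (rule weak_tendsto_0)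
    show "l2 (sym_kern 1)" by (rule l2_sym_kern) simp
    show "0 \<le> sym_kern 1 p" for p by (rule sym_kern_nonneg) simp
    show "l2 (\<lambda>(m, k). form_seq 1 (ys j) m * form_seq 1 (xs j) k)" for j by (rule l2_tensor(1)[OF L(3,1)])
    show "0 \<le> (case p of (m, k) \<Rightarrow> form_seq 1 (ys j) m * form_seq 1 (xs j) k)" for p j
      by (simp add: case_prod_unfold form_seq_nonneg)
    show "l2norm (\<lambda>(m, k). form_seq 1 (ys j) m * form_seq 1 (xs j) k) \<le> (2 * C) * (2 * C)" for j
      unfolding l2_tensor(2)[OF L(3,1)] by (intro mult_mono L) (use C0 in auto)
    show "(\<lambda>j. case p of (m, k) \<Rightarrow> form_seq 1 (ys j) m * form_seq 1 (xs j) k) \<longlonglongrightarrow> 0" for p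
    proof -
      obtain m k where p: "p = (m,k)" by (cases p)
      have "(\<lambda>j. form_seq 1 (xs j) k) \<longlonglongrightarrow> sqrt (resdist 1 k * ressum 1 k) * norm (0::complex)"
        unfolding form_seq_def by (intro tendsto_intros lim)
      then have "(\<lambda>j. form_seq 1 (xs j) k * (2 * C)) \<longlonglongrightarrow> 0 * (2 * C)" by (intro tendsto_intros) simp
      then have 1: "(\<lambda>j. form_seq 1 (xs j) k * (2 * C)) \<longlonglongrightarrow> 0" by simp
      have le: "norm (form_seq 1 (ys j) m * form_seq 1 (xs j) k) \<le> form_seq 1 (xs j) k * (2 * C)" for j
      proof -
        have "\<bar>form_seq 1 (ys j) m\<bar> \<le> 2 * C" using norm_le_l2norm[OF L(3), of j m] L(4)[of j] by simp
        from mult_right_mono[OF this, of "form_seq 1 (xs j) k"] show ?thesis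
          using form_seq_nonneg[of 1 "xs j" k] by (simp add: abs_mult mult.commute)
      qed
      have "(\<lambda>j. form_seq 1 (ys j) m * form_seq 1 (xs j) k) \<longlonglongrightarrow> 0"
        by (rule Lim_null_comparison[OF always_eventually[OF allI[OF le]] 1])
      then show ?thesis by (simp add: p)
    qed
  qed
  then show ?thesis
    by (rule Lim_null_comparison[rotated]) 
      (rule always_eventually, rule allI, rule vterm_summable(3)[OF assms(1,2)], simp)
qed

text \<open>The compact embedding of \<open>h1\<close> in the square summable sequences.\<close>

lemma l2norm_tendsto_0:
  assumes C: "0 \<le> C" and z: "\<And>k m. bracket m * cmod (z k m) \<le> C" and lim: "\<And>m. (\<lambda>k. z k m) \<longlonglongrightarrow> 0"
  shows "(\<lambda>k. l2norm (z k)) \<longlonglongrightarrow> 0"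
proof -
  have "(\<lambda>k. \<Sum>\<^sub>\<infinity>m. (cmod (z k m))\<^sup>2) \<longlonglongrightarrow> 0"
  proof (rule infsum_dominated_tendsto_0)
    show "(\<lambda>m. (C * (1 / bracket m))\<^sup>2) summable_on UNIV"
      using l2_scale(1)[OF l2_inv_bracket, of C] by (simp add: l2_def power_divide)
    show "(cmod (z k m))\<^sup>2 \<le> (C * (1 / bracket m))\<^sup>2" for k m
      using z[of m k] by (intro power_mono) (auto simp: field_simps)
    show "(\<lambda>k. (cmod (z k m))\<^sup>2) \<longlonglongrightarrow> 0" for m
      using tendsto_power[OF tendsto_norm[OF lim[of m]], where n=2] by simp
  qed auto
  from tendsto_real_sqrt[OF this] show ?thesis by (simp add: l2norm_def)
qed

text \<open>By \<open>energy_lower\<close> the sequence is bounded in \<open>h1\<close>.  A diagonal subsequence converges in every coordinate, hence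
  strongly in the square norm; the potential term converges, and the kinetic energy can only drop in the limit.\<close>

lemma compact_sublevel_sets:
  assumes xs: "\<And>k::nat. xs k \<in> h1" and one: "\<And>k. seq_inner (xs k) (xs k) = 1"
    and lim: "(\<lambda>k. Re (A (xs k) (xs k))) \<longlonglongrightarrow> a"
  shows "\<exists>r x. strict_mono r \<and> x \<in> h1 \<and> seq_inner x x = 1 \<and> Re (A x x) \<le> a \<and>
        (\<forall>y\<in>h1. (\<lambda>k. seq_inner (xs (r k)) y) \<longlonglongrightarrow> seq_inner x y)"
proof -
  obtain n where n: "0 < n" "l2norm (kern n w) < 1/2"
    using small_kernel[of "1/2"] by (auto simp: eventually_sequentially)
  obtain K where K: "0 < K" "\<And>k. norm (Re (A (xs k) (xs k))) \<le> K"
    using Bseq_def convergent_imp_Bseq lim unfolding convergent_def by (metis (no_types, lifting))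
  define C where "C = sqrt (1 + K + (real n)\<^sup>2)"
  have C: "C\<^sup>2 = 1 + K + (real n)\<^sup>2" "0 \<le> C" using K(1) by (auto simp: C_def)
  have l1: "l2norm (xs k) = 1" for k
  proof -
    have "(l2norm (xs k))\<^sup>2 = 1" using one[of k] unfolding seq_inner_self by (metis of_real_eq_1_iff)
    then show ?thesis using l2norm_nonneg[of "xs k"] by (metis abs_of_nonneg one_power2 power2_eq_iff_nonneg zero_le_one)
  qed
  have bd: "l2norm (\<lambda>m. bracket m * cmod (xs k m)) \<le> C" for k
  proof -
    note x = xs[of k]
    define E where "E = (\<Sum>\<^sub>\<infinity>m. (of_int m)\<^sup>2 * (cmod (xs k m))\<^sup>2)"
    have s1: "(\<lambda>m. (cmod (xs k m))\<^sup>2) summable_on UNIV" using h1_l2[OF x] by (simp add: l2_def)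
    note s2 = kinetic_summable'[OF x]
    have "E - (real n)\<^sup>2 * (l2norm (xs k))\<^sup>2 \<le> Re (A (xs k) (xs k))" unfolding E_def
      by (rule energy_lower[OF x n(1)]) (use n in simp)
    then have E: "E \<le> K + (real n)\<^sup>2" using K(2)[of k] l1 by simp
    have "(l2norm (\<lambda>m. bracket m * cmod (xs k m)))\<^sup>2 = (\<Sum>\<^sub>\<infinity>m. (bracket m * cmod (xs k m))\<^sup>2)" by (simp add: l2norm_power2)
    also have "\<dots> \<le> (\<Sum>\<^sub>\<infinity>m. (of_int m)\<^sup>2 * (cmod (xs k m))\<^sup>2 + (cmod (xs k m))\<^sup>2)"
    proof (rule infsum_mono)
      show "(\<lambda>m. (bracket m * cmod (xs k m))\<^sup>2) summable_on UNIV" using x by (simp add: h1_def l2_def)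
      show "(\<lambda>m. (of_int m)\<^sup>2 * (cmod (xs k m))\<^sup>2 + (cmod (xs k m))\<^sup>2) summable_on UNIV"
        by (intro summable_on_add s1 s2)
      fix m
      have "(bracket m)\<^sup>2 \<le> (of_int m)\<^sup>2 + 1" by (simp add: bracket_def max_def)
      from mult_right_mono[OF this, of "(cmod (xs k m))\<^sup>2"]
      show "(bracket m * cmod (xs k m))\<^sup>2 \<le> (of_int m)\<^sup>2 * (cmod (xs k m))\<^sup>2 + (cmod (xs k m))\<^sup>2"
        by (simp add: power_mult_distrib algebra_simps)
    qed
    also have "\<dots> = E + (l2norm (xs k))\<^sup>2"
      unfolding E_def l2norm_power2 by (rule infsum_add[OF s2 s1])
    also have "\<dots> \<le> C\<^sup>2" using E l1 C by simp
    finally show ?thesis using C(2) by (rule power2_le_imp_le)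
  qed
  have xl: "l2 (\<lambda>m. bracket m * cmod (xs k m))" for k using xs[of k] by (simp add: h1_def)
  have cb: "bracket m * cmod (xs k m) \<le> C" for k m
    using norm_le_l2norm[OF xl[of k], of m] bd[of k] by (simp add: abs_mult)
  have cb1: "norm (xs k m) \<le> C" for k m
    using cb[where k=k and m=m] mult_right_mono[of 1 "bracket m" "cmod (xs k m)"] by simp
  obtain r where r: "strict_mono r" "\<And>m. m \<in> UNIV \<Longrightarrow> \<exists>l. (\<lambda>k. xs (r k) m) \<longlonglongrightarrow> l"
    by (rule function_convergent_subsequence[of "UNIV :: int set" xs C]) (use cb1 in auto)
  then obtain x where x: "\<And>m. (\<lambda>k. xs (r k) m) \<longlonglongrightarrow> x m" by (metis UNIV_I)
  have Lx: "L2_set (\<lambda>m. norm (bracket m * cmod (x m))) F \<le> C" for F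
  proof (rule LIMSEQ_le_const2)
    show "(\<lambda>k. L2_set (\<lambda>m. norm (bracket m * cmod (xs (r k) m))) F) \<longlonglongrightarrow> L2_set (\<lambda>m. norm (bracket m * cmod (x m))) F"
      unfolding L2_set_def by (intro tendsto_intros x)
    show "\<exists>N. \<forall>k\<ge>N. L2_set (\<lambda>m. norm (bracket m * cmod (xs (r k) m))) F \<le> C"
      using L2_set_le_l2norm[OF xl] bd order_trans by blast
  qed
  have xh: "x \<in> h1" and xbd: "l2norm (\<lambda>m. bracket m * cmod (x m)) \<le> C"
    using l2I[of "\<lambda>m. bracket m * cmod (x m)" C] Lx by (auto simp: h1_def)
  have xcb: "bracket m * cmod (x m) \<le> C" for m using Lx[of "{m}"] by (simp add: abs_mult)
  define z where "z k = (\<lambda>m. xs (r k) m - x m)" for k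
  have zh: "z k \<in> h1" for k unfolding z_def by (rule seq_inner.diff_mem[OF xs xh])
  have zlim: "(\<lambda>k. z k m) \<longlonglongrightarrow> 0" for m
    unfolding z_def using tendsto_diff[OF x[of m] tendsto_const[of "x m"]] by simp
  have zle: "bracket m * cmod (z k m) \<le> bracket m * cmod (xs (r k) m) + bracket m * cmod (x m)" for k m
    unfolding z_def distrib_left[symmetric] by (intro mult_left_mono norm_triangle_ineq4) auto
  have zcb: "bracket m * cmod (z k m) \<le> 2 * C" for k m using zle[where k=k and m=m] cb[where k="r k" and m=m] xcb[of m] by linarith
  have zbd: "l2norm (\<lambda>m. bracket m * cmod (z k m)) \<le> 2 * C" for k
  proof -
    have xl': "l2 (\<lambda>m. bracket m * cmod (x m))" using xh by (simp add: h1_def)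
    note ad = l2_add[OF xl[of "r k"] xl']
    have "l2norm (\<lambda>m. bracket m * cmod (z k m)) \<le> l2norm (\<lambda>m. bracket m * cmod (xs (r k) m) + bracket m * cmod (x m))"
      by (rule l2_mono(2)[OF ad(1)]) (use zle in \<open>auto intro: order_trans[OF _ abs_ge_self]\<close>)
    then show ?thesis using ad(2) bd[of "r k"] xbd by linarith
  qed
  have zl2: "(\<lambda>k. l2norm (z k)) \<longlonglongrightarrow> 0"
    by (rule l2norm_tendsto_0[of "2*C"]) (use C zcb zlim in auto)
  have conv: "(\<lambda>k. seq_inner (xs (r k)) y) \<longlonglongrightarrow> seq_inner x y" if y: "y \<in> h1" for y
  proof -
    have "(\<lambda>k. seq_inner (z k) y) \<longlonglongrightarrow> 0"
    proof (rule Lim_null_comparison)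
      show "(\<lambda>k. l2norm (z k) * l2norm y) \<longlonglongrightarrow> 0" using tendsto_mult[OF zl2 tendsto_const[of "l2norm y"]] by simp
      show "\<forall>\<^sub>F k in sequentially. cmod (seq_inner (z k) y) \<le> l2norm (z k) * l2norm y"
        by (intro always_eventually allI seq_inner_bound h1_l2 zh y)
    qed
    moreover have "seq_inner (z k) y = seq_inner (xs (r k)) y - seq_inner x y" for k
      unfolding z_def by (rule seq_inner.diff_left[OF xs xh y])
    ultimately show ?thesis by (simp add: LIM_zero_cancel)
  qed
  have xn: "l2norm x = 1"
  proof (rule tendsto_unique)
    show "(\<lambda>k. l2norm (xs (r k))) \<longlonglongrightarrow> 1" using l1 by simp
    have "\<bar>l2norm (xs (r k)) - l2norm x\<bar> \<le> l2norm (z k)" for k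
    proof -
      have "l2norm (\<lambda>m. x m + z k m) \<le> l2norm x + l2norm (z k)" by (intro l2_add h1_l2 xh zh)
      moreover have "l2norm (\<lambda>m. xs (r k) m + (-1) * z k m) \<le> l2norm (xs (r k)) + l2norm (\<lambda>m. (-1) * z k m)"
        by (intro l2_add h1_l2 xs h1_scale zh)
      moreover have "l2norm (\<lambda>m. (-1) * z k m) = l2norm (z k)" using l2_scale(2)[OF h1_l2[OF zh[of k]], of "-1"] by simp
      ultimately show ?thesis by (simp add: z_def)
    qed
    then have "(\<lambda>k. l2norm (xs (r k)) - l2norm x) \<longlonglongrightarrow> 0"
      by (intro Lim_null_comparison[OF _ zl2]) auto
    then show "(\<lambda>k. l2norm (xs (r k))) \<longlonglongrightarrow> l2norm x" by (rule LIM_zero_cancel)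
  qed simp
  have Vlim: "(\<lambda>k. V (xs (r k)) (xs (r k))) \<longlonglongrightarrow> V x x"
  proof -
    have C2: "C \<le> 2 * C" using C(2) by simp
    have 1: "(\<lambda>k. V (z k) (xs (r k))) \<longlonglongrightarrow> 0"
      by (rule V_weakly_continuous[of _ _ "2*C"]) (use zh xs zbd bd C2 zlim order_trans in blast)+
    have 2: "(\<lambda>k. V (z k) x) \<longlonglongrightarrow> 0"
      by (rule V_weakly_continuous[of _ _ "2*C"]) (use zh xh zbd xbd C2 zlim order_trans in blast)+
    have eq: "V (xs (r k)) (xs (r k)) - V x x = V (z k) (xs (r k)) + cnj (V (z k) x)" for k
    proof -
      have "cnj (V (z k) x) = cnj (V (xs (r k)) x) - cnj (V x x)"
        unfolding z_def by (subst V.diff_left[OF xs xh xh]) simp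
      also have "\<dots> = V x (xs (r k)) - V x x"
        using V.hermitian[OF xs[of "r k"] xh] V.hermitian[OF xh xh] by simp
      finally show ?thesis using V.diff_left[OF xs[of "r k"] xh xs[of "r k"]] by (simp add: z_def)
    qed
    have "(\<lambda>k. V (z k) (xs (r k)) + cnj (V (z k) x)) \<longlonglongrightarrow> 0 + cnj 0"
      by (intro tendsto_intros 1 2)
    then show ?thesis unfolding eq[symmetric] by (simp add: LIM_zero_cancel)
  qed
  have "Re (A x x) \<le> a"
  proof -
    have fin: "(\<Sum>m\<in>F. (of_int m)\<^sup>2 * (cmod (x m))\<^sup>2) \<le> (a - Re (V x x)) / pi\<^sup>2" if F: "finite F" for F
    proof -
      have "pi\<^sup>2 * (\<Sum>m\<in>F. (of_int m)\<^sup>2 * (cmod (x m))\<^sup>2) \<le> a - Re (V x x)"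
      proof (rule LIMSEQ_le)
        show "(\<lambda>k. pi\<^sup>2 * (\<Sum>m\<in>F. (of_int m)\<^sup>2 * (cmod (xs (r k) m))\<^sup>2)) \<longlonglongrightarrow> pi\<^sup>2 * (\<Sum>m\<in>F. (of_int m)\<^sup>2 * (cmod (x m))\<^sup>2)"
          by (intro tendsto_intros x)
        show "(\<lambda>k. Re (A (xs (r k)) (xs (r k))) - Re (V (xs (r k)) (xs (r k)))) \<longlonglongrightarrow> a - Re (V x x)"
          by (intro tendsto_intros Vlim LIMSEQ_subseq_LIMSEQ[OF lim r(1), unfolded o_def])
        show "\<exists>N. \<forall>k\<ge>N. pi\<^sup>2 * (\<Sum>m\<in>F. (of_int m)\<^sup>2 * (cmod (xs (r k) m))\<^sup>2) \<le> Re (A (xs (r k)) (xs (r k))) - Re (V (xs (r k)) (xs (r k)))"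
        proof (intro exI allI impI)
          fix k
          have "(\<Sum>m\<in>F. (of_int m)\<^sup>2 * (cmod (xs (r k) m))\<^sup>2) \<le> (\<Sum>\<^sub>\<infinity>m. (of_int m)\<^sup>2 * (cmod (xs (r k) m))\<^sup>2)"
            by (rule finite_sum_le_infsum[OF kinetic_summable'[OF xs] F]) auto
          then show "pi\<^sup>2 * (\<Sum>m\<in>F. (of_int m)\<^sup>2 * (cmod (xs (r k) m))\<^sup>2) \<le> Re (A (xs (r k)) (xs (r k))) - Re (V (xs (r k)) (xs (r k)))"
            unfolding A_diag[OF xs] by (simp add: mult_left_mono)
        qed
      qed
      then show ?thesis by (simp add: pos_le_divide_eq mult.commute)
    qed
    have "kinetic x \<le> (a - Re (V x x)) / pi\<^sup>2"
      by (rule infsum_le_finite_sums[OF kinetic_summable'[OF xh]]) (use fin in auto)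
    then show ?thesis unfolding A_diag[OF xh] by (simp add: pos_le_divide_eq mult.commute)
  qed
  moreover have "seq_inner x x = 1" unfolding seq_inner_self using xn by simp
  ultimately show ?thesis using r(1) xh conv by blast
qed

sublocale H: compact_form h1 seq_inner A
proof unfold_locales
  fix x assume x: "x \<in> h1" "x \<noteq> (\<lambda>_. 0)"
  then obtain m where m: "x m \<noteq> 0" by (auto simp: fun_eq_iff)
  then have "0 < l2norm x" using norm_le_l2norm[OF h1_l2[OF x(1)], of m] by (meson less_le_trans zero_less_norm_iff)
  then show "0 < Re (seq_inner x x)" by (simp add: seq_inner_self)
next
  obtain n where n: "0 < n" "l2norm (kern n w) < 1/2"
    using small_kernel[of "1/2"] by (auto simp: eventually_sequentially)
  have "- (real n)\<^sup>2 * Re (seq_inner x x) \<le> Re (A x x)" if x: "x \<in> h1" for x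
  proof -
    have "0 \<le> kinetic x" by (rule infsum_nonneg) auto
    moreover have "kinetic x - (real n)\<^sup>2 * (l2norm x)\<^sup>2 \<le> Re (A x x)"
      by (rule energy_lower[OF x n(1)]) (use n in simp)
    ultimately show ?thesis by (simp add: seq_inner_self)
  qed
  then show "\<exists>c. \<forall>x\<in>h1. c * Re (seq_inner x x) \<le> Re (A x x)" by blast
next
  fix xs :: "nat \<Rightarrow> int \<Rightarrow> complex" and a
  assume "\<And>k. xs k \<in> h1" "\<And>k. seq_inner (xs k) (xs k) = 1" "(\<lambda>k. Re (A (xs k) (xs k))) \<longlonglongrightarrow> a"
  then show "\<exists>r x. strict_mono r \<and> x \<in> h1 \<and> seq_inner x x = 1 \<and> Re (A x x) \<le> a \<and>
        (\<forall>y\<in>h1. (\<lambda>k. seq_inner (xs (r k)) y) \<longlonglongrightarrow> seq_inner x y)"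
    by (rule compact_sublevel_sets)
next
  fix n :: nat and f :: "nat \<Rightarrow> int \<Rightarrow> complex"
  define I where "I = {0..int n}"
  have "finite I" "n < card I" by (auto simp: I_def)
  from homogeneous_system_nontrivial[OF this, of "\<lambda>j i. cnj (f j i)"] 
  obtain c where c: "\<exists>i\<in>I. c i \<noteq> 0" "\<And>j. j < n \<Longrightarrow> (\<Sum>i\<in>I. cnj (f j i) * c i) = 0" by blast
  define x where "x m = (if m \<in> I then c m else 0)" for m
  have "x \<in> h1" by (rule h1_finite_support, rule finite_subset[of _ I]) (auto simp: x_def I_def)
  moreover have "x \<noteq> (\<lambda>_. 0)" using c(1) by (auto simp: x_def fun_eq_iff)
  moreover have "seq_inner x (f j) = 0" if "j < n" for j
  proof -
    have "seq_inner x (f j) = (\<Sum>\<^sub>\<infinity>i\<in>I. cnj (f j i) * c i)"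
      unfolding seq_inner_def by (rule infsum_cong_neutral) (auto simp: x_def)
    also have "\<dots> = 0" using c(2)[OF that] by (simp add: I_def)
    finally show ?thesis .
  qed
  ultimately show "\<exists>x\<in>h1. x \<noteq> (\<lambda>_. 0) \<and> (\<forall>j<n. seq_inner x (f j) = 0)" by blast
qed

lemma A_minus_shift:
  assumes x: "x \<in> h1"
  shows "(\<lambda>m. (pi\<^sup>2 * (of_int m)\<^sup>2 - \<Lambda>) * (cmod (x m))\<^sup>2) summable_on UNIV"
    and "Re (A x x) - \<Lambda> * Re (seq_inner x x) = (\<Sum>\<^sub>\<infinity>m. (pi\<^sup>2 * (of_int m)\<^sup>2 - \<Lambda>) * (cmod (x m))\<^sup>2) + Re (V x x)"
proof -
  have s1: "(\<lambda>m. - \<Lambda> * (cmod (x m))\<^sup>2) summable_on UNIV" 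
    using h1_l2[OF x] unfolding l2_def by (rule summable_on_cmult_right)
  have s2: "(\<lambda>m. pi\<^sup>2 * ((of_int m)\<^sup>2 * (cmod (x m))\<^sup>2)) summable_on UNIV"
    by (rule summable_on_cmult_right[OF kinetic_summable'[OF x]])
  have eq: "(pi\<^sup>2 * (of_int m)\<^sup>2 - \<Lambda>) * (cmod (x m))\<^sup>2 = pi\<^sup>2 * ((of_int m)\<^sup>2 * (cmod (x m))\<^sup>2) + - \<Lambda> * (cmod (x m))\<^sup>2" for m
    by (simp add: algebra_simps)
  show "(\<lambda>m. (pi\<^sup>2 * (of_int m)\<^sup>2 - \<Lambda>) * (cmod (x m))\<^sup>2) summable_on UNIV"
    unfolding eq by (intro summable_on_add s1 s2)
  have "(\<Sum>\<^sub>\<infinity>m. (pi\<^sup>2 * (of_int m)\<^sup>2 - \<Lambda>) * (cmod (x m))\<^sup>2) = 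
      pi\<^sup>2 * kinetic x + - \<Lambda> * (l2norm x)\<^sup>2"
    unfolding eq l2norm_power2 infsum_add[OF s2 s1]
    by (intro arg_cong2[where f="(+)"] infsum_cmult_right) (use kinetic_summable'[OF x] h1_l2[OF x] in \<open>auto simp: l2_def\<close>)
  then show "Re (A x x) - \<Lambda> * Re (seq_inner x x) = (\<Sum>\<^sub>\<infinity>m. (pi\<^sup>2 * (of_int m)\<^sup>2 - \<Lambda>) * (cmod (x m))\<^sup>2) + Re (V x x)"
    by (simp add: A_diag[OF x] seq_inner_self)
qed

text \<open>The number \<open>n\<^sup>2 + n\<close> lies halfway between \<open>n\<^sup>2\<close> and \<open>(n + 1)\<^sup>2\<close>, up to a bounded error, so the gap between two
  consecutive squares is shared between this bound and \<open>midpoint_above\<close>.\<close>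

lemma midpoint_below:
  assumes "0 < n" "\<bar>m\<bar> \<le> int n"
  shows "pi\<^sup>2 * (of_int m)\<^sup>2 - window_top n \<le> - 2 * (resdist n m * ressum n m)"
proof -
  define p where "p = \<bar>real_of_int m\<bar>"
  define q where "q = real n"
  have q: "1 \<le> q" "0 \<le> p" using assms by (simp_all add: q_def p_def)
  have "\<bar>m\<bar> = int n \<or> \<bar>m\<bar> \<le> int n - 1" using assms by linarith
  then have pq: "p = q \<or> p \<le> q - 1" unfolding p_def q_def by auto
  have "p\<^sup>2 - (q\<^sup>2 + q) \<le> - (1/2) * (max 1 \<bar>p - q\<bar> * (p + q))"
  proof (cases "p = q")
    case False
    then have "max 1 \<bar>p - q\<bar> * (p + q) = q\<^sup>2 - p\<^sup>2" using pq by (simp add: power2_eq_square algebra_simps max_def)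
    moreover have "p\<^sup>2 \<le> q\<^sup>2" using pq q False by (intro power_mono) auto
    ultimately show ?thesis using q by linarith
  qed simp
  then have *: "p\<^sup>2 - (q\<^sup>2 + q) \<le> - (1/2) * (resdist n m * ressum n m)" by (simp add: resdist_def ressum_def p_def q_def)
  have "0 \<le> resdist n m * ressum n m" using ressum_pos[OF assms(1), of m] by simp
  then have "p\<^sup>2 - (q\<^sup>2 + q) \<le> 0" using * by linarith
  then have "pi\<^sup>2 * (p\<^sup>2 - (q\<^sup>2 + q)) \<le> 4 * (p\<^sup>2 - (q\<^sup>2 + q))"
    by (rule mult_right_mono_neg[OF pi2_ge])
  also have "\<dots> \<le> 4 * (- (1/2) * (resdist n m * ressum n m))" by (rule mult_left_mono[OF *]) simp
  finally show ?thesis by (simp add: p_def q_def algebra_simps)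
qed

lemma midpoint_above:
  assumes "0 < n" "int n < \<bar>m\<bar>"
  shows "2 * (resdist n m * ressum n m) \<le> pi\<^sup>2 * (of_int m)\<^sup>2 - window_top n"
proof -
  define p where "p = \<bar>real_of_int m\<bar>"
  define q where "q = real n"
  have "int n + 1 \<le> \<bar>m\<bar>" using assms by linarith
  then have "real_of_int (int n + 1) \<le> real_of_int \<bar>m\<bar>" by (rule of_int_le_iff[THEN iffD2])
  then have q: "1 \<le> q" "q + 1 \<le> p" using assms by (auto simp: q_def p_def)
  have e: "max 1 \<bar>p - q\<bar> * (p + q) = p\<^sup>2 - q\<^sup>2" using q by (simp add: power2_eq_square algebra_simps max_def)
  have "1 * (2 * q) \<le> (p - q) * (p + q)" using q by (intro mult_mono) auto
  then have "2 * q \<le> p\<^sup>2 - q\<^sup>2" by (simp add: power2_eq_square algebra_simps)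
  then have *: "1/2 * (resdist n m * ressum n m) \<le> p\<^sup>2 - (q\<^sup>2 + q)" using e by (simp add: resdist_def ressum_def p_def q_def)
  have "0 \<le> resdist n m * ressum n m" using ressum_pos[OF assms(1), of m] by simp
  then have "0 \<le> p\<^sup>2 - (q\<^sup>2 + q)" using * by linarith
  then have "4 * (p\<^sup>2 - (q\<^sup>2 + q)) \<le> pi\<^sup>2 * (p\<^sup>2 - (q\<^sup>2 + q))"
    by (rule mult_right_mono[OF pi2_ge])
  then show ?thesis using * by (simp add: p_def q_def algebra_simps)
qed

lemma form_negative:
  assumes x: "x \<in> h1" "x \<noteq> (\<lambda>_. 0)" and n: "0 < n" "l2norm (kern n w) \<le> 1"
    and supp: "\<And>m. x m \<noteq> 0 \<Longrightarrow> \<bar>m\<bar> \<le> int n"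
  shows "Re (A x x) < window_top n * Re (seq_inner x x)"
proof -
  obtain m where m: "x m \<noteq> 0" using x by (auto simp: fun_eq_iff)
  have "0 < (form_seq n x m)\<^sup>2" unfolding form_seq_power2[OF n(1)] using m ressum_pos[OF n(1), of m] by simp
  then have "0 < l2norm (form_seq n x)" using norm_le_l2norm[OF l2_form_seq(1)[OF x(1) n(1)], of m]
    by (metis less_le_trans zero_less_norm_iff power_zero_numeral less_irrefl)
  then have W: "0 < (l2norm (form_seq n x))\<^sup>2" by simp
  have "(\<Sum>\<^sub>\<infinity>m. (pi\<^sup>2 * (of_int m)\<^sup>2 - window_top n) * (cmod (x m))\<^sup>2)
      \<le> (\<Sum>\<^sub>\<infinity>m. - 2 * (resdist n m * ressum n m * (cmod (x m))\<^sup>2))"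
  proof (rule infsum_mono[OF A_minus_shift(1)[OF x(1)]])
    show "(\<lambda>m. - 2 * (resdist n m * ressum n m * (cmod (x m))\<^sup>2)) summable_on UNIV"
      by (rule summable_on_cmult_right[OF form_seq_norm(1)[OF x(1) n(1)]])
    fix m
    show "(pi\<^sup>2 * (of_int m)\<^sup>2 - window_top n) * (cmod (x m))\<^sup>2 \<le> - 2 * (resdist n m * ressum n m * (cmod (x m))\<^sup>2)"
      using mult_right_mono[OF midpoint_below[OF n(1) supp], of m "(cmod (x m))\<^sup>2"]
      by (cases "x m = 0") (auto simp: mult.assoc)
  qed
  also have "\<dots> = - 2 * (l2norm (form_seq n x))\<^sup>2"
    unfolding form_seq_norm(2)[OF x(1) n(1)] by (rule infsum_cmult_right[OF form_seq_norm(1)[OF x(1) n(1)]])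
  finally have 1: "(\<Sum>\<^sub>\<infinity>m. (pi\<^sup>2 * (of_int m)\<^sup>2 - window_top n) * (cmod (x m))\<^sup>2) \<le> - 2 * (l2norm (form_seq n x))\<^sup>2" .
  have "l2norm (kern n w) * (l2norm (form_seq n x))\<^sup>2 \<le> 1 * (l2norm (form_seq n x))\<^sup>2" by (intro mult_right_mono n) auto
  then have "Re (A x x) - window_top n * Re (seq_inner x x) < 0"
    unfolding A_minus_shift(2)[OF x(1)] using 1 V_diag_bound[OF x(1) n(1)] W by linarith
  then show ?thesis by simp
qed

lemma form_positive:
  assumes x: "x \<in> h1" and n: "0 < n" "l2norm (kern n w) \<le> 1"
    and supp: "\<And>m. x m \<noteq> 0 \<Longrightarrow> int n < \<bar>m\<bar>"
  shows "window_top n * Re (seq_inner x x) \<le> Re (A x x)"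
proof -
  have "2 * (l2norm (form_seq n x))\<^sup>2 = (\<Sum>\<^sub>\<infinity>m. 2 * (resdist n m * ressum n m * (cmod (x m))\<^sup>2))"
    unfolding form_seq_norm(2)[OF x n(1)] by (rule infsum_cmult_right[OF form_seq_norm(1)[OF x n(1)], symmetric])
  also have "\<dots> \<le> (\<Sum>\<^sub>\<infinity>m. (pi\<^sup>2 * (of_int m)\<^sup>2 - window_top n) * (cmod (x m))\<^sup>2)"
  proof (rule infsum_mono[OF _ A_minus_shift(1)[OF x(1)]])
    show "(\<lambda>m. 2 * (resdist n m * ressum n m * (cmod (x m))\<^sup>2)) summable_on UNIV"
      by (rule summable_on_cmult_right[OF form_seq_norm(1)[OF x(1) n(1)]])
    fix m
    show "2 * (resdist n m * ressum n m * (cmod (x m))\<^sup>2) \<le> (pi\<^sup>2 * (of_int m)\<^sup>2 - window_top n) * (cmod (x m))\<^sup>2"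
      using mult_right_mono[OF midpoint_above[OF n(1) supp], of m "(cmod (x m))\<^sup>2"]
      by (cases "x m = 0") (auto simp: mult.assoc)
  qed
  finally have 1: "2 * (l2norm (form_seq n x))\<^sup>2 \<le> (\<Sum>\<^sub>\<infinity>m. (pi\<^sup>2 * (of_int m)\<^sup>2 - window_top n) * (cmod (x m))\<^sup>2)" .
  have "l2norm (kern n w) * (l2norm (form_seq n x))\<^sup>2 \<le> 1 * (l2norm (form_seq n x))\<^sup>2" by (intro mult_right_mono n) auto
  then have "0 \<le> Re (A x x) - window_top n * Re (seq_inner x x)"
    unfolding A_minus_shift(2)[OF x(1)] using 1 V_diag_bound[OF x(1) n(1)] zero_le_power2[of "l2norm (form_seq n x)"] by linarith
  then show ?thesis by simp
qed

text \<open>The form lies below \<open>window_top n\<close> on the \<open>2 n + 1\<close> modes \<open>\<bar>m\<bar> \<le> n\<close> and above it on the sequences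
  annihilated by those coordinates.\<close>

lemma eigenvalue_count:
  assumes seq: "H.spectral_sequence l e" and n: "0 < n" "l2norm (kern n w) \<le> 1"
  shows "l (2 * n) < window_top n" "window_top n \<le> l (2 * n + 1)"
proof -
  define f :: "nat \<Rightarrow> int \<Rightarrow> complex" where "f i m = (if m = int i - int n then 1 else 0)" for i m
  have fh: "f i \<in> h1" for i
    by (rule h1_finite_support, rule finite_subset[of _ "{int i - int n}"]) (auto simp: f_def)
  show "l (2 * n) < window_top n"
  proof (rule H.eigenvalue_less[OF seq fh])
    fix c :: "nat \<Rightarrow> complex" assume c: "\<exists>i\<le>2 * n. c i \<noteq> 0"
    define y where "y = (\<lambda>m. \<Sum>i\<le>2*n. c i * f i m)"
    have y: "y m = (if \<bar>m\<bar> \<le> int n then c (nat (m + int n)) else 0)" for m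
    proof -
      have "y m = (\<Sum>i\<le>2*n. if int i = m + int n then c i else 0)"
        unfolding y_def by (intro sum.cong) (auto simp: f_def)
      also have "\<dots> = (\<Sum>i\<in>{i. i \<le> 2*n \<and> int i = m + int n}. c i)"
        by (simp add: sum.inter_filter[symmetric])
      also have "{i. i \<le> 2*n \<and> int i = m + int n} = (if \<bar>m\<bar> \<le> int n then {nat (m + int n)} else {})"
        by auto
      finally show ?thesis by auto
    qed
    have yh: "y \<in> h1" unfolding y_def by (rule seq_inner.sum_mem) (use fh in auto)
    obtain i where i: "i \<le> 2*n" "c i \<noteq> 0" using c by auto
    have "y (int i - int n) \<noteq> 0" using i y[of "int i - int n"] by auto
    then have "y \<noteq> (\<lambda>_. 0)" by auto
    then show "Re (A (\<lambda>m. \<Sum>i\<le>2*n. c i * f i m) (\<lambda>m. \<Sum>i\<le>2*n. c i * f i m))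
      < window_top n * Re (seq_inner (\<lambda>m. \<Sum>i\<le>2*n. c i * f i m) (\<lambda>m. \<Sum>i\<le>2*n. c i * f i m))"
      unfolding y_def[symmetric] by (intro form_negative yh n) (auto simp: y split: if_splits)
  qed
  show "window_top n \<le> l (2 * n + 1)"
  proof (rule H.eigenvalue_ge[OF seq, where \<phi>="\<lambda>j y. y (int j - int n)"])
    fix y assume y: "y \<in> h1" "\<And>j. j < 2 * n + 1 \<Longrightarrow> y (int j - int n) = 0"
    show "window_top n * Re (seq_inner y y) \<le> Re (A y y)"
    proof (rule form_positive[OF y(1) n])
      fix m assume nz: "y m \<noteq> 0"
      show "int n < \<bar>m\<bar>"
      proof (rule ccontr)
        assume "\<not> int n < \<bar>m\<bar>"
        then have "nat (m + int n) < 2 * n + 1" "int (nat (m + int n)) - int n = m" by auto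
        then show False using y(2)[of "nat (m + int n)"] nz by simp
      qed
    qed
  qed simp
qed

end

section \<open>The two eigenvalues of a window\<close>

context singular_potential
begin

definition conv :: "(int \<Rightarrow> complex) \<Rightarrow> int \<Rightarrow> complex" where
  "conv x m = (\<Sum>\<^sub>\<infinity>k. v (m - k) * x k)"

abbreviation row :: "real \<Rightarrow> (int \<Rightarrow> complex) \<Rightarrow> int \<Rightarrow> complex" where
  "row \<mu> x m \<equiv> (of_real (pi\<^sup>2 * (of_int m)\<^sup>2) - of_real \<mu>) * x m + conv x m"

definition delta :: "int \<Rightarrow> int \<Rightarrow> complex" where
  "delta m k = (if k = m then 1 else 0)"

lemma delta_h1: "delta m \<in> h1"
  by (rule h1_finite_support, rule finite_subset[of _ "{m}"]) (auto simp: delta_def)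

lemma seq_inner_delta: "seq_inner x (delta m) = x m"
proof -
  have "seq_inner x (delta m) = (\<Sum>\<^sub>\<infinity>k\<in>{m}. x k)"
    unfolding seq_inner_def by (rule infsum_cong_neutral) (auto simp: delta_def)
  then show ?thesis by simp
qed

lemma conv_summable:
  assumes "x \<in> h1" shows "(\<lambda>k. cmod (v (m - k) * x k)) summable_on UNIV"
proof -
  have "(\<lambda>p. cmod (vterm x (delta m) p)) summable_on (Pair m ` UNIV)"
    by (rule summable_on_subset_banach[OF vterm_summable(1)[OF assms delta_h1, of 1]]) auto
  then have "((\<lambda>p. cmod (vterm x (delta m) p)) \<circ> Pair m) summable_on UNIV"
    by (subst (asm) summable_on_reindex) (auto simp: inj_on_def)
  then show ?thesis by (simp add: o_def vterm_def delta_def)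
qed

lemma conv_summable': "x \<in> h1 \<Longrightarrow> (\<lambda>k. v (m - k) * x k) summable_on UNIV"
  by (rule abs_summable_summable, rule conv_summable)

lemma A_delta:
  assumes "x \<in> h1" shows "A x (delta m) = of_real (pi\<^sup>2 * (of_int m)\<^sup>2) * x m + conv x m"
proof -
  have "(\<Sum>\<^sub>\<infinity>k. of_real (pi\<^sup>2 * (of_int k)\<^sup>2) * x k * cnj (delta m k)) = (\<Sum>\<^sub>\<infinity>k\<in>{m}. of_real (pi\<^sup>2 * (of_int k)\<^sup>2) * x k)"
    by (rule infsum_cong_neutral) (auto simp: delta_def)
  moreover have "V x (delta m) = (\<Sum>\<^sub>\<infinity>p\<in>Pair m ` UNIV. vterm x (delta m) p)"
    unfolding V_def by (rule infsum_cong_neutral) (auto simp: vterm_def delta_def)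
  moreover have "\<dots> = conv x m"
    unfolding conv_def by (subst infsum_reindex) (auto simp: inj_on_def vterm_def delta_def o_def)
  ultimately show ?thesis by (simp add: A_def)
qed

lemma eigenpair_row:
  assumes "H.eigenpair x \<mu>"
  shows "row \<mu> x m = 0"
  using assms A_delta[of x m] delta_h1[of m] by (auto simp: H.eigenpair_def seq_inner_delta algebra_simps)

lemma conv_combination:
  assumes "x \<in> h1" "y \<in> h1"
  shows "conv (\<lambda>m. a * x m + b * y m) m = a * conv x m + b * conv y m"
proof -
  have "conv (\<lambda>m. a * x m + b * y m) m = (\<Sum>\<^sub>\<infinity>k. a * (v (m - k) * x k) + b * (v (m - k) * y k))"
    unfolding conv_def by (intro infsum_cong) (simp add: algebra_simps)
  also have "\<dots> = (\<Sum>\<^sub>\<infinity>k. a * (v (m - k) * x k)) + (\<Sum>\<^sub>\<infinity>k. b * (v (m - k) * y k))"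
    by (intro infsum_add summable_on_cmult_right conv_summable' assms)
  also have "\<dots> = a * conv x m + b * conv y m"
    unfolding conv_def by (intro arg_cong2[where f="(+)"] infsum_cmult_right conv_summable' assms)
  finally show ?thesis .
qed

text \<open>On the Fourier side this is complex conjugation of the function.\<close>

definition star :: "(int \<Rightarrow> complex) \<Rightarrow> int \<Rightarrow> complex" where "star x m = cnj (x (- m))"

lemma star_star [simp]: "star (star x) = x" by (simp add: star_def fun_eq_iff)

lemma star_h1: "x \<in> h1 \<Longrightarrow> star x \<in> h1"
  using l2_bij(1)[OF bij_add_int(5), of "\<lambda>m. bracket m * cmod (x m)"] by (simp add: h1_def star_def)

lemma conv_star: "conv (star x) m = cnj (conv x (- m))"
proof -
  have "conv (star x) m = (\<Sum>\<^sub>\<infinity>k. cnj (v (- m - (- k)) * x (- k)))"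
    unfolding conv_def
    by (intro infsum_cong) (use v_minus[of "m - k" for k] in \<open>simp add: star_def; metis complex_cnj_cnj minus_diff_eq diff_minus_eq_add add.commute uminus_add_conv_diff\<close>)
  also have "\<dots> = (\<Sum>\<^sub>\<infinity>k. cnj (v (- m - k) * x k))"
    by (rule infsum_reindex_bij_betw[OF bij_add_int(5), of "\<lambda>k. cnj (v (- m - k) * x k)"])
  also have "\<dots> = cnj (conv x (- m))" by (simp only: infsum_cnj conv_def)
  finally show ?thesis .
qed

lemma seq_inner_star: "seq_inner (star x) y = cnj (seq_inner x (star y))"
proof -
  have "seq_inner (star x) y = (\<Sum>\<^sub>\<infinity>m. (\<lambda>m. cnj (x m * cnj (star y m))) (- m))"
    unfolding seq_inner_def by (intro infsum_cong) (simp add: star_def)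
  also have "\<dots> = (\<Sum>\<^sub>\<infinity>m. cnj (x m * cnj (star y m)))"
    by (rule infsum_reindex_bij_betw[OF bij_add_int(5)])
  finally show ?thesis by (simp only: infsum_cnj seq_inner_def)
qed

lemma V_star: "V (star x) y = cnj (V x (star y))"
proof -
  have b: "bij (\<lambda>p. (- fst p, - snd p) :: int \<times> int)"
    by (rule o_bij[where g="\<lambda>p. (- fst p, - snd p)"]) auto
  have vm: "cnj (v (k - m)) = v (m - k)" for k m using v_minus[of "k - m"] by simp
  have "V (star x) y = (\<Sum>\<^sub>\<infinity>p. (\<lambda>p. cnj (vterm x (star y) p)) (- fst p, - snd p))"
    unfolding V_def by (intro infsum_cong) (simp add: star_def vterm_def case_prod_unfold vm)
  also have "\<dots> = (\<Sum>\<^sub>\<infinity>p. cnj (vterm x (star y) p))"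
    by (rule infsum_reindex_bij_betw[OF b])
  finally show ?thesis by (simp only: infsum_cnj V_def)
qed

lemma A_star: "A (star x) y = cnj (A x (star y))"
proof -
  have "(\<Sum>\<^sub>\<infinity>m. of_real (pi\<^sup>2 * (of_int m)\<^sup>2) * star x m * cnj (y m)) =
      (\<Sum>\<^sub>\<infinity>m. (\<lambda>m. cnj (of_real (pi\<^sup>2 * (of_int m)\<^sup>2) * x m * cnj (star y m))) (- m))"
    by (intro infsum_cong) (simp add: star_def)
  also have "\<dots> = (\<Sum>\<^sub>\<infinity>m. cnj (of_real (pi\<^sup>2 * (of_int m)\<^sup>2) * x m * cnj (star y m)))"
    by (rule infsum_reindex_bij_betw[OF bij_add_int(5)])
  finally show ?thesis unfolding A_def V_star complex_cnj_add by (simp only: infsum_cnj)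
qed

text \<open>The potential is real, so complex conjugation preserves eigenspaces.\<close>

lemma eigenpair_star: "H.eigenpair x \<mu> \<Longrightarrow> H.eigenpair (star x) \<mu>"
  unfolding H.eigenpair_def by (auto simp: A_star seq_inner_star star_h1)

subsection \<open>Off-resonance components\<close>

text \<open>Multiplication by the distance to resonance makes the equation for the components away from \<open>\<plusminus> n\<close> a fixed
  point equation with the small kernel \<open>kern n w\<close>.\<close>

definition off_resonant :: "nat \<Rightarrow> (int \<Rightarrow> complex) \<Rightarrow> int \<Rightarrow> real" where
  "off_resonant n x m = (if \<bar>m\<bar> = int n then 0 else resdist n m * cmod (x m))"

lemma off_resonant_nonneg [simp]: "0 \<le> off_resonant n x m" by (simp add: off_resonant_def)

lemma l2_off_resonant: 
  assumes "x \<in> h1" "0 < n" shows "l2 (off_resonant n x)"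
proof (rule l2_mono(1))
  show "l2 (\<lambda>m. (real n + 1) * (bracket m * cmod (x m)))" using assms by (intro l2_scale) (auto simp: h1_def)
  fix m
  have "real n * 1 \<le> real n * bracket m" by (intro mult_left_mono) auto
  then have "resdist n m \<le> (real n + 1) * bracket m" 
    using resdist_le_ressum[OF assms(2), of m] by (auto simp: ressum_def bracket_def algebra_simps)
  then have "resdist n m * cmod (x m) \<le> (real n + 1) * bracket m * cmod (x m)" by (intro mult_right_mono) auto
  then show "norm (off_resonant n x m) \<le> norm ((real n + 1) * (bracket m * cmod (x m)))" 
    by (auto simp: off_resonant_def abs_mult mult.assoc)
qed

lemma cmod_le_off_resonant: "\<bar>m\<bar> \<noteq> int n \<Longrightarrow> cmod (x m) \<le> off_resonant n x m"
  using mult_right_mono[of 1 "resdist n m" "cmod (x m)"] by (simp add: off_resonant_def)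

text \<open>Throughout the window the only resonant modes are \<open>\<plusminus> n\<close>.\<close>

lemma window_bound:
  assumes n: "2 \<le> n" and m: "\<bar>m\<bar> \<noteq> int n"
    and \<mu>: "window_bottom n \<le> \<mu>" "\<mu> \<le> window_top n"
  shows "resdist n m * ressum n m \<le> \<bar>pi\<^sup>2 * (of_int m)\<^sup>2 - \<mu>\<bar>"
proof (cases "int n < \<bar>m\<bar>")
  case True
  have "0 \<le> resdist n m * ressum n m" using n ressum_pos[of n m] by simp
  moreover have "2 * (resdist n m * ressum n m) \<le> pi\<^sup>2 * (of_int m)\<^sup>2 - window_top n"
    by (rule midpoint_above) (use n True in auto)
  ultimately show ?thesis using \<mu> by linarith
next
  case False
  define p where "p = \<bar>real_of_int m\<bar>"
  define q where "q = real n"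
  have "\<bar>m\<bar> \<le> int n - 1" using m False by linarith
  then have "real_of_int \<bar>m\<bar> \<le> real_of_int (int n - 1)" by (rule of_int_le_iff[THEN iffD2])
  then have pq: "p \<le> q - 1" "0 \<le> p" "2 \<le> q" using n by (simp_all add: p_def q_def)
  have e: "resdist n m * ressum n m = q\<^sup>2 - p\<^sup>2" using pq(1) 
    unfolding resdist_def ressum_def p_def[symmetric] q_def[symmetric] by (simp add: power2_eq_square algebra_simps max_def)
  have "p\<^sup>2 \<le> (q - 1)\<^sup>2" using pq by (intro power_mono) auto
  then have h: "2 * q - 1 \<le> q\<^sup>2 - p\<^sup>2" by (simp add: power2_eq_square algebra_simps)
  have h2: "q\<^sup>2 - p\<^sup>2 \<le> 4 * (q\<^sup>2 - q - p\<^sup>2)"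
  proof -
    have "3 * (2 * q - 1) \<le> 3 * (q\<^sup>2 - p\<^sup>2)" using h by (intro mult_left_mono) auto
    then show ?thesis using pq(3) by (simp add: algebra_simps)
  qed
  have "4 * (q\<^sup>2 - q - p\<^sup>2) \<le> pi\<^sup>2 * (q\<^sup>2 - q - p\<^sup>2)"
    by (rule mult_right_mono[OF pi2_ge]) (use h pq in linarith)
  also have "\<dots> \<le> \<mu> - pi\<^sup>2 * (of_int m)\<^sup>2" using \<mu>(1) by (simp add: p_def q_def algebra_simps)
  finally show ?thesis using e h2 by linarith
qed

lemma source_le:
  assumes "0 < n" "\<bar>i\<bar> \<le> int n"
  shows "cmod (v (m - i)) / ressum n m \<le> damped n w (m - i)"
proof -
  have r: "0 < ressum n m" by (rule ressum_pos[OF assms(1)])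
  have "bracket (m - i) \<le> ressum n m" using assms by (auto simp: bracket_def ressum_def)
  then have "bracket (m - i) / ressum n m \<le> 1" using r by simp
  moreover have "bracket (m - i) / ressum n m \<le> bracket (m - i) / n"
    using assms r ressum_ge[of n m] by (intro divide_left_mono) auto
  ultimately have "w (m - i) * (bracket (m - i) / ressum n m) \<le> w (m - i) * min 1 (bracket (m - i) / n)"
    by (intro mult_left_mono) auto
  then show ?thesis by (simp add: damped_def cmod_v mult.commute)
qed

lemma conv_split:
  assumes x: "x \<in> h1" and n: "0 < n"
  shows "conv x m = v (m - int n) * x (int n) + v (m + int n) * x (- int n)
    + (\<Sum>\<^sub>\<infinity>k\<in>{k. \<bar>k\<bar> \<noteq> int n}. v (m - k) * x k)"
proof -
  have U: "UNIV = {int n, - int n} \<union> {k. \<bar>k\<bar> \<noteq> int n}" by auto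
  have "conv x m = (\<Sum>\<^sub>\<infinity>k\<in>{int n, - int n}. v (m - k) * x k) + (\<Sum>\<^sub>\<infinity>k\<in>{k. \<bar>k\<bar> \<noteq> int n}. v (m - k) * x k)"
    unfolding conv_def by (subst U, rule infsum_Un_disjoint)
      (use summable_on_subset_banach[OF conv_summable'[OF x]] in auto)
  then show ?thesis using n by simp
qed

text \<open>The row \<open>m\<close> of the equation is solved for \<open>x m\<close> and divided by the diagonal entry, which \<open>window_bound\<close>
  controls.  The components at \<open>\<plusminus> n\<close> act as sources through \<open>damped n w\<close>, the others through the kernel.  The inhomogeneity
  \<open>g h\<close> is zero for an eigenvector and measures the gap for other vectors of the spectral pair.\<close>

lemma off_resonant_equation:
  assumes x: "x \<in> h1" and n: "2 \<le> n"
    and \<mu>: "window_bottom n \<le> \<mu>" "\<mu> \<le> window_top n"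
    and eq: "\<And>m. row \<mu> x m = of_real g * h m"
    and g: "0 \<le> g"
  shows "off_resonant n x m \<le> cmod (x (int n)) * damped n w (m - int n) + cmod (x (- int n)) * damped n w (m + int n)
     + (\<Sum>\<^sub>\<infinity>k. kern n w (m,k) * off_resonant n x k) + g * cmod (h m) / ressum n m"
proof -
  have n0: "0 < n" using n by simp
  have r: "0 < ressum n m" by (rule ressum_pos[OF n0])
  have ks: "(\<lambda>k. kern n w (m,k) * off_resonant n x k) summable_on UNIV"
    using l2_kernel(1)[OF l2_kern(1)[OF n0 w_nonneg l2_w] l2_off_resonant[OF x n0], of m] kern_w_nonneg[OF n0] by simp
  have rhs0: "0 \<le> cmod (x (int n)) * damped n w (m - int n) + cmod (x (- int n)) * damped n w (m + int n)
     + (\<Sum>\<^sub>\<infinity>k. kern n w (m,k) * off_resonant n x k) + g * cmod (h m) / ressum n m"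
    using g r kern_w_nonneg[OF n0] by (intro add_nonneg_nonneg infsum_nonneg mult_nonneg_nonneg divide_nonneg_pos) (auto simp: damped_def)
  show ?thesis
  proof (cases "\<bar>m\<bar> = int n")
    case True
    then show ?thesis using rhs0 by (simp add: off_resonant_def)
  next
    case False
    define T where "T = (\<Sum>\<^sub>\<infinity>k\<in>{k. \<bar>k\<bar> \<noteq> int n}. v (m - k) * x k)"
    have "cmod (of_real (pi\<^sup>2 * (of_int m)\<^sup>2 - \<mu>) * x m) \<le> g * cmod (h m) + cmod (conv x m)"
    proof -
      have "of_real (pi\<^sup>2 * (of_int m)\<^sup>2 - \<mu>) * x m = of_real g * h m - conv x m"
        using eq[of m] by (simp add: algebra_simps)
      then show ?thesis using norm_triangle_ineq4[of "of_real g * h m" "conv x m"] g by (simp add: norm_mult)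
    qed
    moreover have "resdist n m * ressum n m * cmod (x m) \<le> cmod (of_real (pi\<^sup>2 * (of_int m)\<^sup>2 - \<mu>) * x m)"
      unfolding norm_mult norm_of_real by (rule mult_right_mono[OF window_bound[OF n False \<mu>]]) simp
    moreover have "cmod (conv x m) \<le> cmod (v (m - int n)) * cmod (x (int n)) + cmod (v (m + int n)) * cmod (x (- int n)) + cmod T"
      unfolding conv_split[OF x n0] T_def by (intro norm_triangle_le add_mono) (auto simp: norm_mult)
    ultimately have 1: "resdist n m * ressum n m * cmod (x m) \<le> 
       cmod (v (m - int n)) * cmod (x (int n)) + cmod (v (m + int n)) * cmod (x (- int n)) + cmod T + g * cmod (h m)"
      by linarith
    have T: "cmod T \<le> ressum n m * (\<Sum>\<^sub>\<infinity>k. kern n w (m,k) * off_resonant n x k)"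
    proof -
      have s: "(\<lambda>k. cmod (v (m - k) * x k)) summable_on {k. \<bar>k\<bar> \<noteq> int n}"
        by (rule summable_on_subset_banach[OF conv_summable[OF x]]) auto
      have "cmod T \<le> (\<Sum>\<^sub>\<infinity>k\<in>{k. \<bar>k\<bar> \<noteq> int n}. cmod (v (m - k) * x k))"
        unfolding T_def by (rule norm_infsum_bound[OF s])
      also have "\<dots> \<le> (\<Sum>\<^sub>\<infinity>k. ressum n m * (kern n w (m,k) * off_resonant n x k))"
      proof (rule infsum_mono_neutral[OF s summable_on_cmult_right[OF ks]])
        fix k assume "k \<in> {k. \<bar>k\<bar> \<noteq> int n} \<inter> UNIV"
        then show "cmod (v (m - k) * x k) \<le> ressum n m * (kern n w (m,k) * off_resonant n x k)"
          using r by (simp add: off_resonant_def kern_def norm_mult cmod_v[symmetric])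
      qed (use r kern_w_nonneg[OF n0] in auto)
      also have "\<dots> = ressum n m * (\<Sum>\<^sub>\<infinity>k. kern n w (m,k) * off_resonant n x k)" by (rule infsum_cmult_right[OF ks])
      finally show ?thesis .
    qed
    have "off_resonant n x m = resdist n m * ressum n m * cmod (x m) / ressum n m" using r False by (simp add: off_resonant_def)
    also have "\<dots> \<le> (cmod (v (m - int n)) * cmod (x (int n)) + cmod (v (m + int n)) * cmod (x (- int n)) 
        + ressum n m * (\<Sum>\<^sub>\<infinity>k. kern n w (m,k) * off_resonant n x k) + g * cmod (h m)) / ressum n m"
      by (rule divide_right_mono) (use 1 T r in linarith)+
    also have "\<dots> = cmod (x (int n)) * (cmod (v (m - int n)) / ressum n m) + cmod (x (- int n)) * (cmod (v (m - (- int n))) / ressum n m)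
        + (\<Sum>\<^sub>\<infinity>k. kern n w (m,k) * off_resonant n x k) + g * cmod (h m) / ressum n m"
      using r by (simp add: add_divide_distrib mult.commute)
    also have "\<dots> \<le> cmod (x (int n)) * damped n w (m - int n) + cmod (x (- int n)) * damped n w (m - (- int n))
        + (\<Sum>\<^sub>\<infinity>k. kern n w (m,k) * off_resonant n x k) + g * cmod (h m) / ressum n m"
      by (intro add_mono mult_left_mono source_le n0 order_refl) auto
    finally show ?thesis by simp
  qed
qed

text \<open>Taking norms in \<open>off_resonant_equation\<close>, the kernel term is absorbed on the left.\<close>

lemma off_resonant_norm:
  assumes x: "x \<in> h1" and n: "2 \<le> n" and k: "l2norm (kern n w) \<le> 1/2"
    and \<mu>: "window_bottom n \<le> \<mu>" "\<mu> \<le> window_top n"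
    and eq: "\<And>m. row \<mu> x m = of_real g * h m"
    and g: "0 \<le> g" and h: "l2 h"
  shows "l2norm (off_resonant n x) \<le> 2 * (cmod (x (int n)) + cmod (x (- int n))) * l2norm (damped n w) + 2 * g * l2norm h / n"
proof -
  have n0: "0 < n" using n by simp
  note K = l2_kernel[OF l2_kern(1)[OF n0 w_nonneg l2_w] l2_off_resonant[OF x n0]]
  have nn: "norm (kern n w (m,k)) * norm (off_resonant n x k) = kern n w (m,k) * off_resonant n x k" for m k
    using kern_w_nonneg[OF n0] by simp
  note K = K[unfolded nn]
  note c = l2_damped(1)[OF l2_w, of n]
  have c1: "l2 (\<lambda>m. damped n w (m - int n))" "l2norm (\<lambda>m. damped n w (m - int n)) = l2norm (damped n w)"
    and c2: "l2 (\<lambda>m. damped n w (m + int n))" "l2norm (\<lambda>m. damped n w (m + int n)) = l2norm (damped n w)"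
    using l2_bij[OF bij_add_int(4), of "damped n w" "int n"] l2_bij[OF bij_add_int(1), of "damped n w" "int n"] c by auto
  note s1 = l2_scale[OF c1(1), of "cmod (x (int n))"]
  note s2 = l2_scale[OF c2(1), of "cmod (x (- int n))"]
  have hle: "norm (g * cmod (h m) / ressum n m) \<le> norm (g / n * cmod (h m))" for m
  proof -
    have "g * cmod (h m) / ressum n m \<le> g * cmod (h m) / n"
      using g n0 ressum_ge[of n m] by (intro divide_left_mono) auto
    then show ?thesis using g ressum_pos[OF n0, of m] by (simp add: abs_mult)
  qed
  note s4 = l2_scale[of "\<lambda>m. cmod (h m)" "g / n", unfolded l2_norm, OF h]
  note s4' = l2_mono[OF s4(1) hle]
  note a1 = l2_add[OF s1(1) s2(1)]
  note a2 = l2_add[OF a1(1) K(2)]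
  note a3 = l2_add[OF a2(1) s4'(1)]
  have "l2norm (off_resonant n x) \<le> l2norm (\<lambda>m. cmod (x (int n)) * damped n w (m - int n) + cmod (x (- int n)) * damped n w (m + int n)
     + (\<Sum>\<^sub>\<infinity>k. kern n w (m,k) * off_resonant n x k) + g * cmod (h m) / ressum n m)"
    by (rule l2_mono(2)[OF a3(1)]) (use off_resonant_equation[OF x n \<mu> eq g] in \<open>simp add: order_trans[OF _ abs_ge_self]\<close>)
  also have "\<dots> \<le> cmod (x (int n)) * l2norm (damped n w) + cmod (x (- int n)) * l2norm (damped n w) + l2norm (kern n w) * l2norm (off_resonant n x) + g / n * l2norm h"
    using a3(2) a2(2) a1(2) s1(2) s2(2) c1(2) c2(2) K(3) s4(2) s4'(2) g by simp
  also have "l2norm (kern n w) * l2norm (off_resonant n x) \<le> 1/2 * l2norm (off_resonant n x)" by (intro mult_right_mono k) auto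
  finally have "l2norm (off_resonant n x) \<le> cmod (x (int n)) * l2norm (damped n w) + cmod (x (- int n)) * l2norm (damped n w)
      + 1/2 * l2norm (off_resonant n x) + g / n * l2norm h" by simp
  moreover have "2 * g * l2norm h / n = 2 * (g / n * l2norm h)" by simp
  moreover have "2 * (cmod (x (int n)) + cmod (x (- int n))) * l2norm (damped n w) =
      2 * (cmod (x (int n)) * l2norm (damped n w)) + 2 * (cmod (x (- int n)) * l2norm (damped n w))" by (simp add: algebra_simps)
  ultimately show ?thesis by linarith
qed

subsection \<open>The spectral pair\<close>

text \<open>If two unit vectors have little mass away from \<open>\<plusminus> n\<close>, then so has each combination of them, and its norm is
  controlled by its two resonant components.\<close>

lemma pair_norm_le:
  assumes e1: "l2 e1" "l2norm e1 = 1" and e2: "l2 e2" "l2norm e2 = 1"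
    and off_resonant1: "\<And>m. \<bar>m\<bar> \<noteq> int n \<Longrightarrow> cmod (e1 m) \<le> t1 m" "l2 t1" "l2norm t1 \<le> 1/8"
    and off_resonant2: "\<And>m. \<bar>m\<bar> \<noteq> int n \<Longrightarrow> cmod (e2 m) \<le> t2 m" "l2 t2" "l2norm t2 \<le> 1/8"
    and x: "x = (\<lambda>m. c1 * e1 m + c2 * e2 m)" and c: "cmod c1 \<le> l2norm x" "cmod c2 \<le> l2norm x"
    and t0: "\<And>m. 0 \<le> t1 m" "\<And>m. 0 \<le> t2 m"
  shows "l2norm x \<le> 2 * (cmod (x (int n)) + cmod (x (- int n)))"
proof -
  define a where "a = cmod (x (int n))"
  define b where "b = cmod (x (- int n))"
  define d :: "real \<Rightarrow> int \<Rightarrow> int \<Rightarrow> real" where "d s i m = (if m = i then s else 0)" for s i m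
  have d: "l2 (d s i)" "l2norm (d s i) \<le> s" if "0 \<le> s" for s i
  proof -
    have *: "L2_set (\<lambda>m. norm (d s i m)) F \<le> s" if "finite F" for F
    proof -
      have "L2_set (\<lambda>m. norm (d s i m)) F \<le> (\<Sum>m\<in>F. norm (d s i m))" by (rule L2_set_le_sum) auto
      also have "\<dots> \<le> s" using \<open>0 \<le> s\<close> that by (simp add: d_def if_distrib cong: if_cong)
      finally show ?thesis .
    qed
    show "l2 (d s i)" by (rule l2I(1)[OF *])
    show "l2norm (d s i) \<le> s" by (rule l2I(2)[OF *])
  qed
  note s1 = l2_scale[OF off_resonant1(2), of "cmod c1"]
  note s2 = l2_scale[OF off_resonant2(2), of "cmod c2"]
  note A1 = l2_add[OF d(1)[of a "int n"] d(1)[of b "- int n"]]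
  note A2 = l2_add[OF s1(1) s2(1)]
  have ab: "0 \<le> a" "0 \<le> b" by (auto simp: a_def b_def)
  note A3 = l2_add[OF A1(1)[OF ab] A2(1)]
  have "l2norm x \<le> l2norm (\<lambda>m. d a (int n) m + d b (- int n) m + (cmod c1 * t1 m + cmod c2 * t2 m))"
  proof (rule l2_mono(2)[OF A3(1)])
    fix m
    have "cmod (x m) \<le> d a (int n) m + d b (- int n) m + (cmod c1 * t1 m + cmod c2 * t2 m)"
    proof (cases "\<bar>m\<bar> = int n")
      case True
      then have "m = int n \<or> m = - int n" by linarith
      moreover have "0 \<le> cmod c1 * t1 m + cmod c2 * t2 m" using t0 by simp
      ultimately show ?thesis using ab by (auto simp: d_def a_def b_def)
    next
      case False
      have "cmod (x m) \<le> cmod c1 * cmod (e1 m) + cmod c2 * cmod (e2 m)"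
        unfolding x using norm_triangle_ineq[of "c1 * e1 m" "c2 * e2 m"] by (simp add: norm_mult)
      also have "\<dots> \<le> cmod c1 * t1 m + cmod c2 * t2 m"
        by (intro add_mono mult_left_mono off_resonant1(1)[OF False] off_resonant2(1)[OF False]) auto
      finally show ?thesis using False ab by (auto simp: d_def)
    qed
    then show "norm (x m) \<le> norm (d a (int n) m + d b (- int n) m + (cmod c1 * t1 m + cmod c2 * t2 m))"
      by (simp add: order_trans[OF _ abs_ge_self])
  qed
  also have "\<dots> \<le> a + b + (cmod c1 * l2norm t1 + cmod c2 * l2norm t2)"
    using A3(2) A1(2)[OF ab] A2(2) s1(2) s2(2) d(2)[OF ab(1), of "int n"] d(2)[OF ab(2), of "- int n"] by simp
  also have "\<dots> \<le> a + b + (l2norm x * (1/8) + l2norm x * (1/8))"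
    by (intro add_mono mult_mono c off_resonant1 off_resonant2 order_refl) auto
  finally have "l2norm x \<le> a + b + (l2norm x * (1/8) + l2norm x * (1/8))" .
  then show ?thesis using ab unfolding a_def[symmetric] b_def[symmetric] by argo
qed

text \<open>The vector \<open>x\<close> is the element of the spectral pair with coordinates \<open>0\<close> at \<open>n\<close> and \<open>1\<close> at \<open>- n\<close>, so
  \<open>conv x n\<close> is the off-diagonal entry of the \<open>2\<close> by \<open>2\<close> matrix of the operator minus \<open>\<mu>\<close> in these coordinates.  It
  compares with the gap because this matrix has determinant \<open>0\<close> and trace \<open>g\<close> and its diagonal entries are complex
  conjugates of each other.\<close>

lemma gap_structure_at:
  assumes seq: "H.spectral_sequence l e" and n: "2 \<le> n"
    and k: "l2norm (kern n w) \<le> 1/2" "l2norm (kern (n - 1) w) \<le> 1/2" and cn: "l2norm (damped n w) \<le> 1/32"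
  defines "\<mu> \<equiv> l (2 * n - 1)" and "g \<equiv> l (2 * n) - l (2 * n - 1)"
  shows "window_bottom n \<le> \<mu>" "\<mu> \<le> window_top n" "0 \<le> g"
    "\<exists>x h. x \<in> h1 \<and> x (int n) = 0 \<and> x (- int n) = 1 \<and> l2 h \<and> l2norm h \<le> 2 \<and>
       (\<forall>m. row \<mu> x m = of_real g * h m) \<and>
       g \<le> 2 * cmod (conv x (int n)) \<and> cmod (conv x (int n)) \<le> 2 * g"
proof -
  have n0: "0 < n" "0 < n - 1" using n by auto
  define N where "N = int n"
  define \<nu> where "\<nu> = l (2 * n)"
  define e1 where "e1 = e (2 * n - 1)"
  define e2 where "e2 = e (2 * n)"
  note cnt = eigenvalue_count[OF seq n0(1)] eigenvalue_count[OF seq n0(2)]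
  have idx: "2 * (n - 1) + 1 = 2 * n - 1" "(real (n - 1))\<^sup>2 + real (n - 1) = (real n)\<^sup>2 - n"
    using n by (auto simp: of_nat_diff power2_eq_square algebra_simps)
  have up: "\<nu> < window_top n" using cnt(1) k by (simp add: \<nu>_def)
  have low: "window_bottom n \<le> \<mu>" using cnt(4) k by (simp only: idx \<mu>_def)
  have next_up: "window_top n \<le> l (2 * n + 1)" using cnt(2) k by simp
  have prev_low: "l (2 * n - 2) < window_bottom n"
  proof -
    have "l (2 * (n - 1)) < pi\<^sup>2 * ((real (n - 1))\<^sup>2 + real (n - 1))" using cnt(3) k by simp
    then show ?thesis unfolding idx by (simp add: right_diff_distrib')
  qed
  have le: "\<mu> \<le> \<nu>" unfolding \<mu>_def \<nu>_def by (rule H.seq_mono[OF seq]) simp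
  show "window_bottom n \<le> \<mu>" by (rule low)
  show mu_up: "\<mu> \<le> window_top n" using le up by simp
  show g0: "0 \<le> g" using le by (simp add: g_def \<mu>_def \<nu>_def)
  have nu_low: "window_bottom n \<le> \<nu>" and nu_up: "\<nu> \<le> window_top n" using le low up by auto
  have g_eq: "g = \<nu> - \<mu>" by (simp add: g_def \<mu>_def \<nu>_def)
  have only: "j = 2 * n - 1 \<or> j = 2 * n" if "l j = \<mu> \<or> l j = \<nu>" for j
  proof -
    have "\<not> j \<le> 2 * n - 2" using H.seq_mono[OF seq, of j "2 * n - 2"] that prev_low low nu_low by auto
    moreover have "\<not> 2 * n + 1 \<le> j" using H.seq_mono[OF seq, of "2 * n + 1" j] that next_up up le by auto
    ultimately show ?thesis by linarith
  qed
  have e_mem: "e1 \<in> h1" "e2 \<in> h1" using H.seq_mem[OF seq] by (auto simp: e1_def e2_def)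
  have "2 * n \<noteq> 2 * n - 1" using n by simp
  then have ips: "seq_inner e1 e1 = 1" "seq_inner e2 e2 = 1" "seq_inner e1 e2 = 0" "seq_inner e2 e1 = 0"
    using H.seq_orth[OF seq] by (auto simp: e1_def e2_def)
  have nrm: "l2norm e1 = 1" "l2norm e2 = 1"
    using ips(1,2) unfolding seq_inner_self by (metis l2norm_nonneg of_real_eq_1_iff power2_eq_1_iff abs_of_nonneg abs_minus_cancel abs_one)+
  have pair1: "H.eigenpair e1 \<mu>" and pair2: "H.eigenpair e2 \<nu>"
    using seq by (auto simp: H.spectral_sequence_def e1_def e2_def \<mu>_def \<nu>_def)
  note row1 = eigenpair_row[OF pair1] and row2 = eigenpair_row[OF pair2]
  have comp_le: "cmod (e1 m) \<le> 1" "cmod (e2 m) \<le> 1" for m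
    using norm_le_l2norm[OF h1_l2[OF e_mem(1)], of m] norm_le_l2norm[OF h1_l2[OF e_mem(2)], of m] nrm by auto
  have z2: "l2 (\<lambda>_::int. 0::complex)" by (simp add: l2_def)
  have off_resonant_small: "l2norm (off_resonant n y) \<le> 1/8" if "y \<in> h1" "\<And>m. cmod (y m) \<le> 1" "\<And>m. row \<theta> y m = 0"
     "window_bottom n \<le> \<theta>" "\<theta> \<le> window_top n" for y \<theta>
  proof -
    have "l2norm (off_resonant n y) \<le> 2 * (cmod (y (int n)) + cmod (y (- int n))) * l2norm (damped n w) + 2 * 0 * l2norm (\<lambda>_::int. 0::complex) / n"
      by (rule off_resonant_norm[OF that(1) n k(1) that(4,5) _ order_refl z2]) (use that(3) in auto)
    moreover have "2 * (cmod (y (int n)) + cmod (y (- int n))) * l2norm (damped n w) \<le> 2 * (1 + 1) * (1/32)"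
      by (intro mult_mono add_mono that(2) cn order_refl) auto
    ultimately show ?thesis by simp
  qed
  note off_resonant1 = off_resonant_small[OF e_mem(1) comp_le(1) row1 low mu_up]
  note off_resonant2 = off_resonant_small[OF e_mem(2) comp_le(2) row2 nu_low nu_up]
  define E where "E c1 c2 = (\<lambda>m. c1 * e1 m + c2 * e2 m)" for c1 c2
  have E_mem: "E c1 c2 \<in> h1" for c1 c2 unfolding E_def by (intro h1_add h1_scale e_mem)
  have coef: "seq_inner (E c1 c2) e1 = c1" "seq_inner (E c1 c2) e2 = c2" for c1 c2
    unfolding E_def using e_mem ips by (simp_all add: seq_inner.add_left seq_inner.scale_left h1_scale)
  have coef_le: "cmod c1 \<le> l2norm (E c1 c2)" "cmod c2 \<le> l2norm (E c1 c2)" for c1 c2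
    using seq_inner_bound[OF h1_l2[OF E_mem[of c1 c2]] h1_l2[OF e_mem(1)]] seq_inner_bound[OF h1_l2[OF E_mem[of c1 c2]] h1_l2[OF e_mem(2)]]
    by (simp_all add: coef nrm)
  have E_norm: "l2norm (E c1 c2) \<le> 2 * (cmod (E c1 c2 N) + cmod (E c1 c2 (- N)))" for c1 c2
    unfolding N_def
    by (rule pair_norm_le[OF h1_l2[OF e_mem(1)] nrm(1) h1_l2[OF e_mem(2)] nrm(2) cmod_le_off_resonant l2_off_resonant[OF e_mem(1) n0(1)] off_resonant1
        cmod_le_off_resonant l2_off_resonant[OF e_mem(2) n0(1)] off_resonant2 E_def coef_le off_resonant_nonneg off_resonant_nonneg])
  \<comment> \<open>The coordinates at \<open>\<plusminus> n\<close> determine an element of the spectral pair.\<close>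
  have E_inj: "c1 = 0 \<and> c2 = 0" if "E c1 c2 N = 0" "E c1 c2 (- N) = 0" for c1 c2
  proof -
    have "l2norm (E c1 c2) \<le> 0" using E_norm[of c1 c2] that by simp
    then have "cmod c1 \<le> 0" "cmod c2 \<le> 0" using coef_le(1)[of c1 c2] coef_le(2)[of c2 c1] by linarith+
    then show ?thesis by simp
  qed
  define \<Delta> where "\<Delta> = e1 (-N) * e2 N - e1 N * e2 (-N)"
  have \<Delta>: "\<Delta> \<noteq> 0"
  proof
    assume 0: "\<Delta> = 0"
    have "e2 N = 0 \<and> e1 N = 0" using E_inj[of "e2 N" "- e1 N"] 0 by (simp add: E_def \<Delta>_def algebra_simps)
    moreover have "e2 (-N) = 0 \<and> e1 (-N) = 0" using E_inj[of "e2 (-N)" "- e1 (-N)"] 0 by (simp add: E_def \<Delta>_def algebra_simps)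
    ultimately show False using E_inj[of 1 0] by (simp add: E_def)
  qed
  \<comment> \<open>Cramer's rule for the basis dual to the two coordinates; \<open>x2\<close> is the vector of the conclusion.\<close>
  define x2 where "x2 = E (e2 N / \<Delta>) (- e1 N / \<Delta>)"
  have x2_mem: "x2 \<in> h1" unfolding x2_def by (rule E_mem)
  define x1 where "x1 = E (- e2 (-N) / \<Delta>) (e1 (-N) / \<Delta>)"
  have x2: "x2 N = 0" "x2 (-N) = 1" "x1 N = 1" "x1 (-N) = 0"
    using \<Delta> by (auto simp: x1_def x2_def E_def \<Delta>_def divide_simps)
  have star_E: "\<exists>c1 c2. star (E d1 d2) = E c1 c2" for d1 d2
  proof -
    have in_span: "\<exists>c1 c2. y = E c1 c2" if "H.eigenpair y \<theta>" "\<theta> = \<mu> \<or> \<theta> = \<nu>" for y \<theta>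
    proof -
      have lt: "\<theta> < l (2 * n + 1)" using that(2) next_up up le by auto
      note ex = H.eigenpair_expansion[OF seq that(1) lt]
      have sub: "{j. l j = \<theta>} \<subseteq> {2 * n - 1, 2 * n}" using only that(2) by auto
      have "y = (\<lambda>m. \<Sum>j\<in>{2 * n - 1, 2 * n}. (if l j = \<theta> then seq_inner y (e j) else 0) * e j m)"
        by (subst ex(2)) (intro ext sum.mono_neutral_cong_left, use sub in auto)
      also have "\<dots> = E (if l (2*n-1) = \<theta> then seq_inner y e1 else 0) (if l (2*n) = \<theta> then seq_inner y e2 else 0)"
        using \<open>2 * n \<noteq> 2 * n - 1\<close> by (auto simp: E_def e1_def e2_def)
      finally show ?thesis by blast
    qed
    obtain a1 a2 where a: "star e1 = E a1 a2" using in_span[OF eigenpair_star[OF pair1]] by auto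
    obtain b1 b2 where b: "star e2 = E b1 b2" using in_span[OF eigenpair_star[OF pair2]] by auto
    have "star (E d1 d2) m = cnj d1 * star e1 m + cnj d2 * star e2 m" for m by (simp add: star_def E_def)
    then have "star (E d1 d2) = E (cnj d1 * a1 + cnj d2 * b1) (cnj d1 * a2 + cnj d2 * b2)"
      unfolding a b by (simp add: E_def fun_eq_iff algebra_simps)
    then show ?thesis by blast
  qed
  \<comment> \<open>Conjugation exchanges the coordinates at \<open>n\<close> and \<open>- n\<close>, and the spectral pair is invariant under it.\<close>
  have x1_star: "x1 = star x2"
  proof -
    obtain c1 c2 where c: "star x2 = E c1 c2" using star_E unfolding x2_def by blast
    have "E (c1 - - e2 (-N) / \<Delta>) (c2 - e1 (-N) / \<Delta>) m = star x2 m - x1 m" for m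
      unfolding c x1_def by (simp add: E_def algebra_simps)
    then have "c1 - - e2 (-N) / \<Delta> = 0 \<and> c2 - e1 (-N) / \<Delta> = 0"
      using x2 by (intro E_inj) (simp_all add: star_def)
    then show ?thesis unfolding c x1_def by (simp only: right_minus_eq)
  qed
  \<comment> \<open>The operator minus \<open>\<mu>\<close> annihilates \<open>e1\<close> and multiplies \<open>e2\<close> by the gap.\<close>
  have E_row: "row \<mu> (E c1 c2) m = of_real g * (c2 * e2 m)" for c1 c2 m
  proof -
    have "conv (E c1 c2) m = c1 * conv e1 m + c2 * conv e2 m" unfolding E_def by (rule conv_combination[OF e_mem])
    moreover have "conv e1 m = - ((of_real (pi\<^sup>2 * (of_int m)\<^sup>2) - of_real \<mu>) * e1 m)"
      using row1[of m] by (simp only: eq_neg_iff_add_eq_0 add.commute)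
    moreover have "conv e2 m = - ((of_real (pi\<^sup>2 * (of_int m)\<^sup>2) - of_real \<nu>) * e2 m)"
      using row2[of m] by (simp only: eq_neg_iff_add_eq_0 add.commute)
    ultimately show ?thesis by (simp add: E_def g_eq algebra_simps)
  qed
  define b where "b = conv x2 N"
  define \<alpha> where "\<alpha> = (of_real (pi\<^sup>2 * (real n)\<^sup>2) - of_real \<mu>) + conv x1 N"
  have b1: "b = of_real g * (- e1 N / \<Delta> * e2 N)"
    using E_row[of N "e2 N / \<Delta>" "- e1 N / \<Delta>"] x2 unfolding x2_def[symmetric] by (simp add: b_def)
  have a1: "\<alpha> = of_real g * (e1 (-N) / \<Delta> * e2 N)"
    using E_row[of N "- e2 (-N) / \<Delta>" "e1 (-N) / \<Delta>"] x2 unfolding x1_def[symmetric] by (simp add: \<alpha>_def N_def)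
  have b2: "cnj b = of_real g * (e1 (-N) / \<Delta> * e2 (-N))"
  proof -
    have "conv x1 (-N) = cnj b" unfolding x1_star conv_star b_def by simp
    then show ?thesis using E_row[of "-N" "- e2 (-N) / \<Delta>" "e1 (-N) / \<Delta>"] x2 unfolding x1_def[symmetric] by simp
  qed
  have a2: "cnj \<alpha> = of_real g * (- e1 N / \<Delta> * e2 (-N))"
  proof -
    have "conv x2 (-N) = cnj (conv x1 N)" unfolding x1_star conv_star by simp
    then show ?thesis using E_row[of "-N" "e2 N / \<Delta>" "- e1 N / \<Delta>"] x2 unfolding x2_def[symmetric] 
      by (simp add: \<alpha>_def N_def)
  qed
  \<comment> \<open>The trace is the sum of the eigenvalues \<open>0\<close> and \<open>g\<close>.\<close>
  have tr: "\<alpha> + cnj \<alpha> = of_real g"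
  proof -
    have "\<alpha> + cnj \<alpha> = of_real g * ((e1 (-N) * e2 N - e1 N * e2 (-N)) / \<Delta>)"
      unfolding a2 unfolding a1 by (simp add: algebra_simps diff_divide_distrib)
    then show ?thesis using \<Delta> by (simp add: \<Delta>_def[symmetric])
  qed
  \<comment> \<open>The determinant vanishes.\<close>
  have "\<alpha> * cnj \<alpha> = b * cnj b" unfolding a2 b2 unfolding a1 b1 by (simp add: algebra_simps)
  then have "complex_of_real ((cmod \<alpha>)\<^sup>2) = of_real ((cmod b)\<^sup>2)" unfolding complex_norm_square .
  then have ab: "cmod \<alpha> = cmod b" by (simp only: of_real_eq_iff power2_eq_iff_nonneg[OF norm_ge_zero norm_ge_zero])
  have "g = 2 * Re \<alpha>" using tr by (simp add: complex_eq_iff)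
  then have gb: "g \<le> 2 * cmod b" using complex_Re_le_cmod[of \<alpha>] ab by simp
  have x2_norm: "l2norm x2 \<le> 2" using E_norm[of "e2 N / \<Delta>" "- e1 N / \<Delta>"] x2 unfolding x2_def[symmetric] by simp
  define h where "h = (\<lambda>m. - e1 N / \<Delta> * e2 m)"
  have cle: "cmod (- e1 N / \<Delta>) \<le> 2" using coef_le(2)[of "- e1 N / \<Delta>" "e2 N / \<Delta>"] x2_norm unfolding x2_def[symmetric] by simp
  have h: "l2 h" "l2norm h \<le> 2"
    unfolding h_def using l2_scale[OF h1_l2[OF e_mem(2)], of "- e1 N / \<Delta>"] nrm cle by auto
  have bg: "cmod b \<le> 2 * g"
  proof -
    have "cmod b = g * (cmod (- e1 N / \<Delta>) * cmod (e2 N))" unfolding b1 using g0 by (simp add: norm_mult norm_divide)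
    also have "\<dots> \<le> g * (2 * 1)" by (intro mult_left_mono mult_mono cle comp_le g0) auto
    finally show ?thesis by simp
  qed
  have "\<forall>m. row \<mu> x2 m = of_real g * h m"
    unfolding x2_def h_def using E_row by blast
  then show "\<exists>x h. x \<in> h1 \<and> x (int n) = 0 \<and> x (- int n) = 1 \<and> l2 h \<and> l2norm h \<le> 2 \<and>
       (\<forall>m. row \<mu> x m = of_real g * h m) \<and>
       g \<le> 2 * cmod (conv x (int n)) \<and> cmod (conv x (int n)) \<le> 2 * g"
    using x2_mem x2 h gb bg unfolding b_def N_def by blast
qed

end

section \<open>Weighted estimates for the gap lengths\<close>

text \<open>The last clause says that \<open>\<rho> j / j\<close> does not increase for \<open>j \<ge> 1\<close>; it stands in for concavity and makes
  \<open>\<rho>\<close> subadditive.  Boundedness ensures that every weighted norm below is finite, so that terms can be absorbed.\<close>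

definition weight :: "(int \<Rightarrow> real) \<Rightarrow> bool" where
  "weight \<rho> \<longleftrightarrow> (\<exists>B. \<forall>j. \<rho> j \<le> B) \<and> (\<forall>j. 0 \<le> \<rho> j) \<and> (\<forall>i j. \<bar>i\<bar> \<le> \<bar>j\<bar> \<longrightarrow> \<rho> i \<le> \<rho> j) \<and>
     (\<forall>i j. 1 \<le> i \<longrightarrow> i \<le> j \<longrightarrow> of_int i * \<rho> j \<le> of_int j * \<rho> i)"

lemma weight_nonneg: "weight \<rho> \<Longrightarrow> 0 \<le> \<rho> j" by (simp add: weight_def)
lemma weight_mono: "weight \<rho> \<Longrightarrow> \<bar>i\<bar> \<le> \<bar>j\<bar> \<Longrightarrow> \<rho> i \<le> \<rho> j" unfolding weight_def by blast
lemma weight_scale: "weight \<rho> \<Longrightarrow> 1 \<le> i \<Longrightarrow> i \<le> j \<Longrightarrow> of_int i * \<rho> j \<le> of_int j * \<rho> i" unfolding weight_def by blast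

lemma weight_add:
  assumes "weight \<rho>" shows "\<rho> (a + b) \<le> \<rho> a + \<rho> b"
proof -
  consider "a = 0" | "b = 0" | "a \<noteq> 0" "b \<noteq> 0" by blast
  then show ?thesis
  proof cases
    case 3
    define s where "s = \<bar>a\<bar> + \<bar>b\<bar>"
    have s: "0 < real_of_int s" using 3 by (simp add: s_def)
    have 1: "of_int \<bar>a\<bar> * \<rho> s \<le> of_int s * \<rho> \<bar>a\<bar>" by (rule weight_scale[OF assms]) (use 3 in \<open>auto simp: s_def\<close>)
    have 2: "of_int \<bar>b\<bar> * \<rho> s \<le> of_int s * \<rho> \<bar>b\<bar>" by (rule weight_scale[OF assms]) (use 3 in \<open>auto simp: s_def\<close>)
    have 3: "\<rho> \<bar>a\<bar> \<le> \<rho> a" "\<rho> \<bar>b\<bar> \<le> \<rho> b" "\<rho> (a + b) \<le> \<rho> s"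
      by (rule weight_mono[OF assms], simp add: s_def)+
    have "of_int s * \<rho> s = of_int \<bar>a\<bar> * \<rho> s + of_int \<bar>b\<bar> * \<rho> s" by (simp add: s_def algebra_simps)
    also have "\<dots> \<le> of_int s * (\<rho> \<bar>a\<bar> + \<rho> \<bar>b\<bar>)" using 1 2 by (simp add: algebra_simps)
    finally have "\<rho> s \<le> \<rho> \<bar>a\<bar> + \<rho> \<bar>b\<bar>" using s by simp
    then show ?thesis using 3 by linarith
  qed (use weight_nonneg[OF assms] in auto)
qed

lemma weight_div:
  assumes "weight \<rho>" "0 < n" shows "\<rho> (m + int n) / ressum n m \<le> \<rho> (int n) / n"
proof -
  have "\<rho> (m + int n) \<le> \<rho> (\<bar>m\<bar> + int n)" by (rule weight_mono[OF assms(1)]) simp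
  moreover have "of_int (int n) * \<rho> (\<bar>m\<bar> + int n) \<le> of_int (\<bar>m\<bar> + int n) * \<rho> (int n)"
    by (rule weight_scale[OF assms(1)]) (use assms(2) in auto)
  ultimately have "real n * \<rho> (m + int n) \<le> ressum n m * \<rho> (int n)"
    using mult_left_mono[of "\<rho> (m + int n)" "\<rho> (\<bar>m\<bar> + int n)" "real n"] by (simp add: ressum_def)
  then show ?thesis using assms(2) ressum_pos[OF assms(2), of m] by (simp add: field_simps)
qed

lemma l2_weight:
  assumes "weight \<rho>" "l2 f" shows "l2 (\<lambda>j. \<rho> j * f j)"
proof -
  obtain B where B: "\<And>j. \<rho> j \<le> B" using assms(1) by (auto simp: weight_def)
  show ?thesis
  proof (rule l2_mono(1)[OF l2_scale(1)[OF assms(2), of B]])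
    show "norm (\<rho> j * f j) \<le> norm (B * f j)" for j
      using B[of j] weight_nonneg[OF assms(1), of j] by (simp add: abs_mult mult_right_mono)
  qed
qed

lemma real_sum_CS:
  fixes f g :: "'i \<Rightarrow> real"
  assumes "l2 f" "l2 g" "\<And>i. 0 \<le> f i" "\<And>i. 0 \<le> g i"
  shows "(\<lambda>i. f i * g i) summable_on UNIV" "(\<Sum>\<^sub>\<infinity>i. f i * g i) \<le> l2norm f * l2norm g"
  using l2_CS[OF assms(1,2)] assms(3,4) by simp_all

lemma inv_bracket_norm_ge: "1 \<le> inv_bracket_norm"
  using norm_le_l2norm[OF l2_inv_bracket, of 0] by (simp add: inv_bracket_norm_def bracket_def)

context singular_potential
begin

definition weighted_norm :: "(int \<Rightarrow> real) \<Rightarrow> real" where "weighted_norm \<rho> = l2norm (\<lambda>j. \<rho> j * w j)"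

text \<open>Up to the substitution \<open>j = n - k\<close>, this is the norm of \<open>\<rho> w\<close> localised by \<open>1 / bracket (2 n - j)\<close> near the
  frequency \<open>2 n\<close>.\<close>

definition local_mass :: "(int \<Rightarrow> real) \<Rightarrow> nat \<Rightarrow> real" where
  "local_mass \<rho> n = l2norm (\<lambda>k. \<rho> (int n - k) * w (int n - k) / bracket (int n + k))"

lemma local_mass_l2:
  assumes "weight \<rho>" shows "l2 (\<lambda>k. \<rho> (int n - k) * w (int n - k) / bracket (int n + k))"
proof -
  have s: "l2 (\<lambda>k. \<rho> (int n - k) * w (int n - k))"
    using l2_bij(1)[OF bij_add_int(3), of "\<lambda>j. \<rho> j * w j" "int n"] l2_weight[OF assms l2_w] by simp
  show ?thesis
  proof (rule l2_mono(1)[OF s])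
    show "norm (\<rho> (int n - k) * w (int n - k) / bracket (int n + k)) \<le> norm (\<rho> (int n - k) * w (int n - k))" for k
      using divide_left_mono[of 1 "bracket (int n + k)" "\<rho> (int n - k) * w (int n - k)"] weight_nonneg[OF assms]
      by (simp add: abs_mult)
  qed
qed

text \<open>Summation over \<open>n\<close> of the squares of the localising factors costs only a constant.\<close>

lemma sum_local_mass:
  assumes "weight \<rho>" "finite S" shows "(\<Sum>n\<in>S. (local_mass \<rho> n)\<^sup>2) \<le> (weighted_norm \<rho> * inv_bracket_norm)\<^sup>2"
proof -
  note t = l2_tensor[OF l2_weight[OF assms(1) l2_w] l2_inv_bracket]
  have bij: "bij (\<lambda>(N::int,j). (j, N - j))"
    by (rule o_bij[where g="\<lambda>(j,i). (i + j, j)"]) (auto simp: fun_eq_iff)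
  define K where "K = (\<lambda>(N::int,j). \<rho> j * w j * (1 / bracket (N - j)))"
  have K: "l2 K" "l2norm K = weighted_norm \<rho> * inv_bracket_norm"
    using l2_bij[OF bij, of "\<lambda>(j,i). \<rho> j * w j * (1 / bracket i)"] t
    by (auto simp: K_def case_prod_unfold weighted_norm_def inv_bracket_norm_def)
  note R = l2_rows[OF K(1)]
  have local_mass_eq: "local_mass \<rho> n = l2norm (\<lambda>j. K (2 * int n, j))" for n
    using l2_bij(2)[OF bij_add_int(3), of "\<lambda>j. K (2 * int n, j)" "int n"]
    by (simp add: local_mass_def K_def algebra_simps)
  have "(\<Sum>n\<in>S. (local_mass \<rho> n)\<^sup>2) = (\<Sum>N\<in>(\<lambda>n. 2 * int n) ` S. (l2norm (\<lambda>j. K (N, j)))\<^sup>2)"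
    unfolding local_mass_eq by (subst sum.reindex) (auto simp: inj_on_def)
  also have "\<dots> \<le> (l2norm (\<lambda>N. l2norm (\<lambda>j. K (N, j))))\<^sup>2"
    using sum_le_l2norm[OF R(1), of "(\<lambda>n. 2 * int n) ` S"] assms(2) by simp
  finally show ?thesis using R(2) K(2) by simp
qed

text \<open>The part of the coupling of \<open>n\<close> and \<open>- n\<close> that passes through other modes; the direct coupling is \<open>v (2 * int n)\<close>.\<close>

definition correction :: "nat \<Rightarrow> (int \<Rightarrow> complex) \<Rightarrow> complex" where
  "correction n x = (\<Sum>\<^sub>\<infinity>k\<in>{k. \<bar>k\<bar> \<noteq> int n}. v (int n - k) * x k)"

lemma correction_bound:
  assumes x: "x \<in> h1" and n: "0 < n" and c: "0 \<le> c"
    and f: "\<And>k. c * (bracket (int n - k) * w (int n - k) / resdist n k) * off_resonant n x k \<le> f k" "f summable_on UNIV"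
  shows "c * cmod (correction n x) \<le> (\<Sum>\<^sub>\<infinity>k. f k)"
proof -
  have s: "(\<lambda>k. cmod (v (int n - k) * x k)) summable_on {k. \<bar>k\<bar> \<noteq> int n}"
    by (rule summable_on_subset_banach[OF conv_summable[OF x]]) auto
  have "c * cmod (correction n x) \<le> c * (\<Sum>\<^sub>\<infinity>k\<in>{k. \<bar>k\<bar> \<noteq> int n}. cmod (v (int n - k) * x k))"
    unfolding correction_def by (rule mult_left_mono[OF norm_infsum_bound[OF s] c])
  also have "\<dots> = (\<Sum>\<^sub>\<infinity>k\<in>{k. \<bar>k\<bar> \<noteq> int n}. c * cmod (v (int n - k) * x k))"
    by (rule infsum_cmult_right[OF s, symmetric])
  also have "\<dots> \<le> (\<Sum>\<^sub>\<infinity>k. f k)"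
  proof (rule infsum_mono_neutral[OF summable_on_cmult_right[OF s] f(2)])
    fix k assume "k \<in> {k. \<bar>k\<bar> \<noteq> int n} \<inter> UNIV"
    then have "c * cmod (v (int n - k) * x k) = c * (bracket (int n - k) * w (int n - k) / resdist n k) * off_resonant n x k"
      by (simp add: off_resonant_def norm_mult cmod_v[symmetric])
    then show "c * cmod (v (int n - k) * x k) \<le> f k" using f(1)[of k] by simp
  next
    fix k assume "k \<in> UNIV - {k. \<bar>k\<bar> \<noteq> int n}"
    then show "0 \<le> f k" using f(1)[of k] by (simp add: off_resonant_def)
  qed auto
  finally show ?thesis .
qed

text \<open>In the sum for the correction, the factor \<open>\<bar>n - k\<bar>\<close> of the potential is compensated by the distance to resonance
  unless \<open>k\<close> lies near \<open>- n\<close>.  In that range it is comparable with \<open>n\<close>.\<close>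

lemma ratio_split:
  assumes "0 < n"
  shows "(- 2 * int n \<le> k \<and> k \<le> 0 \<and> bracket (int n - k) \<le> 3 * n \<and> n \<le> bracket (int n - k) \<and> resdist n k = bracket (int n + k)) \<or>
         bracket (int n - k) \<le> 3 * resdist n k"
proof (cases "- 2 * int n \<le> k \<and> k \<le> 0")
  case True
  then show ?thesis using assms by (auto simp: bracket_def resdist_def)
next
  case False
  then consider "k > 0" | "k < - 2 * int n" by linarith
  then show ?thesis
  proof cases
    case 1
    then have "bracket (int n - k) = resdist n k" by (simp add: bracket_def resdist_def)
    then show ?thesis by simp
  next
    case 2
    then have "real_of_int k < real_of_int (- 2 * int n)" by (simp only: of_int_less_iff)
    then show ?thesis using assms by (auto simp: bracket_def resdist_def)
  qed
qed

text \<open>Without weights the correction is already of lower order than \<open>n\<close>; this gives a first bound for the gap, with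
  which the weighted estimates start.\<close>

lemma unweighted_correction_bound:
  assumes x: "x \<in> h1" and n: "0 < n"
  shows "cmod (correction n x) / n \<le> (3 * l2norm (damped n w) + 3 * l2norm w / n) * l2norm (off_resonant n x)"
proof -
  define z where "z k = 3 * damped n w (int n - k) + 3 / n * w (int n - k)" for k
  have l: "l2 (\<lambda>k. damped n w (int n - k))" "l2norm (\<lambda>k. damped n w (int n - k)) = l2norm (damped n w)" 
    "l2 (\<lambda>k. w (int n - k))" "l2norm (\<lambda>k. w (int n - k)) = l2norm w"
    using l2_bij[OF bij_add_int(3), of "damped n w" "int n"] l2_bij[OF bij_add_int(3), of w "int n"] l2_damped(1)[OF l2_w] l2_w by auto
  note s1 = l2_scale[OF l(1), of 3] and s2 = l2_scale[OF l(3), of "3/n"]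
  note a = l2_add[OF s1(1) s2(1)]
  have z: "l2 z" "l2norm z \<le> 3 * l2norm (damped n w) + 3 * l2norm w / n"
    using a s1(2) s2(2) l n by (auto simp: z_def[abs_def])
  have z0: "0 \<le> z k" for k by (simp add: z_def damped_def)
  note cs = real_sum_CS[OF z(1) l2_off_resonant[OF x n] z0 off_resonant_nonneg]
  have "1 / real n * cmod (correction n x) \<le> (\<Sum>\<^sub>\<infinity>k. z k * off_resonant n x k)"
  proof (rule correction_bound[OF x n _ _ cs(1)])
    fix k
    have "bracket (int n - k) * w (int n - k) / resdist n k \<le> n * z k" (is ?claim)
    proof (rule disjE[OF ratio_split[OF n, of k]], goal_cases)
      case 1
      then have 1: "bracket (int n - k) \<le> 3 * n" "1 \<le> bracket (int n - k) / n" using n by auto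
      have "bracket (int n - k) * w (int n - k) / resdist n k \<le> 3 * n * w (int n - k) / 1"
        using 1 by (intro frac_le mult_right_mono) auto
      also have "\<dots> = n * (3 * damped n w (int n - k))" using 1 by (simp add: damped_def)
      also have "\<dots> \<le> n * z k" by (intro mult_left_mono) (auto simp: z_def)
      finally show ?claim .
    next
      case 2
      then have "bracket (int n - k) * w (int n - k) / resdist n k \<le> 3 * resdist n k * w (int n - k) / resdist n k"
        by (intro divide_right_mono mult_right_mono) auto
      also have "\<dots> = n * (3 / n * w (int n - k))" using n by simp
      also have "\<dots> \<le> n * z k" by (intro mult_left_mono) (auto simp: z_def damped_def)
      finally show ?claim .
    qed
    then have "1 / real n * (bracket (int n - k) * w (int n - k) / resdist n k) \<le> z k" using n by (simp add: field_simps)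
    then show "1 / real n * (bracket (int n - k) * w (int n - k) / resdist n k) * off_resonant n x k \<le> z k * off_resonant n x k"
      by (intro mult_right_mono) auto
  qed simp
  also have "\<dots> \<le> (3 * l2norm (damped n w) + 3 * l2norm w / n) * l2norm (off_resonant n x)"
    by (rule order_trans[OF cs(2)]) (intro mult_right_mono z; simp)
  finally show ?thesis by simp
qed

text \<open>The equation for the off-resonant components is multiplied by \<open>\<rho> (m + int n)\<close>.  Subadditivity moves the weight
  either to the potential or to the unknown; the second term is absorbed as in \<open>off_resonant_norm\<close>.  The shift by \<open>n\<close> suits the
  normalisation of \<open>x\<close>: the only source is \<open>x (- int n) = 1\<close>, and its contribution is dominated by a translate of \<open>\<rho> w\<close>.\<close>

lemma weighted_off_resonant_bound:
  assumes x: "x \<in> h1" "x (int n) = 0" "x (- int n) = 1" and n: "2 \<le> n" and k: "l2norm (kern n w) \<le> 1/2"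
    and \<mu>: "window_bottom n \<le> \<mu>" "\<mu> \<le> window_top n"
    and eq: "\<And>m. row \<mu> x m = of_real g * h m"
    and g: "0 \<le> g" and h: "l2 h" "l2norm h \<le> 2" and \<rho>: "weight \<rho>"
  shows "l2 (\<lambda>m. \<rho> (m + int n) * off_resonant n x m)"
    "l2norm (\<lambda>m. \<rho> (m + int n) * off_resonant n x m) \<le> 2 * weighted_norm \<rho> * (1 + 3 * inv_bracket_norm * l2norm (off_resonant n x)) + 4 * (g / n) * \<rho> (int n)"
proof -
  have n0: "0 < n" using n by simp
  define t where "t = off_resonant n x"
  define r where "r m = \<rho> (m + int n) * t m" for m
  define \<omega> where "\<omega> j = \<rho> j * w j" for j
  have t: "l2 t" "\<And>m. 0 \<le> t m" using l2_off_resonant[OF x(1) n0] by (auto simp: t_def)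
  have \<rho>0: "0 \<le> \<rho> j" for j by (rule weight_nonneg[OF \<rho>])
  have \<omega>: "l2 \<omega>" "\<And>j. 0 \<le> \<omega> j" "l2norm \<omega> = weighted_norm \<rho>"
    using l2_weight[OF \<rho> l2_w] \<rho>0 by (auto simp: \<omega>_def[abs_def] weighted_norm_def)
  obtain B where B: "\<And>j. \<rho> j \<le> B" using \<rho> by (auto simp: weight_def)
  have r: "l2 r" "\<And>m. 0 \<le> r m"
  proof -
    show "l2 r" by (rule l2_mono(1)[OF l2_scale(1)[OF t(1), of B]])
      (use B \<rho>0 t(2) in \<open>auto simp: r_def abs_mult intro!: mult_right_mono order_trans[OF B abs_ge_self]\<close>)
  qed (use \<rho>0 t(2) in \<open>simp add: r_def\<close>)
  show "l2 (\<lambda>m. \<rho> (m + int n) * off_resonant n x m)" using r(1) by (simp add: r_def[abs_def] t_def)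
  have kw0: "0 \<le> kern n w p" for p by (rule kern_w_nonneg[OF n0])
  have k\<omega>0: "0 \<le> kern n \<omega> p" for p using \<omega>(2) ressum_pos[OF n0, of "fst p"] by (auto simp: kern_def case_prod_unfold)
  note Kw = l2_kern(1)[OF n0 w_nonneg l2_w]
  note K\<omega> = l2_kern[OF n0 \<omega>(2) \<omega>(1)]
  note T0 = l2_kernel(1)[OF Kw t(1)]
  note T1 = l2_kernel[OF K\<omega>(1) t(1)]
  note T2 = l2_kernel[OF Kw r(1)]
  have nn: "norm (kern n w (m,k)) * norm (t k) = kern n w (m,k) * t k"
    "norm (kern n \<omega> (m,k)) * norm (t k) = kern n \<omega> (m,k) * t k"
    "norm (kern n w (m,k)) * norm (r k) = kern n w (m,k) * r k" for m k
    using kw0 k\<omega>0 t(2) r(2) by auto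
  note T0 = T0[unfolded nn] and T1 = T1[unfolded nn] and T2 = T2[unfolded nn]
  define S where "S m = \<omega> (m + int n) + (\<Sum>\<^sub>\<infinity>k. kern n \<omega> (m,k) * t k) + (\<Sum>\<^sub>\<infinity>k. kern n w (m,k) * r k) + g * (\<rho> (int n) / n) * cmod (h m)" for m
  have rS: "r m \<le> S m" for m
  proof -
    have "t m \<le> damped n w (m + int n) + (\<Sum>\<^sub>\<infinity>k. kern n w (m,k) * t k) + g * cmod (h m) / ressum n m"
      using off_resonant_equation[OF x(1) n \<mu> eq g, of m] x(2,3) by (simp add: t_def)
    then have "r m \<le> \<rho> (m + int n) * (damped n w (m + int n) + (\<Sum>\<^sub>\<infinity>k. kern n w (m,k) * t k) + g * cmod (h m) / ressum n m)"
      unfolding r_def by (rule mult_left_mono[OF _ \<rho>0])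
    also have "\<dots> = \<rho> (m + int n) * damped n w (m + int n) + (\<Sum>\<^sub>\<infinity>k. \<rho> (m + int n) * (kern n w (m,k) * t k)) + g * (\<rho> (m + int n) / ressum n m) * cmod (h m)"
      by (subst infsum_cmult_right[OF T0]) (simp add: algebra_simps)
    also have "\<dots> \<le> \<omega> (m + int n) + (\<Sum>\<^sub>\<infinity>k. kern n \<omega> (m,k) * t k + kern n w (m,k) * r k) + g * (\<rho> (int n) / n) * cmod (h m)"
    proof (intro add_mono mult_right_mono mult_left_mono weight_div[OF \<rho> n0] g infsum_mono)
      show "\<rho> (m + int n) * damped n w (m + int n) \<le> \<omega> (m + int n)"
        unfolding \<omega>_def damped_def using \<rho>0 by (intro mult_left_mono mult_left_le) auto
      show "(\<lambda>k. \<rho> (m + int n) * (kern n w (m, k) * t k)) summable_on UNIV" by (rule summable_on_cmult_right[OF T0])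
      show "(\<lambda>k. kern n \<omega> (m,k) * t k + kern n w (m,k) * r k) summable_on UNIV" by (rule summable_on_add[OF T1(1) T2(1)])
      fix k
      have "\<rho> (m + int n) \<le> \<rho> (m - k) + \<rho> (k + int n)" using weight_add[OF \<rho>, of "m - k" "k + int n"] by simp
      then have "\<rho> (m + int n) * (kern n w (m,k) * t k) \<le> (\<rho> (m - k) + \<rho> (k + int n)) * (kern n w (m,k) * t k)"
        using kw0 t(2) by (intro mult_right_mono) auto
      also have "\<dots> = kern n \<omega> (m,k) * t k + kern n w (m,k) * r k"
        by (simp add: kern_def \<omega>_def r_def algebra_simps add_divide_distrib)
      finally show "\<rho> (m + int n) * (kern n w (m,k) * t k) \<le> kern n \<omega> (m,k) * t k + kern n w (m,k) * r k" .
    qed auto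
    also have "\<dots> = S m" unfolding S_def infsum_add[OF T1(1) T2(1)] by simp
    finally show ?thesis .
  qed
  have s1: "l2 (\<lambda>m. \<omega> (m + int n))" "l2norm (\<lambda>m. \<omega> (m + int n)) = weighted_norm \<rho>"
    using l2_bij[OF bij_add_int(1), of \<omega> "int n"] \<omega> by auto
  note s4 = l2_scale[of "\<lambda>m. cmod (h m)" "g * (\<rho> (int n) / n)", unfolded l2_norm, OF h(1)]
  note a1 = l2_add[OF s1(1) T1(2)]
  note a2 = l2_add[OF a1(1) T2(2)]
  note a3 = l2_add[OF a2(1) s4(1)]
  have "l2norm r \<le> l2norm S"
    unfolding S_def by (rule l2_mono(2)[OF a3(1)]) (use rS r(2) in \<open>simp add: S_def order_trans[OF _ abs_ge_self]\<close>)
  also have "\<dots> \<le> weighted_norm \<rho> + l2norm (kern n \<omega>) * l2norm t + l2norm (kern n w) * l2norm r + g * (\<rho> (int n) / n) * l2norm h"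
    unfolding S_def using a3(2) a2(2) a1(2) s1(2) T1(3) T2(3) s4(2) g \<rho>0 by simp
  also have "\<dots> \<le> weighted_norm \<rho> + (3 * inv_bracket_norm * weighted_norm \<rho>) * l2norm t + 1/2 * l2norm r + g * (\<rho> (int n) / n) * 2"
    using K\<omega>(3) k h(2) g \<rho>0 \<omega>(3) inv_bracket_norm_ge by (intro add_mono mult_mono mult_left_mono order_refl) (auto simp: weighted_norm_def)
  finally have 1: "l2norm r \<le> weighted_norm \<rho> + (3 * inv_bracket_norm * weighted_norm \<rho>) * l2norm t + 1/2 * l2norm r + g * (\<rho> (int n) / n) * 2" .
  have "2 * weighted_norm \<rho> * (1 + 3 * inv_bracket_norm * l2norm t) + 4 * (g / n) * \<rho> (int n) = 
     2 * weighted_norm \<rho> + 2 * ((3 * inv_bracket_norm * weighted_norm \<rho>) * l2norm t) + 2 * (g * (\<rho> (int n) / n) * 2)" by (simp add: algebra_simps)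
  then have "l2norm r \<le> 2 * weighted_norm \<rho> * (1 + 3 * inv_bracket_norm * l2norm t) + 4 * (g / n) * \<rho> (int n)" using 1 by argo
  then show "l2norm (\<lambda>m. \<rho> (m + int n) * off_resonant n x m) \<le> 2 * weighted_norm \<rho> * (1 + 3 * inv_bracket_norm * l2norm (off_resonant n x)) + 4 * (g / n) * \<rho> (int n)"
    by (simp add: r_def[abs_def] t_def)
qed

text \<open>By subadditivity \<open>\<rho> (2 n)\<close> is distributed over \<open>n - k\<close> and \<open>k + n\<close>.  The critical range of \<open>ratio_split\<close>
  produces the local mass, which is square summable in \<open>n\<close>; everything else gains a factor \<open>1 / n\<close>.\<close>

lemma weighted_correction_bound:
  assumes x: "x \<in> h1" and n: "0 < n" and \<rho>: "weight \<rho>" and r: "l2 (\<lambda>m. \<rho> (m + int n) * off_resonant n x m)"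
  shows "\<rho> (2 * int n) * cmod (correction n x) / n \<le> 6 * local_mass \<rho> n * l2norm (off_resonant n x)
     + 3 / n * (weighted_norm \<rho> * l2norm (off_resonant n x) + l2norm w * l2norm (\<lambda>m. \<rho> (m + int n) * off_resonant n x m))"
proof -
  define t where "t = off_resonant n x"
  have t: "l2 t" "\<And>m. 0 \<le> t m" using l2_off_resonant[OF x(1) n] by (auto simp: t_def)
  have \<rho>0: "0 \<le> \<rho> j" for j by (rule weight_nonneg[OF \<rho>])
  have L1: "0 \<le> \<rho> (int n - k) * w (int n - k) / bracket (int n + k)" "0 \<le> \<rho> (int n - k) * w (int n - k)" for k using \<rho>0 by simp_all
  have L2: "l2 (\<lambda>k. \<rho> (int n - k) * w (int n - k))" "l2norm (\<lambda>k. \<rho> (int n - k) * w (int n - k)) = weighted_norm \<rho>"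
    "l2 (\<lambda>k. w (int n - k))" "l2norm (\<lambda>k. w (int n - k)) = l2norm w"
    using l2_bij[OF bij_add_int(3), of "\<lambda>j. \<rho> j * w j" "int n"] l2_bij[OF bij_add_int(3), of w "int n"] l2_weight[OF \<rho> l2_w] l2_w
    by (auto simp: weighted_norm_def)
  have r0: "0 \<le> \<rho> (k + int n) * t k" for k using \<rho>0 t by simp
  note c1 = real_sum_CS[OF local_mass_l2[OF \<rho>, of n] t(1) L1(1) t(2)]
  note c2 = real_sum_CS[OF L2(1) t(1) L1(2) t(2)]
  note c3 = real_sum_CS[OF L2(3) r[folded t_def] w_nonneg r0]
  define f1 where "f1 k = \<rho> (int n - k) * w (int n - k) / bracket (int n + k) * t k" for k
  define f2 where "f2 k = \<rho> (int n - k) * w (int n - k) * t k" for k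
  define f3 where "f3 k = w (int n - k) * (\<rho> (k + int n) * t k)" for k
  have f0: "0 \<le> f1 k" "0 \<le> f2 k" "0 \<le> f3 k" for k using L1 \<rho>0 t(2) by (auto simp: f1_def f2_def f3_def)
  have s: "f1 summable_on UNIV" "f2 summable_on UNIV" "f3 summable_on UNIV"
    using c1(1) c2(1) c3(1) by (simp_all add: f1_def[abs_def] f2_def[abs_def] f3_def[abs_def])
  note s6 = summable_on_cmult_right[OF s(1), of 6]
  note s23 = summable_on_cmult_right[OF summable_on_add[OF s(2,3)], of "3/n"]
  have "\<rho> (2 * int n) / n * cmod (correction n x) \<le> (\<Sum>\<^sub>\<infinity>k. 6 * f1 k + 3 / n * (f2 k + f3 k))"
  proof (rule correction_bound[OF x n _ _ summable_on_add[OF s6 s23]])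
    fix k
    show "\<rho> (2 * int n) / n * (bracket (int n - k) * w (int n - k) / resdist n k) * off_resonant n x k \<le> 6 * f1 k + 3 / n * (f2 k + f3 k)"
(is ?claim)
    proof (rule disjE[OF ratio_split[OF n, of k]], goal_cases)
      case a: 1
      have "\<rho> (2 * int n) \<le> \<rho> (int n) + \<rho> (int n)" using weight_add[OF \<rho>, of "int n" "int n"] by simp
      moreover have "\<rho> (int n) \<le> \<rho> (int n - k)" by (rule weight_mono[OF \<rho>]) (use a in auto)
      ultimately have \<rho>2: "\<rho> (2 * int n) \<le> 2 * \<rho> (int n - k)" by linarith
      have "\<rho> (2 * int n) / n * (bracket (int n - k) * w (int n - k) / resdist n k) \<le> 2 * \<rho> (int n - k) / n * (3 * n * w (int n - k) / resdist n k)"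
        using a \<rho>2 \<rho>0 n by (intro mult_mono divide_right_mono mult_right_mono) auto
      also have "\<dots> = 6 * (\<rho> (int n - k) * w (int n - k) / bracket (int n + k))" using a n by simp
      finally have "\<rho> (2 * int n) / n * (bracket (int n - k) * w (int n - k) / resdist n k) * t k \<le> 6 * (\<rho> (int n - k) * w (int n - k) / bracket (int n + k)) * t k"
        by (rule mult_right_mono[OF _ t(2)])
      also have "\<dots> = 6 * f1 k" by (simp add: f1_def)
      also have "\<dots> \<le> 6 * f1 k + 3 / n * (f2 k + f3 k)" using f0[of k] by simp
      finally show ?claim by (simp add: t_def)
    next
      case a: 2
      have \<rho>2: "\<rho> (2 * int n) \<le> \<rho> (int n - k) + \<rho> (k + int n)" using weight_add[OF \<rho>, of "int n - k" "k + int n"] by simp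
      have "bracket (int n - k) * w (int n - k) / resdist n k \<le> 3 * resdist n k * w (int n - k) / resdist n k"
        using a by (intro divide_right_mono mult_right_mono) auto
      then have "bracket (int n - k) * w (int n - k) / resdist n k \<le> 3 * w (int n - k)" by simp
      then have "\<rho> (2 * int n) / n * (bracket (int n - k) * w (int n - k) / resdist n k) \<le> (\<rho> (int n - k) + \<rho> (k + int n)) / n * (3 * w (int n - k))"
        using \<rho>2 \<rho>0 n by (intro mult_mono divide_right_mono) auto
      then have "\<rho> (2 * int n) / n * (bracket (int n - k) * w (int n - k) / resdist n k) * t k \<le> (\<rho> (int n - k) + \<rho> (k + int n)) / n * (3 * w (int n - k)) * t k"
        by (rule mult_right_mono[OF _ t(2)])
      also have "\<dots> = 3 / n * (f2 k + f3 k)" by (simp add: f2_def f3_def field_simps)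
      also have "\<dots> \<le> 6 * f1 k + 3 / n * (f2 k + f3 k)" using f0[of k] by simp
      finally show ?claim by (simp add: t_def)
    qed
  qed (use \<rho>0 in simp)
  also have "\<dots> = 6 * (\<Sum>\<^sub>\<infinity>k. f1 k) + 3 / n * ((\<Sum>\<^sub>\<infinity>k. f2 k) + (\<Sum>\<^sub>\<infinity>k. f3 k))"
    unfolding infsum_add[OF s6 s23] infsum_cmult_right[OF s(1)] infsum_cmult_right[OF summable_on_add[OF s(2,3)]]
      infsum_add[OF s(2,3)] ..
  also have "\<dots> \<le> 6 * (local_mass \<rho> n * l2norm t) + 3 / n * (weighted_norm \<rho> * l2norm t + l2norm w * l2norm (\<lambda>m. \<rho> (m + int n) * t m))"
    using c1(2) c2(2) c3(2) L2 unfolding f1_def f2_def f3_def local_mass_def[symmetric]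
    by (intro add_mono mult_left_mono) auto
  finally show ?thesis by (simp add: t_def mult.assoc)
qed

end

section \<open>Truncated power weights and the characterization of the weighted spaces\<close>

definition truncated_power :: "real \<Rightarrow> real \<Rightarrow> int \<Rightarrow> real" where
  "truncated_power s M j = min (bracket j) M powr s"

lemma weight_truncated_power:
  assumes s: "0 \<le> s" "s \<le> 1" and M: "1 \<le> M" shows "weight (truncated_power s M)"
  unfolding weight_def
proof (intro conjI allI impI)
  have pos: "0 < min (bracket j) M" for j using M by simp
  show "\<exists>B. \<forall>j. truncated_power s M j \<le> B"
    by (intro exI[of _ "M powr s"] allI) (unfold truncated_power_def, intro powr_mono2, use s pos less_imp_le in auto)
  show "0 \<le> truncated_power s M j" for j by (simp add: truncated_power_def)
  show "truncated_power s M i \<le> truncated_power s M j" if "\<bar>i\<bar> \<le> \<bar>j\<bar>" for i j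
  proof -
    have "bracket i \<le> bracket j" using that unfolding bracket_def by (metis max.mono of_int_abs of_int_le_iff order_refl)
    then show ?thesis unfolding truncated_power_def using s pos[of i] by (intro powr_mono2) auto
  qed
  fix i j :: int assume ij: "1 \<le> i" "i \<le> j"
  then have r: "1 \<le> real_of_int i" "real_of_int i \<le> real_of_int j" by simp_all
  have bracket: "bracket i = real_of_int i" "bracket j = real_of_int j" using ij by (auto simp: bracket_def)
  \<comment> \<open>The function \<open>p powr s / p\<close> is nonincreasing because \<open>s \<le> 1\<close>.\<close>
  have key: "p * q powr s \<le> q * p powr s" if "0 < p" "p \<le> q" for p q :: real
  proof -
    have "(q / p) powr s \<le> (q / p) powr 1" using s that by (intro powr_mono) auto
    then have "q powr s / p powr s \<le> q / p" using that by (simp add: powr_divide)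
    then show ?thesis using that by (simp add: divide_simps mult.commute split: if_splits)
  qed
  show "of_int i * truncated_power s M j \<le> of_int j * truncated_power s M i"
  proof (cases "real_of_int i \<le> M")
    case True
    have "of_int i * truncated_power s M j \<le> of_int i * of_int j powr s"
      unfolding truncated_power_def bracket using s r M by (intro mult_left_mono powr_mono2) auto
    also have "\<dots> \<le> of_int j * of_int i powr s" by (rule key) (use r in auto)
    finally show ?thesis using True by (simp add: truncated_power_def bracket min_def)
  next
    case False
    then show ?thesis using r by (simp add: truncated_power_def bracket min_def mult_right_mono)
  qed
qed

lemma truncated_power_le: "0 \<le> s \<Longrightarrow> 1 \<le> M \<Longrightarrow> truncated_power s M j \<le> bracket j powr s"
  unfolding truncated_power_def by (intro powr_mono2) auto

lemma truncated_power_eq: "bracket j \<le> M \<Longrightarrow> truncated_power s M j = bracket j powr s"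
  by (simp add: truncated_power_def min_def)

context singular_potential
begin

definition scaled_gap :: "(nat \<Rightarrow> real) \<Rightarrow> nat \<Rightarrow> real" where
  "scaled_gap l n = (l (2 * n) - l (2 * n - 1)) / n"

lemma w_le_damped: 
  assumes "0 < n" shows "w (2 * int n) \<le> l2norm (damped n w)"
proof -
  have "damped n w (2 * int n) = w (2 * int n)" using assms by (simp add: damped_def bracket_def)
  then show ?thesis using norm_le_l2norm[OF l2_damped(1)[OF l2_w], of n "2 * int n"] by simp
qed

lemma w_minus: "w (- j) = w j" by (simp add: w_def v_minus)

text \<open>The constants of \<open>gap_expansion_at\<close>.  The off-resonant norm is at most \<open>38\<close> times \<open>l2norm (damped n w)\<close>, and
  \<open>114 = 3 * 38\<close>, \<open>228 = 6 * 38\<close>.\<close>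

definition C1 :: real where "C1 = 114 + 6 * l2norm w * (1 + 114 * inv_bracket_norm)"
definition C2 :: real where "C2 = 12 * l2norm w"

abbreviation remainder_bound :: "(int \<Rightarrow> real) \<Rightarrow> nat \<Rightarrow> real \<Rightarrow> real" where
  "remainder_bound \<rho> n g \<equiv> 228 * l2norm (damped n w) * local_mass \<rho> n + C1 / n * weighted_norm \<rho> + C2 / n * (\<rho> (2 * int n) * g)"

text \<open>The unweighted bound makes the gap and the off-resonant norm at most a multiple of \<open>l2norm (damped n w)\<close>; with
  this information the weighted bounds apply.  The correction does not depend on the weight.\<close>

lemma gap_expansion_at:
  assumes seq: "H.spectral_sequence l e" and n: "2 \<le> n"
    and k: "l2norm (kern n w) \<le> 1/2" "l2norm (kern (n - 1) w) \<le> 1/2" and cn: "l2norm (damped n w) \<le> 1/64" and large: "3 * l2norm w / n \<le> 1/64"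
  shows "\<exists>\<beta>. n * scaled_gap l n \<le> 2 * cmod (v (2 * int n) + \<beta>) \<and> cmod (v (2 * int n) + \<beta>) \<le> 2 * (n * scaled_gap l n) \<and> 0 \<le> scaled_gap l n \<and>
     (\<forall>\<rho>. weight \<rho> \<longrightarrow> \<rho> (2 * int n) * cmod \<beta> / n \<le> remainder_bound \<rho> n (scaled_gap l n))"
proof -
  define c where "c = l2norm (damped n w)"
  define g where "g = l (2 * n) - l (2 * n - 1)"
  define G where "G = scaled_gap l n"
  have n0: "0 < n" using n by simp
  have gG: "g = n * G" using n by (simp add: G_def scaled_gap_def g_def)
  have cn': "l2norm (damped n w) \<le> 1/32" using cn by simp
  note st = gap_structure_at[OF seq n k cn']
  obtain x h where x: "x \<in> h1" "x (int n) = 0" "x (- int n) = 1" and h: "l2 h" "l2norm h \<le> 2"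
    and eq: "\<And>m. row (l (2 * n - 1)) x m = of_real g * h m"
    and b: "g \<le> 2 * cmod (conv x (int n))" "cmod (conv x (int n)) \<le> 2 * g"
    using st(4) unfolding g_def by blast
  have g0: "0 \<le> g" using st(3) by (simp add: g_def)
  have G0: "0 \<le> G" using g0 gG n by (simp add: zero_le_mult_iff)
  have c0: "0 \<le> c" "c \<le> 1" using cn by (auto simp: c_def)
  define \<beta> where "\<beta> = correction n x"
  define t where "t = l2norm (off_resonant n x)"
  have conv: "conv x (int n) = v (2 * int n) + \<beta>"
    unfolding conv_split[OF x(1) n0] correction_def \<beta>_def x by simp
  have "t \<le> 2 * (cmod (x (int n)) + cmod (x (- int n))) * l2norm (damped n w) + 2 * g * l2norm h / n"
    unfolding t_def by (rule off_resonant_norm[OF x(1) n k(1) st(1,2) eq g0 h(1)])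
  also have "\<dots> \<le> 2 * c + 2 * g * 2 / n"
    unfolding x c_def using h(2) g0 n0 by (intro add_mono divide_right_mono mult_left_mono) auto
  also have "\<dots> = 2 * c + 4 * G" using n0 by (simp add: gG)
  finally have t1: "t \<le> 2 * c + 4 * G" .
  have "cmod \<beta> / n \<le> (3 * l2norm (damped n w) + 3 * l2norm w / n) * t"
    unfolding \<beta>_def t_def by (rule unweighted_correction_bound[OF x(1) n0])
  also have "\<dots> \<le> 1/16 * t" using cn large by (intro mult_right_mono) (auto simp: t_def)
  finally have \<beta>1: "cmod \<beta> / n \<le> 1/16 * t" .
  have "g \<le> 2 * (cmod (v (2 * int n)) + cmod \<beta>)"
    using b(1) norm_triangle_ineq[of "v (2 * int n)" \<beta>] unfolding conv by argo
  also have "cmod (v (2 * int n)) = 2 * n * w (2 * int n)" using n0 by (simp add: cmod_v bracket_def)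
  finally have "n * G \<le> n * (4 * w (2 * int n) + 2 * (cmod \<beta> / n))" using n0 by (simp add: gG algebra_simps)
  then have "G \<le> 4 * w (2 * int n) + 2 * (cmod \<beta> / n)" using n0 by simp
  also have "\<dots> \<le> 4 * c + 2 * (1/16 * (2 * c + 4 * G))"
    using w_le_damped[OF n0] \<beta>1 t1 unfolding c_def[symmetric] by argo
  finally have "G \<le> 4 * c + 2 * (1/16 * (2 * c + 4 * G))" .
  then have Gc: "G \<le> 9 * c" using c0 by argo
  have tc: "t \<le> 38 * c" using t1 Gc by linarith
  have main: "\<rho> (2 * int n) * cmod \<beta> / n \<le> 228 * c * local_mass \<rho> n + C1 / n * weighted_norm \<rho> + C2 / n * (\<rho> (2 * int n) * G)" if \<rho>: "weight \<rho>" for \<rho>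
  proof -
    define R where "R = l2norm (\<lambda>m. \<rho> (m + int n) * off_resonant n x m)"
    note wo = weighted_off_resonant_bound[OF x n k(1) st(1,2) eq g0 h \<rho>]
    have j: "1 \<le> inv_bracket_norm" by (rule inv_bracket_norm_ge)
    have \<rho>0: "0 \<le> \<rho> i" for i by (rule weight_nonneg[OF \<rho>])
    have weighted_norm0: "0 \<le> weighted_norm \<rho>" by (simp add: weighted_norm_def)
    have local_mass0: "0 \<le> local_mass \<rho> n" by (simp add: local_mass_def)
    have "R \<le> 2 * weighted_norm \<rho> * (1 + 3 * inv_bracket_norm * t) + 4 * (g / n) * \<rho> (int n)" using wo(2) by (simp add: R_def t_def)
    also have "\<dots> \<le> 2 * weighted_norm \<rho> * (1 + 3 * inv_bracket_norm * 38) + 4 * G * \<rho> (2 * int n)"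
    proof (intro add_mono mult_left_mono mult_mono)
      show "t \<le> 38" using tc c0 by linarith
      show "\<rho> (int n) \<le> \<rho> (2 * int n)" by (rule weight_mono[OF \<rho>]) simp
      show "g / n \<le> G" using n0 by (simp add: gG)
    qed (use j weighted_norm0 \<rho>0 G0 in \<open>auto simp: t_def\<close>)
    finally have R: "R \<le> 2 * weighted_norm \<rho> * (1 + 114 * inv_bracket_norm) + 4 * G * \<rho> (2 * int n)" by simp
    have "\<rho> (2 * int n) * cmod \<beta> / n \<le> 6 * local_mass \<rho> n * t + 3 / n * (weighted_norm \<rho> * t + l2norm w * R)"
      using weighted_correction_bound[OF x(1) n0 \<rho> wo(1)] by (simp add: \<beta>_def t_def R_def)
    also have "\<dots> \<le> 6 * local_mass \<rho> n * (38 * c) + 3 / n * (weighted_norm \<rho> * 38 + l2norm w * (2 * weighted_norm \<rho> * (1 + 114 * inv_bracket_norm) + 4 * G * \<rho> (2 * int n)))"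
      using local_mass0 tc c0 weighted_norm0 R n0 by (intro add_mono mult_left_mono) auto
    also have "\<dots> = 228 * c * local_mass \<rho> n + C1 / n * weighted_norm \<rho> + C2 / n * (\<rho> (2 * int n) * G)"
      using n0 by (simp add: C1_def C2_def field_simps)
    finally show ?thesis .
  qed
  show ?thesis
    using b main G0 unfolding conv gG G_def c_def by (intro exI[of _ \<beta>]) blast
qed

lemma gap_expansion:
  assumes seq: "H.spectral_sequence l e"
  shows "\<forall>\<^sub>F n in sequentially. \<exists>\<beta>. n * scaled_gap l n \<le> 2 * cmod (v (2 * int n) + \<beta>) \<and> cmod (v (2 * int n) + \<beta>) \<le> 2 * (n * scaled_gap l n) \<and> 0 \<le> scaled_gap l n \<and>
     (\<forall>\<rho>. weight \<rho> \<longrightarrow> \<rho> (2 * int n) * cmod \<beta> / n \<le> remainder_bound \<rho> n (scaled_gap l n))"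
proof -
  have 1: "\<forall>\<^sub>F n in sequentially. 0 < n \<and> l2norm (kern n w) < 1/2" by (rule small_kernel) simp
  then have 2: "\<forall>\<^sub>F n in sequentially. 0 < n - 1 \<and> l2norm (kern (n - 1) w) < 1/2"
    by (rule eventually_compose_filterlim[OF _ filterlim_minus_const_nat_at_top[of 1]])
  have 3: "\<forall>\<^sub>F n in sequentially. l2norm (damped n w) < 1/64"
    by (rule order_tendstoD(2)[OF damped_tendsto_0[OF l2_w]]) simp
  have "(\<lambda>n. 3 * l2norm w / real n) \<longlonglongrightarrow> 0" by (rule lim_const_over_n)
  then have 4: "\<forall>\<^sub>F n in sequentially. 3 * l2norm w / real n < 1/64"
    by (rule order_tendstoD(2)) simp
  show ?thesis
    using 1 2 3 4 eventually_ge_at_top[of 2]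
    by eventually_elim (rule gap_expansion_at[OF seq], auto)
qed

lemma power2_sum3_le: "(a + b + c :: real)\<^sup>2 \<le> 3 * (a\<^sup>2 + b\<^sup>2 + c\<^sup>2)"
proof -
  have "0 \<le> (a - b)\<^sup>2 + (b - c)\<^sup>2 + (c - a)\<^sup>2" by simp
  then show ?thesis by (simp add: power2_eq_square algebra_simps)
qed

text \<open>Each of the three terms of \<open>remainder_bound\<close> is square summable with a small constant: the first since
  \<open>l2norm (damped n w)\<close> tends to \<open>0\<close> and the local masses are square summable, the second since the tail of the series of
  \<open>1 / n\<^sup>2\<close> is small, the third since \<open>C2 / n\<close> tends to \<open>0\<close>.  The threshold depends on \<open>w\<close> and \<open>\<epsilon>\<close> alone.\<close>

lemma correction_sum_bound:
  assumes \<epsilon>: "0 < \<epsilon>"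
  shows "\<exists>N1>0. \<forall>N\<ge>N1. \<forall>\<beta> G \<rho> M. weight \<rho> \<longrightarrow> (\<forall>n\<ge>N. \<rho> (2 * int n) * cmod (\<beta> n) / n \<le> remainder_bound \<rho> n (G n)) \<longrightarrow>
     (\<Sum>n=N..<M. (\<rho> (2 * int n) * cmod (\<beta> n) / n)\<^sup>2) \<le> \<epsilon> * ((weighted_norm \<rho>)\<^sup>2 + (\<Sum>n=N..<M. (\<rho> (2 * int n) * G n)\<^sup>2))"
proof -
  define \<delta> where "\<delta> = \<epsilon> / 6"
  have \<delta>: "0 < \<delta>" using \<epsilon> by (simp add: \<delta>_def)
  have "(\<lambda>n. (228 * l2norm (damped n w) * inv_bracket_norm)\<^sup>2) \<longlonglongrightarrow> (228 * 0 * inv_bracket_norm)\<^sup>2"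
    by (intro tendsto_intros damped_tendsto_0 l2_w)
  then have "\<forall>\<^sub>F n in sequentially. (228 * l2norm (damped n w) * inv_bracket_norm)\<^sup>2 < \<delta>"
    by (rule order_tendstoD(2)) (use \<delta> in simp)
  then obtain N2 where N2: "\<And>n. n \<ge> N2 \<Longrightarrow> (228 * l2norm (damped n w) * inv_bracket_norm)\<^sup>2 < \<delta>"
    by (auto simp: eventually_sequentially)
  have "(\<lambda>n. C2 / real n) \<longlonglongrightarrow> 0" by (rule lim_const_over_n)
  from tendsto_power[OF this, where n=2] have "(\<lambda>n. (C2 / real n)\<^sup>2) \<longlonglongrightarrow> 0" by simp
  then have "\<forall>\<^sub>F n in sequentially. (C2 / real n)\<^sup>2 < \<delta>" by (rule order_tendstoD(2)) (use \<delta> in simp)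
  then obtain N3 where N3: "\<And>n. n \<ge> N3 \<Longrightarrow> (C2 / real n)\<^sup>2 < \<delta>" by (auto simp: eventually_sequentially)
  have "summable (\<lambda>n. C1\<^sup>2 * inverse ((real n)\<^sup>2))"
    using inverse_power_summable[of 2, where 'a=real] by (intro summable_mult) simp
  then have "\<exists>N. \<forall>m\<ge>N. \<forall>n. norm (\<Sum>k=m..<n. C1\<^sup>2 * inverse ((real k)\<^sup>2)) < \<delta>"
    unfolding summable_Cauchy using \<delta> by blast
  then obtain N4 where N4: "\<And>m n. m \<ge> N4 \<Longrightarrow> (\<Sum>k=m..<n. C1\<^sup>2 * inverse ((real k)\<^sup>2)) < \<delta>"
    by (auto simp: abs_less_iff)
  show ?thesis
  proof (intro exI[of _ "Suc (max N2 (max N3 N4))"] conjI allI impI)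
    fix N \<beta> G \<rho> M assume N: "Suc (max N2 (max N3 N4)) \<le> N" and \<rho>: "weight \<rho>"
    assume H: "\<forall>n\<ge>N. \<rho> (2 * int n) * cmod (\<beta> n) / n \<le> remainder_bound \<rho> n (G n)"
    have j: "0 < inv_bracket_norm" using inv_bracket_norm_ge by linarith
    have "(\<Sum>n=N..<M. (\<rho> (2 * int n) * cmod (\<beta> n) / n)\<^sup>2) \<le> 
      (\<Sum>n=N..<M. 3 * (\<delta> / inv_bracket_norm\<^sup>2 * (local_mass \<rho> n)\<^sup>2 + C1\<^sup>2 * inverse ((real n)\<^sup>2) * (weighted_norm \<rho>)\<^sup>2 + \<delta> * (\<rho> (2 * int n) * G n)\<^sup>2))"
    proof (intro sum_mono)
      fix n assume "n \<in> {N..<M}"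
      then have n: "n \<ge> N" "n \<ge> N2" "n \<ge> N3" using N by auto
      have "(\<rho> (2 * int n) * cmod (\<beta> n) / n)\<^sup>2 \<le> (remainder_bound \<rho> n (G n))\<^sup>2"
        by (intro power_mono) (use H n weight_nonneg[OF \<rho>] in auto)
      also have "\<dots> \<le> 3 * ((228 * l2norm (damped n w) * local_mass \<rho> n)\<^sup>2 + (C1 / n * weighted_norm \<rho>)\<^sup>2 + (C2 / n * (\<rho> (2 * int n) * G n))\<^sup>2)"
        by (rule power2_sum3_le)
      also have "(228 * l2norm (damped n w) * local_mass \<rho> n)\<^sup>2 = (228 * l2norm (damped n w) * inv_bracket_norm)\<^sup>2 / inv_bracket_norm\<^sup>2 * (local_mass \<rho> n)\<^sup>2"
        using j by (simp add: power_mult_distrib)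
      also have "(C2 / n * (\<rho> (2 * int n) * G n))\<^sup>2 = (C2 / n)\<^sup>2 * (\<rho> (2 * int n) * G n)\<^sup>2" by (simp only: power_mult_distrib)
      also have "(C1 / n * weighted_norm \<rho>)\<^sup>2 = C1\<^sup>2 * inverse ((real n)\<^sup>2) * (weighted_norm \<rho>)\<^sup>2" by (simp add: power_mult_distrib power_divide divide_inverse power_inverse)
      finally have "(\<rho> (2 * int n) * cmod (\<beta> n) / n)\<^sup>2 \<le> 3 * ((228 * l2norm (damped n w) * inv_bracket_norm)\<^sup>2 / inv_bracket_norm\<^sup>2 * (local_mass \<rho> n)\<^sup>2 
         + C1\<^sup>2 * inverse ((real n)\<^sup>2) * (weighted_norm \<rho>)\<^sup>2 + (C2 / n)\<^sup>2 * (\<rho> (2 * int n) * G n)\<^sup>2)" .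
      also have "\<dots> \<le> 3 * (\<delta> / inv_bracket_norm\<^sup>2 * (local_mass \<rho> n)\<^sup>2 + C1\<^sup>2 * inverse ((real n)\<^sup>2) * (weighted_norm \<rho>)\<^sup>2 + \<delta> * (\<rho> (2 * int n) * G n)\<^sup>2)"
        using N2[OF n(2)] N3[OF n(3)] by (intro mult_left_mono add_mono mult_right_mono divide_right_mono) auto
      finally show "(\<rho> (2 * int n) * cmod (\<beta> n) / n)\<^sup>2 \<le> 3 * (\<delta> / inv_bracket_norm\<^sup>2 * (local_mass \<rho> n)\<^sup>2 + C1\<^sup>2 * inverse ((real n)\<^sup>2) * (weighted_norm \<rho>)\<^sup>2 + \<delta> * (\<rho> (2 * int n) * G n)\<^sup>2)" .
    qed
    also have "\<dots> = 3 * (\<delta> / inv_bracket_norm\<^sup>2 * (\<Sum>n=N..<M. (local_mass \<rho> n)\<^sup>2) + (\<Sum>n=N..<M. C1\<^sup>2 * inverse ((real n)\<^sup>2)) * (weighted_norm \<rho>)\<^sup>2 + \<delta> * (\<Sum>n=N..<M. (\<rho> (2 * int n) * G n)\<^sup>2))"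
      by (simp add: sum.distrib sum_distrib_left sum_distrib_right)
    also have "\<dots> \<le> 3 * (\<delta> / inv_bracket_norm\<^sup>2 * (weighted_norm \<rho> * inv_bracket_norm)\<^sup>2 + \<delta> * (weighted_norm \<rho>)\<^sup>2 + \<delta> * (\<Sum>n=N..<M. (\<rho> (2 * int n) * G n)\<^sup>2))"
    proof (intro mult_left_mono add_mono mult_right_mono sum_local_mass[OF \<rho>])
      have "N4 \<le> N" using N by simp
      from less_imp_le[OF N4[OF this]] show "(\<Sum>n=N..<M. C1\<^sup>2 * inverse ((real n)\<^sup>2)) \<le> \<delta>" .
    qed (use \<delta> in auto)
    also have "\<dots> = \<epsilon> * (weighted_norm \<rho>)\<^sup>2 + \<epsilon> / 2 * (\<Sum>n=N..<M. (\<rho> (2 * int n) * G n)\<^sup>2)"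
      using j by (simp add: \<delta>_def power_mult_distrib field_simps)
    also have "\<dots> \<le> \<epsilon> * (weighted_norm \<rho>)\<^sup>2 + \<epsilon> * (\<Sum>n=N..<M. (\<rho> (2 * int n) * G n)\<^sup>2)"
      using \<epsilon> by (intro add_mono mult_right_mono sum_nonneg) auto
    finally show "(\<Sum>n=N..<M. (\<rho> (2 * int n) * cmod (\<beta> n) / n)\<^sup>2) \<le> \<epsilon> * ((weighted_norm \<rho>)\<^sup>2 + (\<Sum>n=N..<M. (\<rho> (2 * int n) * G n)\<^sup>2))"
      by (simp add: distrib_left)
  qed simp
qed

text \<open>The gaps only control the entries \<open>v (2 n)\<close> with \<open>n \<ge> N\<close>; for a potential without odd entries these make up the whole
  norm apart from finitely many modes, each occurring twice because \<open>w\<close> and \<open>\<rho>\<close> are even.\<close>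

lemma weighted_norm_le_even_modes:
  assumes odd: "\<And>j. odd j \<Longrightarrow> v j = 0" and \<rho>: "weight \<rho>" and F: "finite F"
  shows "\<exists>M\<ge>N. \<forall>K\<ge>M. (\<Sum>j\<in>F. (\<rho> j * w j)\<^sup>2) \<le> (\<Sum>j\<in>{- 2 * int N..2 * int N}. (\<rho> j * w j)\<^sup>2) + 2 * (\<Sum>n=N..<K. (\<rho> (2 * int n) * w (2 * int n))\<^sup>2)"
proof -
  define f where "f j = (\<rho> j * w j)\<^sup>2" for j
  have f0: "0 \<le> f j" for j by (simp add: f_def)
  have fm: "f (- j) = f j" for j
    using weight_mono[OF \<rho>, of j "-j"] weight_mono[OF \<rho>, of "-j" j] by (simp add: f_def w_minus)
  have fo: "f j = 0" if "odd j" for j using odd[OF that] by (simp add: f_def w_def)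
  define M where "M = N + nat (Max (insert 0 ((\<lambda>j. \<bar>j\<bar>) ` F))) + 1"
  have big: "\<bar>j\<bar> < int M" if "j \<in> F" for j
  proof -
    have "\<bar>j\<bar> \<le> Max (insert 0 ((\<lambda>j. \<bar>j\<bar>) ` F))" by (rule Max_ge) (use that F in auto)
    then show ?thesis unfolding M_def by linarith
  qed
  have "sum f F \<le> sum f {- 2 * int N..2 * int N} + 2 * (\<Sum>n=N..<K. f (2 * int n))" if K: "K \<ge> M" for K
  proof -
    define P where "P = (\<lambda>n. 2 * int n) ` {N..<K}"
    define Q where "Q = (\<lambda>n. - 2 * int n) ` {N..<K}"
    have "sum f F = sum f {j\<in>F. even j}"
      by (rule sum.mono_neutral_right) (use F fo in auto)
    also have "\<dots> \<le> sum f ({- 2 * int N..2 * int N} \<union> P \<union> Q)"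
    proof (rule sum_mono2)
      show "{j \<in> F. even j} \<subseteq> {- 2 * int N..2 * int N} \<union> P \<union> Q"
      proof
        fix j assume "j \<in> {j \<in> F. even j}"
        then obtain i where i: "j = 2 * i" "\<bar>j\<bar> < int M" using big by (auto elim: evenE)
        consider "\<bar>i\<bar> < int N" | "int N \<le> i" | "i \<le> - int N" by linarith
        then show "j \<in> {- 2 * int N..2 * int N} \<union> P \<union> Q"
        proof cases
          case 2
          then have "j = 2 * int (nat i)" "nat i \<in> {N..<K}" using i K by auto
          then show ?thesis unfolding P_def by blast
        next
          case 3
          then have "j = - 2 * int (nat (- i))" "nat (- i) \<in> {N..<K}" using i K by auto
          then show ?thesis unfolding Q_def by blast
        qed (use i in auto)
      qed
    qed (use f0 in \<open>auto simp: P_def Q_def\<close>)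
    also have "\<dots> \<le> sum f {- 2 * int N..2 * int N} + sum f P + sum f Q"
    proof -
      have "sum f ({- 2 * int N..2 * int N} \<union> P \<union> Q) \<le> sum f ({- 2 * int N..2 * int N} \<union> P) + sum f Q"
        by (subst sum_Un) (use f0 in \<open>auto simp: P_def Q_def intro: sum_nonneg\<close>)
      also have "sum f ({- 2 * int N..2 * int N} \<union> P) \<le> sum f {- 2 * int N..2 * int N} + sum f P"
        by (subst sum_Un) (use f0 in \<open>auto simp: P_def intro: sum_nonneg\<close>)
      finally show ?thesis by simp
    qed
    also have "sum f P = (\<Sum>n=N..<K. f (2 * int n))" unfolding P_def by (subst sum.reindex) (auto simp: inj_on_def)
    also have "sum f Q = (\<Sum>n=N..<K. f (2 * int n))" unfolding Q_def 
      by (subst sum.reindex) (use fm in \<open>auto simp: inj_on_def intro!: sum.cong\<close>)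
    finally show ?thesis by simp
  qed
  then show ?thesis unfolding f_def by (intro exI[of _ M]) (auto simp: M_def)
qed

text \<open>Both implications work with truncated weights, where the norms are finite, bound one side by the other plus
  corrections, absorb the latter by \<open>correction_sum_bound\<close> with \<open>\<epsilon> = 1/16\<close>, and let the truncation grow.\<close>

theorem weighted_gap_characterization:
  assumes seq: "H.spectral_sequence l e" and odd: "\<And>j. odd j \<Longrightarrow> v j = 0" and s: "0 \<le> s" "s \<le> 1"
  shows "l2 (\<lambda>j. bracket j powr s * w j) \<longleftrightarrow> summable (\<lambda>n. (real n powr s * scaled_gap l n)\<^sup>2)"
proof -
  define G where "G = scaled_gap l"
  obtain N0 where "\<forall>n\<ge>N0. \<exists>\<beta>. n * G n \<le> 2 * cmod (v (2 * int n) + \<beta>) \<and> cmod (v (2 * int n) + \<beta>) \<le> 2 * (n * G n) \<and> 0 \<le> G n \<and>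
     (\<forall>\<rho>. weight \<rho> \<longrightarrow> \<rho> (2 * int n) * cmod \<beta> / n \<le> remainder_bound \<rho> n (G n))"
    using gap_expansion[OF seq] unfolding eventually_sequentially G_def by blast
  then obtain \<beta> where \<beta>: "\<And>n. n \<ge> N0 \<Longrightarrow> n * G n \<le> 2 * cmod (v (2 * int n) + \<beta> n)"
    "\<And>n. n \<ge> N0 \<Longrightarrow> cmod (v (2 * int n) + \<beta> n) \<le> 2 * (n * G n)" "\<And>n. n \<ge> N0 \<Longrightarrow> 0 \<le> G n"
    "\<And>n \<rho>. n \<ge> N0 \<Longrightarrow> weight \<rho> \<Longrightarrow> \<rho> (2 * int n) * cmod (\<beta> n) / n \<le> remainder_bound \<rho> n (G n)"
    by metis
  obtain N1 where N1: "0 < N1" "\<And>N \<beta> G \<rho> M. N \<ge> N1 \<Longrightarrow> weight \<rho> \<Longrightarrow> (\<forall>n\<ge>N. \<rho> (2 * int n) * cmod (\<beta> n) / n \<le> remainder_bound \<rho> n (G n)) \<Longrightarrow>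
     (\<Sum>n=N..<M. (\<rho> (2 * int n) * cmod (\<beta> n) / n)\<^sup>2) \<le> 1/16 * ((weighted_norm \<rho>)\<^sup>2 + (\<Sum>n=N..<M. (\<rho> (2 * int n) * G n)\<^sup>2))"
    using correction_sum_bound[of "1/16"] by auto
  define N where "N = max N0 N1"
  have N: "N \<ge> N0" "N \<ge> N1" "0 < N" using N1(1) by (auto simp: N_def)
  have X: "(\<Sum>n=N..<M. (\<rho> (2 * int n) * cmod (\<beta> n) / n)\<^sup>2) \<le> 1/16 * ((weighted_norm \<rho>)\<^sup>2 + (\<Sum>n=N..<M. (\<rho> (2 * int n) * G n)\<^sup>2))" 
    if "weight \<rho>" for \<rho> M
    by (rule N1(2)[OF N(2) that]) (use \<beta>(4) that N(1) in auto)
  have v2: "cmod (v (2 * int n)) = 2 * n * w (2 * int n)" if "0 < n" for n using that by (simp add: cmod_v bracket_def)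
  have G_le: "(\<rho> (2 * int n) * G n)\<^sup>2 \<le> 32 * (\<rho> (2 * int n) * w (2 * int n))\<^sup>2 + 8 * (\<rho> (2 * int n) * cmod (\<beta> n) / n)\<^sup>2"
    if "weight \<rho>" "n \<ge> N" for \<rho> n
  proof -
    have n: "0 < n" "n \<ge> N0" using that N by auto
    have \<rho>0: "0 \<le> \<rho> (2 * int n)" by (rule weight_nonneg[OF that(1)])
    have "n * G n \<le> 2 * (cmod (v (2 * int n)) + cmod (\<beta> n))"
      using \<beta>(1)[OF n(2)] norm_triangle_ineq[of "v (2 * int n)" "\<beta> n"] by argo
    also have "\<dots> = n * (4 * w (2 * int n) + 2 * (cmod (\<beta> n) / n))"
      unfolding v2[OF n(1)] using n(1) by (simp add: field_simps)
    finally have "n * G n \<le> n * (4 * w (2 * int n) + 2 * (cmod (\<beta> n) / n))" .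
    then have "G n \<le> 4 * w (2 * int n) + 2 * (cmod (\<beta> n) / n)" using n by simp
    then have "\<rho> (2 * int n) * G n \<le> \<rho> (2 * int n) * (4 * w (2 * int n) + 2 * (cmod (\<beta> n) / n))"
      by (rule mult_left_mono[OF _ \<rho>0])
    then have "(\<rho> (2 * int n) * G n)\<^sup>2 \<le> (4 * (\<rho> (2 * int n) * w (2 * int n)) + 2 * (\<rho> (2 * int n) * cmod (\<beta> n) / n))\<^sup>2"
      using \<rho>0 \<beta>(3)[OF n(2)] by (intro power_mono) (auto simp: algebra_simps)
    also have "\<dots> \<le> 2 * ((4 * (\<rho> (2 * int n) * w (2 * int n)))\<^sup>2 + (2 * (\<rho> (2 * int n) * cmod (\<beta> n) / n))\<^sup>2)"
      using power2_sum3_le sum_squares_bound[of "4 * (\<rho> (2 * int n) * w (2 * int n))" "2 * (\<rho> (2 * int n) * cmod (\<beta> n) / n)"]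
      unfolding power2_sum by argo
    finally show ?thesis by (simp only: power_mult_distrib) simp
  qed
  have w_le: "(\<rho> (2 * int n) * w (2 * int n))\<^sup>2 \<le> 2 * (\<rho> (2 * int n) * G n)\<^sup>2 + 2 * (\<rho> (2 * int n) * cmod (\<beta> n) / n)\<^sup>2"
    if "weight \<rho>" "n \<ge> N" for \<rho> n
  proof -
    have n: "0 < n" "n \<ge> N0" using that N by auto
    have \<rho>0: "0 \<le> \<rho> (2 * int n)" by (rule weight_nonneg[OF that(1)])
    have "cmod (v (2 * int n)) \<le> 2 * (n * G n) + cmod (\<beta> n)"
      using \<beta>(2)[OF n(2)] norm_triangle_ineq4[of "v (2 * int n) + \<beta> n" "\<beta> n"] by simp
    also have "\<dots> = 2 * real n * (G n + cmod (\<beta> n) / n / 2)" using n(1) by (simp add: field_simps)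
    finally have "2 * real n * w (2 * int n) \<le> 2 * real n * (G n + cmod (\<beta> n) / n / 2)" unfolding v2[OF n(1)] .
    then have "w (2 * int n) \<le> G n + cmod (\<beta> n) / n / 2" using n by simp
    also have "\<dots> \<le> G n + cmod (\<beta> n) / n"
      using divide_nonneg_nonneg[OF norm_ge_zero of_nat_0_le_iff, of "\<beta> n" n] by argo
    finally have "\<rho> (2 * int n) * w (2 * int n) \<le> \<rho> (2 * int n) * (G n + cmod (\<beta> n) / n)"
      by (rule mult_left_mono[OF _ \<rho>0])
    then have "(\<rho> (2 * int n) * w (2 * int n))\<^sup>2 \<le> ((\<rho> (2 * int n) * G n) + (\<rho> (2 * int n) * cmod (\<beta> n) / n))\<^sup>2"
      using \<rho>0 by (intro power_mono) (auto simp: algebra_simps)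
    then show ?thesis
      using sum_squares_bound[of "\<rho> (2 * int n) * G n" "\<rho> (2 * int n) * cmod (\<beta> n) / n"] unfolding power2_sum by argo
  qed
  show ?thesis
  proof
    assume L: "l2 (\<lambda>j. bracket j powr s * w j)"
    define W where "W = l2norm (\<lambda>j. bracket j powr s * w j)"
    have "summable (\<lambda>n. (real (n + N) powr s * G (n + N))\<^sup>2)"
    proof (rule bounded_imp_summable[where B="65 * W\<^sup>2"])
      fix K
      define M where "M = Suc K + N"
      \<comment> \<open>The truncation at \<open>2 M\<close> leaves the weights of the modes \<open>2 n\<close> with \<open>n < M\<close> unchanged.\<close>
      define \<rho> where "\<rho> = truncated_power s (2 * real M)"
      have M: "1 \<le> 2 * real M" by (simp add: M_def)
      have \<rho>: "weight \<rho>" unfolding \<rho>_def by (rule weight_truncated_power[OF s M])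
      have wnW: "(weighted_norm \<rho>)\<^sup>2 \<le> W\<^sup>2"
        unfolding weighted_norm_def W_def
        by (intro power_mono l2_mono(2)[OF L]) (use truncated_power_le[OF s(1) M] weight_nonneg[OF \<rho>] in \<open>auto simp: \<rho>_def abs_mult intro!: mult_right_mono\<close>)
      define S where "S = (\<Sum>n=N..<M. (\<rho> (2 * int n) * G n)\<^sup>2)"
      have even_modes: "(\<Sum>n=N..<M. (\<rho> (2 * int n) * w (2 * int n))\<^sup>2) \<le> (weighted_norm \<rho>)\<^sup>2"
      proof -
        have "(\<Sum>n=N..<M. (\<rho> (2 * int n) * w (2 * int n))\<^sup>2) = (\<Sum>j\<in>(\<lambda>n. 2 * int n) ` {N..<M}. (norm (\<rho> j * w j))\<^sup>2)"
          by (subst sum.reindex) (auto simp: inj_on_def)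
        also have "\<dots> \<le> (weighted_norm \<rho>)\<^sup>2" unfolding weighted_norm_def by (rule sum_le_l2norm[OF l2_weight[OF \<rho> l2_w]]) simp
        finally show ?thesis .
      qed
      have "S \<le> (\<Sum>n=N..<M. 32 * (\<rho> (2 * int n) * w (2 * int n))\<^sup>2 + 8 * (\<rho> (2 * int n) * cmod (\<beta> n) / n)\<^sup>2)"
        unfolding S_def by (intro sum_mono G_le[OF \<rho>]) auto
      also have "\<dots> = 32 * (\<Sum>n=N..<M. (\<rho> (2 * int n) * w (2 * int n))\<^sup>2) + 8 * (\<Sum>n=N..<M. (\<rho> (2 * int n) * cmod (\<beta> n) / n)\<^sup>2)"
        by (simp only: sum.distrib sum_distrib_left)
      also have "\<dots> \<le> 32 * (weighted_norm \<rho>)\<^sup>2 + 8 * (1/16 * ((weighted_norm \<rho>)\<^sup>2 + S))"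
        using even_modes X[OF \<rho>, of M] unfolding S_def by (intro add_mono mult_left_mono) auto
      finally have S: "S \<le> 65 * W\<^sup>2" using wnW by argo
      have "(\<Sum>i\<le>K. (real (i + N) powr s * G (i + N))\<^sup>2) = (\<Sum>n=N..<M. (real n powr s * G n)\<^sup>2)"
        by (rule sum.reindex_bij_witness[of _ "\<lambda>n. n - N" "\<lambda>i. i + N"]) (auto simp: M_def)
      also have "\<dots> \<le> S" unfolding S_def
      proof (intro sum_mono power_mono mult_right_mono)
        fix n assume n: "n \<in> {N..<M}"
        have "real n powr s \<le> bracket (2 * int n) powr s" using s by (intro powr_mono2) (auto simp: bracket_def)
        also have "\<dots> = \<rho> (2 * int n)" unfolding \<rho>_def using n M by (intro truncated_power_eq[symmetric]) (auto simp: bracket_def)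
        finally show "real n powr s \<le> \<rho> (2 * int n)" .
        show "0 \<le> G n" "0 \<le> real n powr s * G n" using \<beta>(3)[of n] n N(1) by auto
      qed
      finally show "(\<Sum>i\<le>K. (real (i + N) powr s * G (i + N))\<^sup>2) \<le> 65 * W\<^sup>2" using S by simp
    qed simp
    then show "summable (\<lambda>n. (real n powr s * scaled_gap l n)\<^sup>2)" unfolding G_def by (subst (asm) summable_iff_shift)
  next
    assume sm: "summable (\<lambda>n. (real n powr s * scaled_gap l n)\<^sup>2)"
    define S where "S = (\<Sum>n. (real n powr s * G n)\<^sup>2)"
    define C where "C = (\<Sum>j\<in>{- 2 * int N..2 * int N}. (bracket j powr s * w j)\<^sup>2)"
    have bound: "(weighted_norm \<rho>)\<^sup>2 \<le> 2 * C + 40 * S" if \<rho>: "weight \<rho>" and le: "\<And>j. \<rho> j \<le> bracket j powr s" for \<rho>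
    proof -
      have \<rho>0: "0 \<le> \<rho> j" for j by (rule weight_nonneg[OF \<rho>])
      have fin: "(\<Sum>j\<in>F. (\<rho> j * w j)\<^sup>2) \<le> C + 2 * (2 * (4 * S) + 2 * (1/16 * ((weighted_norm \<rho>)\<^sup>2 + 4 * S)))" if F: "finite F" for F
      proof -
        obtain M where M: "(\<Sum>j\<in>F. (\<rho> j * w j)\<^sup>2) \<le> (\<Sum>j\<in>{- 2 * int N..2 * int N}. (\<rho> j * w j)\<^sup>2) + 2 * (\<Sum>n=N..<M. (\<rho> (2 * int n) * w (2 * int n))\<^sup>2)"
          using weighted_norm_le_even_modes[OF odd \<rho> F, of N] by blast
        have 1: "(\<Sum>j\<in>{- 2 * int N..2 * int N}. (\<rho> j * w j)\<^sup>2) \<le> C"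
          unfolding C_def using le \<rho>0 by (intro sum_mono power_mono mult_right_mono) auto
        have SG: "(\<Sum>n=N..<M. (\<rho> (2 * int n) * G n)\<^sup>2) \<le> 4 * S"
        proof -
          have "(\<Sum>n=N..<M. (\<rho> (2 * int n) * G n)\<^sup>2) \<le> (\<Sum>n=N..<M. 4 * (real n powr s * G n)\<^sup>2)"
          proof (rule sum_mono)
            fix n assume "n \<in> {N..<M}"
            then have n: "n \<ge> N0" "0 < n" using N by auto
            have "\<rho> (2 * int n) \<le> (2 * real n) powr s" using le[of "2 * int n"] n by (simp add: bracket_def)
            also have "\<dots> = 2 powr s * real n powr s" by (simp add: powr_mult)
            also have "\<dots> \<le> 2 powr 1 * real n powr s" using s by (intro mult_right_mono powr_mono) auto
            finally have "\<rho> (2 * int n) * G n \<le> 2 * real n powr s * G n" using \<beta>(3)[OF n(1)] by (intro mult_right_mono) auto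
            then have "(\<rho> (2 * int n) * G n)\<^sup>2 \<le> (2 * real n powr s * G n)\<^sup>2" using \<rho>0 \<beta>(3)[OF n(1)] by (intro power_mono) auto
            then show "(\<rho> (2 * int n) * G n)\<^sup>2 \<le> 4 * (real n powr s * G n)\<^sup>2" by (simp add: power_mult_distrib)
          qed
          also have "\<dots> = 4 * (\<Sum>n=N..<M. (real n powr s * G n)\<^sup>2)" by (simp only: sum_distrib_left)
          also have "\<dots> \<le> 4 * S" unfolding S_def using sm
            by (intro mult_left_mono sum_le_suminf) (auto simp: G_def)
          finally show ?thesis .
        qed
        have "(\<Sum>n=N..<M. (\<rho> (2 * int n) * w (2 * int n))\<^sup>2) \<le> (\<Sum>n=N..<M. 2 * (\<rho> (2 * int n) * G n)\<^sup>2 + 2 * (\<rho> (2 * int n) * cmod (\<beta> n) / n)\<^sup>2)"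
          by (intro sum_mono w_le[OF \<rho>]) auto
        also have "\<dots> = 2 * (\<Sum>n=N..<M. (\<rho> (2 * int n) * G n)\<^sup>2) + 2 * (\<Sum>n=N..<M. (\<rho> (2 * int n) * cmod (\<beta> n) / n)\<^sup>2)"
          by (simp only: sum.distrib sum_distrib_left)
        also have "\<dots> \<le> 2 * (4 * S) + 2 * (1/16 * ((weighted_norm \<rho>)\<^sup>2 + 4 * S))"
          using SG X[OF \<rho>, of M] by (intro add_mono mult_left_mono) (auto intro: order_trans)
        finally show ?thesis using M 1 by argo
      qed
      have "(weighted_norm \<rho>)\<^sup>2 \<le> C + 2 * (2 * (4 * S) + 2 * (1/16 * ((weighted_norm \<rho>)\<^sup>2 + 4 * S)))"
        unfolding weighted_norm_def l2norm_power2
        by (rule infsum_le_finite_sums) (use l2_weight[OF \<rho> l2_w] fin in \<open>auto simp: l2_def weighted_norm_def l2norm_power2\<close>)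
      moreover have "0 \<le> S" unfolding S_def using sm by (intro suminf_nonneg) (auto simp: G_def)
      moreover have "0 \<le> C" unfolding C_def by (rule sum_nonneg) simp
      ultimately show ?thesis by argo
    qed
    show "l2 (\<lambda>j. bracket j powr s * w j)"
    proof (rule l2I(1))
      fix F :: "int set" assume F: "finite F"
      define M where "M = Max (insert 1 (bracket ` F))"
      have M: "1 \<le> M" "\<And>j. j \<in> F \<Longrightarrow> bracket j \<le> M" using F by (auto simp: M_def)
      note \<rho> = weight_truncated_power[OF s M(1)]
      have "(\<Sum>j\<in>F. (norm (bracket j powr s * w j))\<^sup>2) = (\<Sum>j\<in>F. (norm (truncated_power s M j * w j))\<^sup>2)"
        using M(2) by (intro sum.cong) (auto simp: truncated_power_eq)
      also have "\<dots> \<le> (weighted_norm (truncated_power s M))\<^sup>2" unfolding weighted_norm_def by (rule sum_le_l2norm[OF l2_weight[OF \<rho> l2_w] F])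
      also have "\<dots> \<le> 2 * C + 40 * S" by (rule bound[OF \<rho> truncated_power_le[OF s(1) M(1)]])
      finally show "L2_set (\<lambda>j. norm (bracket j powr s * w j)) F \<le> sqrt (2 * C + 40 * S)"
        unfolding L2_set_def by (rule real_sqrt_le_mono)
    qed
  qed
qed

end

section \<open>Fourier series on the circle of length two\<close>

definition per_measure :: "real measure" where "per_measure = restrict_space lborel {0..2}"

definition efun :: "int \<Rightarrow> real \<Rightarrow> complex" where "efun m x = cis (pi * of_int m * x)"

definition fourier :: "(real \<Rightarrow> complex) \<Rightarrow> int \<Rightarrow> complex" where
  "fourier u m = (LINT x|per_measure. u x * cnj (efun m x)) / 2"

lemma space_per_measure: "space per_measure = {0..2}" by (simp add: per_measure_def space_restrict_space)

lemma finite_per_measure: "finite_measure per_measure"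
  unfolding per_measure_def by (rule finite_measureI) (simp add: space_restrict_space emeasure_restrict_space)

interpretation per_measure: finite_measure per_measure by (rule finite_per_measure)

lemma measure_per_measure: "measure per_measure (space per_measure) = 2"
  by (simp add: per_measure_def measure_def space_restrict_space emeasure_restrict_space)

lemma set_integral_per_measure: "(LINT x:{0..2}|lborel. f x) = (LINT x|per_measure. f x)"
  for f :: "real \<Rightarrow> 'a::{banach, second_countable_topology}"
  by (simp add: per_measure_def set_lebesgue_integral_def integral_restrict_space)

lemma set_integrable_per_measure: "set_integrable lborel {0..2} f \<longleftrightarrow> integrable per_measure f"
  for f :: "real \<Rightarrow> 'a::{banach, second_countable_topology}"
  by (simp add: per_measure_def set_integrable_def integrable_restrict_space)

lemma L2_fun_per_measure: "L2_fun u \<longleftrightarrow> u \<in> borel_measurable per_measure \<and> integrable per_measure (\<lambda>x. (cmod (u x))\<^sup>2)"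
  by (simp add: L2_fun_def set_integrable_per_measure) (simp add: per_measure_def set_borel_measurable_def borel_measurable_restrict_space_iff)

lemma L2_inner_per_measure: "L2_inner u v = (LINT x|per_measure. u x * cnj (v x))"
  by (simp add: L2_inner_def set_integral_per_measure)

lemma continuous_measurable_per_measure: 
  fixes f :: "real \<Rightarrow> 'a::real_normed_vector" 
  shows "continuous_on {0..2} f \<Longrightarrow> f \<in> borel_measurable per_measure"
  using borel_measurable_continuous_on_restrict[of "{0..2}" f]
  by (simp add: per_measure_def cong: measurable_cong_sets)

lemma integrable_bounded_per_measure:
  fixes f :: "real \<Rightarrow> 'a::{banach, second_countable_topology}"
  assumes "f \<in> borel_measurable per_measure" "\<And>x. x \<in> {0..2} \<Longrightarrow> norm (f x) \<le> B"
  shows "integrable per_measure f"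
  by (rule per_measure.integrable_const_bound[of _ B]) (use assms in \<open>auto intro!: AE_I2 simp: space_per_measure\<close>)

lemma L2_bounded:
  assumes "f \<in> borel_measurable per_measure" "\<And>x. x \<in> {0..2} \<Longrightarrow> cmod (f x) \<le> B" shows "L2_fun f"
  unfolding L2_fun_per_measure
proof
  show "integrable per_measure (\<lambda>x. (cmod (f x))\<^sup>2)"
    by (rule integrable_bounded_per_measure[of _ "B\<^sup>2"]) (use assms in \<open>auto intro!: power_mono\<close>)
qed (rule assms)

lemma L2_continuous: 
  assumes "continuous_on {0..2} f" shows "L2_fun f"
proof -
  have "compact (f ` {0..2})" by (rule compact_continuous_image[OF assms]) simp
  then obtain B where "\<And>x. x \<in> {0..2} \<Longrightarrow> norm (f x) \<le> B"
    using compact_imp_bounded bounded_iff by (metis imageI)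
  then show ?thesis by (intro L2_bounded continuous_measurable_per_measure assms)
qed

definition sq_norm :: "(real \<Rightarrow> complex) \<Rightarrow> real" where "sq_norm u = (LINT x|per_measure. (cmod (u x))\<^sup>2)"

lemma sq_norm_nonneg [simp]: "0 \<le> sq_norm u" by (simp add: sq_norm_def)

lemma L2_product_integrable:
  assumes "L2_fun f" "L2_fun g"
  shows "integrable per_measure (\<lambda>x. f x * g x)" "integrable per_measure (\<lambda>x. cmod (f x) * cmod (g x))"
proof -
  have m[measurable]: "f \<in> borel_measurable per_measure" "g \<in> borel_measurable per_measure" using assms by (auto simp: L2_fun_per_measure)
  have i: "integrable per_measure (\<lambda>x. (cmod (f x))\<^sup>2 + (cmod (g x))\<^sup>2)" using assms by (auto simp: L2_fun_per_measure)
  have le: "cmod (f x) * cmod (g x) \<le> (cmod (f x))\<^sup>2 + (cmod (g x))\<^sup>2" for x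
    using sum_squares_bound[of "cmod (f x)" "cmod (g x)"] mult_nonneg_nonneg[OF norm_ge_zero norm_ge_zero, of "f x" "g x"] 
    by argo
  show "integrable per_measure (\<lambda>x. f x * g x)"
    by (rule Bochner_Integration.integrable_bound[OF i]) (use le in \<open>auto simp: norm_mult\<close>)
  show "integrable per_measure (\<lambda>x. cmod (f x) * cmod (g x))"
    by (rule Bochner_Integration.integrable_bound[OF i]) (use le in \<open>auto simp: norm_mult\<close>)
qed

lemma L2_CS:
  assumes "L2_fun f" "L2_fun g"
  shows "(LINT x|per_measure. cmod (f x) * cmod (g x))\<^sup>2 \<le> sq_norm f * sq_norm g"
    "(cmod (LINT x|per_measure. f x * g x))\<^sup>2 \<le> sq_norm f * sq_norm g"
proof -
  define I where "I = (LINT x|per_measure. cmod (f x) * cmod (g x))"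
  have I0: "0 \<le> I" by (simp add: I_def)
  have i: "integrable per_measure (\<lambda>x. (cmod (f x))\<^sup>2)" "integrable per_measure (\<lambda>x. (cmod (g x))\<^sup>2)" using assms by (auto simp: L2_fun_per_measure)
  have quad: "2 * t * I \<le> t\<^sup>2 * sq_norm f + sq_norm g" for t
  proof -
    have "2 * t * I = (LINT x|per_measure. 2 * t * (cmod (f x) * cmod (g x)))" by (simp add: I_def)
    also have "\<dots> \<le> (LINT x|per_measure. t\<^sup>2 * (cmod (f x))\<^sup>2 + (cmod (g x))\<^sup>2)"
    proof (rule integral_mono)
      fix x
      have "0 \<le> (t * cmod (f x) - cmod (g x))\<^sup>2" by simp
      then show "2 * t * (cmod (f x) * cmod (g x)) \<le> t\<^sup>2 * (cmod (f x))\<^sup>2 + (cmod (g x))\<^sup>2"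
        by (simp add: power2_eq_square algebra_simps)
    qed (use i L2_product_integrable[OF assms] in auto)
    also have "\<dots> = t\<^sup>2 * sq_norm f + sq_norm g" using i by (simp add: sq_norm_def)
    finally show ?thesis .
  qed
  show main: "(LINT x|per_measure. cmod (f x) * cmod (g x))\<^sup>2 \<le> sq_norm f * sq_norm g"
  proof (cases "sq_norm f = 0")
    case True
    have "I = 0"
    proof (rule ccontr)
      assume "I \<noteq> 0"
      then have "I > 0" using I0 by simp
      have "2 * ((sq_norm g + 1) / (2 * I)) * I \<le> sq_norm g" using quad[of "(sq_norm g + 1) / (2 * I)"] True by simp
      then show False using \<open>I > 0\<close> by simp
    qed
    then show ?thesis by (simp add: I_def)
  next
    case False
    then have f: "0 < sq_norm f" by (simp add: order_less_le)
    have "2 * (I / sq_norm f) * I \<le> (I / sq_norm f)\<^sup>2 * sq_norm f + sq_norm g" by (rule quad)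
    then have "I\<^sup>2 \<le> sq_norm f * sq_norm g" using f by (simp add: power2_eq_square field_simps)
    then show ?thesis by (simp add: I_def)
  qed
  have "cmod (LINT x|per_measure. f x * g x) \<le> (LINT x|per_measure. cmod (f x * g x))" by (rule integral_norm_bound)
  then have "cmod (LINT x|per_measure. f x * g x) \<le> I" by (simp add: I_def norm_mult)
  then have "(cmod (LINT x|per_measure. f x * g x))\<^sup>2 \<le> I\<^sup>2" by (intro power_mono) auto
  then show "(cmod (LINT x|per_measure. f x * g x))\<^sup>2 \<le> sq_norm f * sq_norm g" using main unfolding I_def by (rule order_trans)
qed

lemma L2_integrable: "L2_fun f \<Longrightarrow> integrable per_measure f"
  using L2_product_integrable(1)[of f "\<lambda>_. 1"] L2_continuous[of "\<lambda>_. 1"] by simp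

lemma L2_add: "L2_fun f \<Longrightarrow> L2_fun g \<Longrightarrow> L2_fun (\<lambda>x. f x + g x)"
proof -
  assume a: "L2_fun f" "L2_fun g"
  have m[measurable]: "f \<in> borel_measurable per_measure" "g \<in> borel_measurable per_measure" using a by (auto simp: L2_fun_per_measure)
  have i: "integrable per_measure (\<lambda>x. 2 * (cmod (f x))\<^sup>2 + 2 * (cmod (g x))\<^sup>2)" using a by (auto simp: L2_fun_per_measure)
  have "(cmod (f x + g x))\<^sup>2 \<le> 2 * (cmod (f x))\<^sup>2 + 2 * (cmod (g x))\<^sup>2" for x
  proof -
    have "(cmod (f x + g x))\<^sup>2 \<le> (cmod (f x) + cmod (g x))\<^sup>2" by (intro power_mono norm_triangle_ineq) auto
    then show ?thesis using sum_squares_bound[of "cmod (f x)" "cmod (g x)"] unfolding power2_sum by argo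
  qed
  then have "integrable per_measure (\<lambda>x. (cmod (f x + g x))\<^sup>2)"
    by (intro Bochner_Integration.integrable_bound[OF i]) auto
  then show ?thesis by (simp add: L2_fun_per_measure)
qed

lemma L2_scale: "L2_fun f \<Longrightarrow> L2_fun (\<lambda>x. c * f x)"
  by (auto simp: L2_fun_per_measure norm_mult power_mult_distrib)

lemma L2_diff: "L2_fun f \<Longrightarrow> L2_fun g \<Longrightarrow> L2_fun (\<lambda>x. f x - g x)"
  using L2_add[of f "\<lambda>x. -1 * g x"] L2_scale[of g "-1"] by simp

lemma L2_cnj: "L2_fun f \<Longrightarrow> L2_fun (\<lambda>x. cnj (f x))"
  by (auto simp: L2_fun_per_measure intro: borel_measurable_continuous_on[of cnj, OF continuous_on_cnj[OF continuous_on_id]])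

lemma L2_sum: "finite F \<Longrightarrow> (\<And>i. i \<in> F \<Longrightarrow> L2_fun (f i)) \<Longrightarrow> L2_fun (\<lambda>x. \<Sum>i\<in>F. f i x)"
proof (induction F rule: finite_induct)
  case empty
  then show ?case using L2_continuous[of "\<lambda>_. 0"] by simp
next
  case (insert i F)
  then show ?case using L2_add[of "f i" "\<lambda>x. \<Sum>i\<in>F. f i x"] by simp
qed

lemma continuous_efun: "continuous_on A (efun m)" unfolding efun_def by (intro continuous_intros)
lemma L2_efun: "L2_fun (efun m)" by (rule L2_continuous[OF continuous_efun])
lemma efun_norm [simp]: "cmod (efun m x) = 1" by (simp add: efun_def)
lemma efun_mult: "efun m x * efun k x = efun (m + k) x" by (simp add: efun_def cis_mult algebra_simps)
lemma efun_cnj: "cnj (efun m x) = efun (- m) x" by (simp add: efun_def cis_cnj)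
lemma efun_0 [simp]: "efun 0 x = 1" by (simp add: efun_def)
lemma efun_at_0 [simp]: "efun m 0 = 1" by (simp add: efun_def)
lemma efun_periodic: "efun m (x + 2) = efun m x"
proof -
  have "cis (2 * pi * of_int m) = 1" by (rule cis_multiple_2pi) simp
  moreover have "pi * of_int m * (x + 2) = pi * of_int m * x + 2 * pi * of_int m" by (simp add: algebra_simps)
  ultimately show ?thesis by (simp add: efun_def cis_mult[symmetric])
qed

lemma efun_integral_Icc:
  assumes "m \<noteq> 0" "0 \<le> b"
  shows "(\<integral>x. indicator {0..b} x *\<^sub>R efun m x \<partial>lborel) = (efun m b - 1) / (\<i> * of_real (pi * of_int m))"
proof -
  define F where "F x = efun m x / (\<i> * of_real (pi * of_int m))" for x
  have "(F has_vector_derivative efun m x) (at x within {0..b})" for x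
  proof -
    have "((\<lambda>x. cis (pi * of_int m * x)) has_vector_derivative (pi * of_int m) *\<^sub>R (\<i> * cis (pi * of_int m * x))) (at x within {0..b})"
    proof -
      have "((\<lambda>z. exp (\<i> * of_real (pi * of_int m) * z)) has_field_derivative (\<i> * of_real (pi * of_int m) * exp (\<i> * of_real (pi * of_int m) * of_real x))) (at (of_real x))"
        by (auto intro!: derivative_eq_intros)
      from has_vector_derivative_real_field[OF this, of "{0..b}"] show ?thesis
        by (simp add: cis_conv_exp scaleR_conv_of_real mult_ac)
    qed
    then have "((\<lambda>x. cis (pi * of_int m * x) / (\<i> * of_real (pi * of_int m))) has_vector_derivative (pi * of_int m) *\<^sub>R (\<i> * cis (pi * of_int m * x)) / (\<i> * of_real (pi * of_int m))) (at x within {0..b})"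
      by (rule has_vector_derivative_divide)
    then show ?thesis using assms unfolding F_def efun_def by (simp add: scaleR_conv_of_real)
  qed
  then have "(\<integral>x. indicator {0..b} x *\<^sub>R efun m x \<partial>lborel) = F b - F 0"
    by (intro integral_FTC_Icc assms continuous_efun) auto
  then show ?thesis by (simp add: F_def diff_divide_distrib)
qed

lemma efun_integral: "(LINT x|per_measure. efun m x) = (if m = 0 then 2 else 0)"
proof (cases "m = 0")
  case True
  then show ?thesis using measure_per_measure by (simp add: scaleR_conv_of_real)
next
  case False
  have "efun m 2 = 1" using efun_periodic[of m 0] by simp
  then show ?thesis using efun_integral_Icc[OF False, of 2] False
    by (simp add: per_measure_def integral_restrict_space)
qed

lemma efun_orth: "(LINT x|per_measure. efun m x * cnj (efun k x)) = (if m = k then 2 else 0)"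
  unfolding efun_cnj efun_mult efun_integral by simp

definition trig_sum :: "(int \<Rightarrow> complex) \<Rightarrow> int set \<Rightarrow> real \<Rightarrow> complex" where
  "trig_sum c F x = (\<Sum>m\<in>F. c m * efun m x)"

lemma L2_trig_sum: "finite F \<Longrightarrow> L2_fun (trig_sum c F)"
  unfolding trig_sum_def by (intro L2_sum L2_scale L2_efun)

lemma trig_sum_inner:
  assumes "finite F" "L2_fun g"
  shows "(LINT x|per_measure. trig_sum c F x * cnj (g x)) = 2 * (\<Sum>m\<in>F. c m * cnj (fourier g m))"
proof -
  have i: "integrable per_measure (\<lambda>x. efun m x * cnj (g x))" for m
    by (intro L2_product_integrable L2_efun L2_cnj assms)
  have "(LINT x|per_measure. trig_sum c F x * cnj (g x)) = (LINT x|per_measure. (\<Sum>m\<in>F. c m * (efun m x * cnj (g x))))"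
    by (simp add: trig_sum_def sum_distrib_right mult.assoc)
  also have "\<dots> = (\<Sum>m\<in>F. c m * (LINT x|per_measure. efun m x * cnj (g x)))"
    using i by simp
  also have "\<dots> = (\<Sum>m\<in>F. c m * (2 * cnj (fourier g m)))"
  proof (intro sum.cong refl)
    fix m
    have "cnj (LINT x|per_measure. g x * cnj (efun m x)) = (LINT x|per_measure. cnj (g x * cnj (efun m x)))"
      by (rule Bochner_Integration.integral_cnj[symmetric])
    then show "c m * (LINT x|per_measure. efun m x * cnj (g x)) = c m * (2 * cnj (fourier g m))"
      by (simp add: fourier_def mult.commute)
  qed
  finally show ?thesis by (simp add: sum_distrib_left mult.left_commute)
qed

lemma fourier_trig_sum: "finite F \<Longrightarrow> fourier (trig_sum c F) m = (if m \<in> F then c m else 0)"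
proof -
  assume F: "finite F"
  have "fourier (efun m) k = (if k = m then 1 else 0)" for k by (simp add: fourier_def efun_orth)
  then have "(LINT x|per_measure. trig_sum c F x * cnj (efun m x)) = 2 * (\<Sum>k\<in>F. if k = m then c k else 0)"
    unfolding trig_sum_inner[OF F L2_efun] by (intro arg_cong[of _ _ "\<lambda>x. 2 * x"] sum.cong) auto
  then show ?thesis using F by (simp add: fourier_def)
qed

lemma sq_norm_trig_sum: "finite F \<Longrightarrow> sq_norm (trig_sum c F) = 2 * (\<Sum>m\<in>F. (cmod (c m))\<^sup>2)"
proof -
  assume F: "finite F"
  have "(LINT x|per_measure. trig_sum c F x * cnj (trig_sum c F x)) = 2 * (\<Sum>m\<in>F. c m * cnj (c m))"
    unfolding trig_sum_inner[OF F L2_trig_sum[OF F]] using F by (simp add: fourier_trig_sum)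
  then have "complex_of_real (sq_norm (trig_sum c F)) = of_real (2 * (\<Sum>m\<in>F. (cmod (c m))\<^sup>2))"
    by (simp add: sq_norm_def complex_norm_square[symmetric] del: of_real_power)
  then show ?thesis by (simp only: of_real_eq_iff)
qed

lemma bessel:
  assumes "L2_fun u" shows "l2 (fourier u)"
proof (rule l2I(1))
  fix F :: "int set" assume F: "finite F"
  have "(cmod (LINT x|per_measure. trig_sum (fourier u) F x * cnj (u x)))\<^sup>2 \<le> sq_norm (trig_sum (fourier u) F) * sq_norm (\<lambda>x. cnj (u x))"
    by (intro L2_CS L2_trig_sum F L2_cnj assms)
  moreover have "(LINT x|per_measure. trig_sum (fourier u) F x * cnj (u x)) = of_real (2 * (\<Sum>m\<in>F. (cmod (fourier u m))\<^sup>2))"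
    unfolding trig_sum_inner[OF F assms] by (simp add: complex_norm_square[symmetric] del: of_real_power)
  moreover have "sq_norm (\<lambda>x. cnj (u x)) = sq_norm u" by (simp add: sq_norm_def)
  moreover define S where "S = (\<Sum>m\<in>F. (cmod (fourier u m))\<^sup>2)"
  ultimately have 1: "(2 * S)\<^sup>2 \<le> 2 * S * sq_norm u" unfolding sq_norm_trig_sum[OF F] by (simp only: norm_of_real power2_abs)
  have S0: "0 \<le> S" by (simp add: S_def sum_nonneg)
  have "S \<le> sq_norm u"
  proof (cases "S = 0")
    case False
    then have "0 < S" using S0 by simp
    then have "2 * S \<le> sq_norm u" using 1 by (simp add: power2_eq_square)
    then show ?thesis using S0 by linarith
  qed simp
  then show "L2_set (\<lambda>m. norm (fourier u m)) F \<le> sqrt (sq_norm u)" unfolding L2_set_def S_def by simp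
qed

subsection \<open>Completeness of the trigonometric system\<close>

inductive trig :: "(real \<Rightarrow> complex) \<Rightarrow> bool" where
  mono: "trig (\<lambda>x. c * efun m x)"
| add: "trig f \<Longrightarrow> trig g \<Longrightarrow> trig (\<lambda>x. f x + g x)"

lemma trig_mult: 
  assumes "trig f" "trig g" shows "trig (\<lambda>x. f x * g x)"
proof -
  have 1: "trig (\<lambda>x. c * efun m x * g x)" for c m
    using assms(2)
  proof (induction rule: trig.induct)
    case (mono c' m')
    have "(\<lambda>x. c * efun m x * (c' * efun m' x)) = (\<lambda>x. (c * c') * efun (m + m') x)"
      by (simp add: fun_eq_iff efun_mult[symmetric])
    then show ?case using trig.mono[of "c * c'" "m + m'"] by simp
  next
    case (add f g)
    then show ?case using trig.add by (simp add: distrib_left)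
  qed
  show ?thesis using assms(1)
  proof (induction rule: trig.induct)
    case (mono c m)
    then show ?case by (rule 1)
  next
    case (add f g)
    then show ?case using trig.add by (simp add: distrib_right)
  qed
qed

text \<open>The real and imaginary part of \<open>exp (\<i> \<pi> x)\<close> are trigonometric polynomials, and these form an algebra.\<close>

lemma trig_polynomial:
  assumes "real_polynomial_function p" shows "trig (\<lambda>x. of_real (p (efun 1 x)))"
  using assms
proof (induction rule: real_polynomial_function.induct)
  case (linear f)
  define a b where "a = f 1" and "b = f \<i>"
  have "f z = Re z * a + Im z * b" for z
  proof -
    have "z = Re z *\<^sub>R 1 + Im z *\<^sub>R \<i>" by (simp add: complex_eq_iff)
    then have "f z = f (Re z *\<^sub>R 1 + Im z *\<^sub>R \<i>)" by simp
    also have "\<dots> = Re z * a + Im z * b"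
      using linear unfolding a_def b_def by (simp only: bounded_linear.linear linear_add linear_cmul) simp
    finally show ?thesis .
  qed
  note f_eq = this
  have re_im: "of_real (Re (efun 1 x)) = efun 1 x / 2 + efun (-1) x / 2"
    "of_real (Im (efun 1 x)) = - \<i> * efun 1 x / 2 + \<i> * efun (-1) x / 2" for x
    by (auto simp: efun_def complex_eq_iff)
  have "of_real (f (efun 1 x)) = (a / 2 - \<i> * b / 2) * efun 1 x + (a / 2 + \<i> * b / 2) * efun (-1) x" for x
    unfolding f_eq of_real_add of_real_mult re_im by (simp add: algebra_simps)
  then show ?case using trig.add[OF trig.mono trig.mono] by simp
next
  case (const c)
  then show ?case using trig.mono[of "of_real c" 0] by simp
next
  case (add f g)
  then show ?case using trig.add by simp
next
  case (mult f g)
  then show ?case using trig_mult by simp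
qed

lemma trig_L2: "trig f \<Longrightarrow> L2_fun f"
  by (induction rule: trig.induct) (auto intro: L2_add L2_scale L2_efun)

lemma trig_orth:
  assumes "trig f" and h: "L2_fun h" "\<And>m. fourier h m = 0" shows "(LINT x|per_measure. h x * f x) = 0"
  using assms(1)
proof (induction rule: trig.induct)
  case (mono c m)
  have "(LINT x|per_measure. h x * (c * efun m x)) = c * (LINT x|per_measure. h x * cnj (efun (- m) x))"
    by (simp add: efun_cnj mult.left_commute)
  then show ?case using h(2)[of "- m"] by (simp add: fourier_def)
next
  case (add f g)
  have "integrable per_measure (\<lambda>x. h x * f x)" "integrable per_measure (\<lambda>x. h x * g x)"
    by (intro L2_product_integrable h trig_L2 add)+
  then show ?case using add by (simp add: distrib_left)
qed

text \<open>Stone-Weierstrass on the unit circle approximates \<open>\<phi>\<close> by polynomials, for which the integral vanishes by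
  \<open>trig_orth\<close>.\<close>

lemma continuous_orth:
  fixes \<phi> :: "complex \<Rightarrow> real"
  assumes h: "L2_fun h" "\<And>m. fourier h m = 0" and \<phi>: "continuous_on (sphere 0 1) \<phi>"
  shows "(LINT x|per_measure. h x * of_real (\<phi> (efun 1 x))) = 0"
proof -
  have c: "continuous_on {0..2} (\<lambda>x. complex_of_real (\<phi> (efun 1 x)))"
    by (intro continuous_on_of_real continuous_on_compose2[OF \<phi> continuous_efun]) auto
  note i = L2_product_integrable(1)[OF h(1) L2_continuous[OF c]]
  have hi: "integrable per_measure (\<lambda>x. cmod (h x))" using L2_integrable[OF h(1)] by simp
  define H where "H = (LINT x|per_measure. cmod (h x))"
  have H0: "0 \<le> H" by (simp add: H_def)
  have "cmod (LINT x|per_measure. h x * of_real (\<phi> (efun 1 x))) \<le> e" if e: "0 < e" for e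
  proof -
    have "0 < e / (H + 1)" using e H0 by simp
    from Stone_Weierstrass_real_polynomial_function[OF compact_sphere \<phi> this]
    obtain p where p: "real_polynomial_function p" "\<And>z. z \<in> sphere 0 1 \<Longrightarrow> \<bar>\<phi> z - p z\<bar> < e / (H + 1)" by blast
    note tp = trig_polynomial[OF p(1)]
    note ip = L2_product_integrable(1)[OF h(1) trig_L2[OF tp]]
    have "(LINT x|per_measure. h x * of_real (\<phi> (efun 1 x))) = (LINT x|per_measure. h x * of_real (\<phi> (efun 1 x)) - h x * of_real (p (efun 1 x)))"
      using i ip trig_orth[OF tp h] by simp
    also have "cmod \<dots> \<le> (LINT x|per_measure. cmod (h x * of_real (\<phi> (efun 1 x)) - h x * of_real (p (efun 1 x))))"
      by (rule integral_norm_bound)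
    also have "\<dots> \<le> (LINT x|per_measure. e / (H + 1) * cmod (h x))"
    proof (rule integral_mono)
      show "integrable per_measure (\<lambda>x. cmod (h x * of_real (\<phi> (efun 1 x)) - h x * of_real (p (efun 1 x))))" using i ip by simp
      show "integrable per_measure (\<lambda>x. e / (H + 1) * cmod (h x))" using hi by simp
      fix x
      have "cmod (h x * of_real (\<phi> (efun 1 x)) - h x * of_real (p (efun 1 x))) = \<bar>\<phi> (efun 1 x) - p (efun 1 x)\<bar> * cmod (h x)"
        by (simp add: right_diff_distrib[symmetric] norm_mult mult.commute flip: of_real_diff)
      also have "\<dots> \<le> e / (H + 1) * cmod (h x)" using p(2)[of "efun 1 x"] by (intro mult_right_mono) auto
      finally show "cmod (h x * of_real (\<phi> (efun 1 x)) - h x * of_real (p (efun 1 x))) \<le> e / (H + 1) * cmod (h x)" .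
    qed
    also have "\<dots> = e / (H + 1) * H" by (simp add: H_def)
    also have "\<dots> \<le> e" using e H0 by (simp add: field_simps)
    finally show ?thesis .
  qed
  then have "cmod (LINT x|per_measure. h x * of_real (\<phi> (efun 1 x))) \<le> 0" by (rule field_le_epsilon[of _ 0, simplified])
  then show ?thesis by simp
qed

lemma efun1_inj:
  assumes "0 < x" "x < 2" "0 \<le> y" "y \<le> 2" "efun 1 x = efun 1 y" shows "x = y"
proof -
  have "cis (pi * x) = cis (pi * y)" using assms(5) by (simp add: efun_def)
  then have "cis (pi * x - pi * y) = 1" by (simp add: cis_divide[symmetric])
  then obtain k :: int where k: "pi * x - pi * y = 2 * pi * of_int k"
    unfolding cis_conv_exp exp_eq_1 by auto
  then have "pi * (x - y) = pi * (2 * of_int k)" by (simp add: algebra_simps)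
  then have xy: "x - y = 2 * of_int k" by (simp only: mult_cancel_left) auto
  then have "\<bar>real_of_int k\<bar> < 1" using assms by auto
  then have "k = 0" by linarith
  then show ?thesis using xy by simp
qed

text \<open>The indicator of \<open>U\<close> is the bounded limit of continuous functions on the circle, built from the distance to the
  compact image of the complement of \<open>U\<close>.  The points \<open>0\<close> and \<open>2\<close>, identified on the circle, both lie outside \<open>U\<close>.\<close>

lemma open_orth:
  assumes h: "L2_fun h" "\<And>m. fourier h m = 0" and U: "open U" "U \<subseteq> {0<..<2}"
  shows "(LINT x|per_measure. indicator U x *\<^sub>R h x) = 0"
proof -
  define K where "K = efun 1 ` ({0..2} - U)"
  have K: "compact K" unfolding K_def
    by (intro compact_continuous_image continuous_efun compact_diff U) auto
  have K0: "K \<noteq> {}" using U by (force simp: K_def)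
  define \<phi> where "\<phi> k z = min 1 (real k * infdist z K)" for k z
  have c: "continuous_on A (\<phi> k)" for A k unfolding \<phi>_def by (intro continuous_intros)
  have z: "(LINT x|per_measure. h x * of_real (\<phi> k (efun 1 x))) = 0" for k by (rule continuous_orth[OF h c])
  have m[measurable]: "h \<in> borel_measurable per_measure" using h by (simp add: L2_fun_per_measure)
  have U_meas: "U \<in> sets borel" using U by simp
  have iU: "(\<lambda>x. indicator U x *\<^sub>R h x) \<in> borel_measurable per_measure"
  proof -
    have "(indicator U :: real \<Rightarrow> real) \<in> borel_measurable lborel" using U_meas by simp
    then have "(indicator U :: real \<Rightarrow> real) \<in> borel_measurable per_measure" unfolding per_measure_def by (rule measurable_restrict_space1)
    then show ?thesis by simp
  qed
  have "(\<lambda>k. LINT x|per_measure. h x * of_real (\<phi> k (efun 1 x))) \<longlonglongrightarrow> (LINT x|per_measure. indicator U x *\<^sub>R h x)"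
  proof (rule integral_dominated_convergence[where w="\<lambda>x. cmod (h x)"])
    show "(\<lambda>x. h x * of_real (\<phi> k (efun 1 x))) \<in> borel_measurable per_measure" for k
    proof -
      have "continuous_on {0..2} (\<lambda>x. complex_of_real (\<phi> k (efun 1 x)))"
        by (intro continuous_on_of_real continuous_on_compose2[OF c continuous_efun]) auto
      from continuous_measurable_per_measure[OF this] show ?thesis by simp
    qed
    show "integrable per_measure (\<lambda>x. cmod (h x))" using L2_integrable[OF h(1)] by simp
    show "AE x in per_measure. cmod (h x * of_real (\<phi> k (efun 1 x))) \<le> cmod (h x)" for k
    proof (rule AE_I2)
      fix x
      have "\<bar>\<phi> k (efun 1 x)\<bar> \<le> 1" by (auto simp: \<phi>_def abs_le_iff infdist_nonneg intro: order_trans[of _ 0])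
      then show "cmod (h x * of_real (\<phi> k (efun 1 x))) \<le> cmod (h x)" by (simp add: norm_mult mult_left_le)
    qed
    show "AE x in per_measure. (\<lambda>k. h x * of_real (\<phi> k (efun 1 x))) \<longlonglongrightarrow> indicator U x *\<^sub>R h x"
    proof (rule AE_I2)
      fix x assume "x \<in> space per_measure"
      then have x: "0 \<le> x" "x \<le> 2" by (auto simp: space_per_measure)
      show "(\<lambda>k. h x * of_real (\<phi> k (efun 1 x))) \<longlonglongrightarrow> indicator U x *\<^sub>R h x"
      proof (cases "x \<in> U")
        case True
        then have x2: "0 < x" "x < 2" using U by auto
        have "efun 1 x \<notin> K"
        proof
          assume "efun 1 x \<in> K"
          then obtain y where "y \<in> {0..2}" "y \<notin> U" "efun 1 x = efun 1 y" by (auto simp: K_def)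
          then show False using efun1_inj[OF x2, of y] True by auto
        qed
        then have d: "0 < infdist (efun 1 x) K" (is "0 < ?d")
          using infdist_pos_not_in_closed[OF compact_imp_closed[OF K] K0] by blast
        have "\<forall>\<^sub>F k in sequentially. h x * of_real (\<phi> k (efun 1 x)) = indicator U x *\<^sub>R h x"
          using eventually_ge_at_top[of "nat \<lceil>1 / ?d\<rceil>"]
        proof eventually_elim
          case (elim k)
          then have "1 / ?d \<le> real k" by linarith
          then have "1 \<le> real k * ?d" using d by (simp add: field_simps)
          then show ?case using True by (simp add: \<phi>_def)
        qed
        then show ?thesis by (rule tendsto_eventually)
      next
        case False
        then have "efun 1 x \<in> K" using x by (auto simp: K_def)
        then show ?thesis using False by (simp add: \<phi>_def)
      qed
    qed
  qed (use iU in auto)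
  then show ?thesis unfolding z by (simp add: LIMSEQ_const_iff)
qed

text \<open>A function orthogonal to all exponentials has vanishing integral over open sets, hence over
  all Borel sets.\<close>

lemma complete:
  assumes h: "L2_fun h" "\<And>m. fourier h m = 0"
  shows "AE x in per_measure. h x = 0"
proof -
  define f where "f x = indicator {0<..<2} x *\<^sub>R h x" for x :: real
  have hm[measurable]: "h \<in> borel_measurable per_measure" using h by (simp add: L2_fun_per_measure)
  have ind: "(indicator A :: real \<Rightarrow> real) \<in> borel_measurable per_measure" if "A \<in> sets borel" for A :: "real set"
    unfolding per_measure_def by (rule measurable_restrict_space1) (use that in simp)
  have hi: "integrable per_measure h" by (rule L2_integrable[OF h(1)])
  have fi: "integrable lborel f"
  proof -
    have "f \<in> borel_measurable per_measure"
      unfolding f_def by (rule borel_measurable_scaleR[OF ind hm]) simp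
    then have "integrable per_measure f"
      by (rule Bochner_Integration.integrable_bound[OF hi]) (auto simp: f_def indicator_def)
    then have "integrable lborel (\<lambda>x. indicator {0..2} x *\<^sub>R f x)" by (simp add: per_measure_def integrable_restrict_space)
    moreover have "(\<lambda>x. indicator {0..2} x *\<^sub>R f x) = f" by (auto simp: f_def indicator_def fun_eq_iff)
    ultimately show ?thesis by simp
  qed
  have fset: "set_integrable lborel A f" if "A \<in> sets borel" for A
    unfolding set_integrable_def by (rule integrable_mult_indicator[OF _ fi]) (use that in simp)
  have open0: "(LINT x:U|lborel. f x) = 0" if "open U" for U
  proof -
    have "(LINT x:U|lborel. f x) = (LINT x|per_measure. indicator (U \<inter> {0<..<2}) x *\<^sub>R h x)"
      unfolding per_measure_def set_lebesgue_integral_def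
      by (subst integral_restrict_space) (auto intro!: Bochner_Integration.integral_cong simp: f_def indicator_def)
    also have "\<dots> = 0" by (rule open_orth[OF h]) (use that in auto)
    finally show ?thesis .
  qed
  have all0: "(LINT x:A|lborel. f x) = 0" if "A \<in> sets borel" for A
  proof -
    show ?thesis
    proof (rule sigma_sets_induct_disjoint[of "{S. open S}" UNIV A "\<lambda>A. (LINT x:A|lborel. f x) = 0"])
      show "A \<in> sigma_sets UNIV {S. open S}" using that by (simp add: borel_def)
      show "Int_stable {S. open (S :: real set)}" by (auto simp: Int_stable_def)
      show "{S. open S} \<subseteq> Pow (UNIV :: real set)" by auto
      show "(LINT x:U|lborel. f x) = 0" if "U \<in> {S. open S}" for U using that open0 by simp
      show "(LINT x:{}|lborel. f x) = 0" by (simp add: set_lebesgue_integral_def)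
    next
      fix A assume A: "A \<in> sigma_sets UNIV {S. open S}" "(LINT x:A|lborel. f x) = 0"
      then have b: "A \<in> sets borel" by (simp add: borel_def)
      have "(LINT x:A \<union> (UNIV - A)|lborel. f x) = (LINT x:A|lborel. f x) + (LINT x:UNIV - A|lborel. f x)"
        by (rule set_integral_Un) (use b fset in auto)
      moreover have "A \<union> (UNIV - A) = UNIV" by auto
      ultimately show "(LINT x:UNIV - A|lborel. f x) = 0" using A(2) open0[of UNIV] by simp
    next
      fix A :: "nat \<Rightarrow> real set"
      assume A: "disjoint_family A" "range A \<subseteq> sigma_sets UNIV {S. open S}" "\<And>i. (LINT x:A i|lborel. f x) = 0"
      have b: "A i \<in> sets borel" for i using A(2) by (auto simp: borel_def)
      have "(LINT x:(\<Union>i. A i)|lborel. f x) = (\<Sum>i. (LINT x:(A i)|lborel. f x))"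
        by (rule lebesgue_integral_countable_add) (use b A(1) fset in \<open>auto simp: disjoint_family_on_def\<close>)
      then show "(LINT x:(\<Union>i. A i)|lborel. f x) = 0" using A(3) by simp
    qed
  qed
  have "AE x in lborel. f x = 0" by (rule sigma_finite_measure.density_zero[OF sigma_finite_lborel fi]) (use all0 in simp)
  moreover have "AE x in lborel. x \<noteq> 0 \<and> x \<noteq> (2::real)"
    using AE_lborel_singleton[of 0] AE_lborel_singleton[of "2::real"] by eventually_elim auto
  ultimately have "AE x in lborel. x \<in> {0..2} \<longrightarrow> h x = 0"
    by eventually_elim (auto simp: f_def indicator_def split: if_splits)
  then show ?thesis unfolding per_measure_def by (subst AE_restrict_space_iff) auto
qed

lemma int_interval_at_top: "filterlim (\<lambda>N::nat. {- int N..int N}) (finite_subsets_at_top UNIV) sequentially"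
  unfolding filterlim_finite_subsets_at_top
proof (intro allI impI)
  fix X :: "int set" assume X: "finite X \<and> X \<subseteq> UNIV"
  show "\<forall>\<^sub>F N in sequentially. finite {- int N..int N} \<and> X \<subseteq> {- int N..int N} \<and> {- int N..int N} \<subseteq> UNIV"
    using eventually_ge_at_top[of "nat (Max (insert 0 ((\<lambda>j. \<bar>j\<bar>) ` X)))"]
  proof eventually_elim
    case (elim N)
    have "\<bar>j\<bar> \<le> int N" if "j \<in> X" for j
    proof -
      have "\<bar>j\<bar> \<le> Max (insert 0 ((\<lambda>j. \<bar>j\<bar>) ` X))" by (rule Max_ge) (use that X in auto)
      then show ?thesis using elim by linarith
    qed
    then show ?case by (auto simp: abs_le_iff) (meson abs_le_iff minus_le_iff)
  qed
qed

lemma infsum_int_limit: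
  fixes f :: "int \<Rightarrow> 'a::{comm_monoid_add, t2_space}"
  assumes "f summable_on UNIV"
  shows "(\<lambda>N::nat. \<Sum>m\<in>{- int N..int N}. f m) \<longlonglongrightarrow> (\<Sum>\<^sub>\<infinity>m. f m)"
  using has_sum_infsum[OF assms] unfolding has_sum_def by (rule filterlim_compose[OF _ int_interval_at_top])

abbreviation psum :: "(int \<Rightarrow> complex) \<Rightarrow> nat \<Rightarrow> real \<Rightarrow> complex" where
  "psum c N \<equiv> trig_sum c {- int N..int N}"

lemma L2_AE_cong:
  fixes k :: "real \<Rightarrow> complex"
  assumes "AE x in per_measure. f x = g x" "f \<in> borel_measurable per_measure" "g \<in> borel_measurable per_measure" "k \<in> borel_measurable per_measure"
  shows "(LINT x|per_measure. f x * k x) = (LINT x|per_measure. g x * k x)"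
  by (rule integral_cong_AE) (use assms in \<open>auto\<close>)

text \<open>The partial sums are Cauchy in the mean, so a subsequence converges almost everywhere; Fatou's lemma turns the
  pointwise limit into a limit in the square mean.\<close>

lemma riesz_fischer:
  assumes c: "l2 c"
  shows "\<exists>u. L2_fun u \<and> (\<lambda>N. sq_norm (\<lambda>x. u x - psum c N x)) \<longlonglongrightarrow> 0"
proof -
  define P where "P N = (\<Sum>m\<in>{- int N..int N}. (cmod (c m))\<^sup>2)" for N
  define S where "S = (\<Sum>\<^sub>\<infinity>m. (cmod (c m))\<^sup>2)"
  have cs: "(\<lambda>m. (cmod (c m))\<^sup>2) summable_on UNIV" using c by (simp add: l2_def)
  have Plim: "P \<longlonglongrightarrow> S" unfolding P_def S_def by (rule infsum_int_limit[OF cs])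
  have PS: "P N \<le> S" for N unfolding P_def S_def by (rule finite_sum_le_infsum[OF cs]) auto
  have diff: "sq_norm (\<lambda>x. psum c j x - psum c i x) = 2 * (P j - P i)" if "i \<le> j" for i j
  proof -
    have sub: "{- int i..int i} \<subseteq> {- int j..int j}" using that by auto
    have "psum c j x - psum c i x = trig_sum c ({- int j..int j} - {- int i..int i}) x" for x
      unfolding trig_sum_def using sum_diff[OF _ sub, of "\<lambda>m. c m * efun m x"] by simp
    then have "sq_norm (\<lambda>x. psum c j x - psum c i x) = sq_norm (trig_sum c ({- int j..int j} - {- int i..int i}))" by simp
    also have "\<dots> = 2 * (P j - P i)"
      unfolding P_def by (subst sq_norm_trig_sum) (use sum_diff[OF _ sub, of "\<lambda>m. (cmod (c m))\<^sup>2"] in auto)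
    finally show ?thesis .
  qed
  have sym: "sq_norm (\<lambda>x. psum c i x - psum c j x) = sq_norm (\<lambda>x. psum c j x - psum c i x)" for i j
    by (simp add: sq_norm_def norm_minus_commute)
  have pL2: "L2_fun (psum c N)" for N by (rule L2_trig_sum) simp
  have pm[measurable]: "psum c N \<in> borel_measurable per_measure" for N using pL2 by (simp add: L2_fun_per_measure)
  have one: "L2_fun (\<lambda>_. 1)" "sq_norm (\<lambda>_. 1) = 2"
    using L2_continuous[of "\<lambda>_. 1"] measure_per_measure by (auto simp: sq_norm_def)
  have sq_norm_le: "sq_norm (\<lambda>x. psum c i x - psum c j x) \<le> 2 * (S - P N)" if "N \<le> i" "N \<le> j" for i j N
  proof -
    have mono: "P N \<le> P i" if "N \<le> i" for N i
      unfolding P_def by (rule sum_mono2) (use that in auto)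
    show ?thesis
    proof (cases "i \<le> j")
      case True
      then show ?thesis using diff[OF True] mono[OF that(1)] PS[of j] unfolding sym[of i j] by argo
    next
      case False
      then have "j \<le> i" by simp
      then show ?thesis using diff[of j i] mono[OF that(2)] PS[of i] by argo
    qed
  qed
  have cauchy: "\<exists>N. \<forall>i\<ge>N. \<forall>j\<ge>N. (LINT x|per_measure. norm (psum c i x - psum c j x)) < e" if e: "0 < e" for e
  proof -
    have "(\<lambda>N. 4 * (S - P N)) \<longlonglongrightarrow> 4 * (S - S)" by (intro tendsto_intros Plim)
    then have "\<forall>\<^sub>F N in sequentially. 4 * (S - P N) < e\<^sup>2" by (rule order_tendstoD(2)) (use e in simp)
    then obtain N where N: "4 * (S - P N) < e\<^sup>2" by (auto simp: eventually_sequentially)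
    show ?thesis
    proof (intro exI allI impI)
      fix i j assume ij: "N \<le> i" "N \<le> j"
      have "(LINT x|per_measure. cmod (psum c i x - psum c j x) * cmod 1)\<^sup>2 \<le> sq_norm (\<lambda>x. psum c i x - psum c j x) * sq_norm (\<lambda>_. 1)"
        by (rule L2_CS(1)[OF L2_diff[OF pL2 pL2] one(1)])
      also have "\<dots> < e\<^sup>2" using sq_norm_le[OF ij] N one(2) by simp
      finally show "(LINT x|per_measure. norm (psum c i x - psum c j x)) < e" using e by (simp add: power2_less_imp_less)
    qed
  qed
  obtain r where r: "strict_mono r" "AE x in per_measure. Cauchy (\<lambda>i. psum c (r i) x)"
    by (rule cauchy_L1_AE_cauchy_subseq[of per_measure "psum c"]) (use L2_integrable[OF pL2] cauchy in auto)
  define u where "u x = lim (\<lambda>i. psum c (r i) x)" for x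
  have um[measurable]: "u \<in> borel_measurable per_measure" unfolding u_def by measurable
  have ulim: "AE x in per_measure. (\<lambda>i. psum c (r i) x) \<longlonglongrightarrow> u x"
    using r(2) by eventually_elim (auto simp: u_def Cauchy_convergent_iff convergent_LIMSEQ_iff)
  have bound: "(\<integral>\<^sup>+x. ennreal ((cmod (u x - psum c N x))\<^sup>2) \<partial>per_measure) \<le> ennreal (2 * (S - P N))" for N
  proof -
    have "(\<integral>\<^sup>+x. ennreal ((cmod (u x - psum c N x))\<^sup>2) \<partial>per_measure) = (\<integral>\<^sup>+x. liminf (\<lambda>i. ennreal ((cmod (psum c (r i) x - psum c N x))\<^sup>2)) \<partial>per_measure)"
    proof (rule nn_integral_cong_AE, use ulim in eventually_elim)
      case (elim x)
      have "(\<lambda>i. ennreal ((cmod (psum c (r i) x - psum c N x))\<^sup>2)) \<longlonglongrightarrow> ennreal ((cmod (u x - psum c N x))\<^sup>2)"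
        by (intro tendsto_ennrealI tendsto_intros elim)
      then show ?case by (intro lim_imp_Liminf[symmetric]) simp_all
    qed
    also have "\<dots> \<le> liminf (\<lambda>i. \<integral>\<^sup>+x. ennreal ((cmod (psum c (r i) x - psum c N x))\<^sup>2) \<partial>per_measure)"
      by (rule nn_integral_liminf) measurable
    also have "\<dots> \<le> ennreal (2 * (S - P N))"
    proof (rule Liminf_le)
      show "\<forall>\<^sub>F i in sequentially. (\<integral>\<^sup>+x. ennreal ((cmod (psum c (r i) x - psum c N x))\<^sup>2) \<partial>per_measure) \<le> ennreal (2 * (S - P N))"
        using eventually_ge_at_top[of N]
      proof eventually_elim
        case (elim i)
        then have "N \<le> r i" using strict_mono_imp_increasing[OF r(1), of i] by simp
        have "integrable per_measure (\<lambda>x. (cmod (psum c (r i) x - psum c N x))\<^sup>2)"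
          using L2_diff[OF pL2 pL2] by (auto simp: L2_fun_per_measure)
        then have "(\<integral>\<^sup>+x. ennreal ((cmod (psum c (r i) x - psum c N x))\<^sup>2) \<partial>per_measure) = ennreal (sq_norm (\<lambda>x. psum c (r i) x - psum c N x))"
          unfolding sq_norm_def by (rule nn_integral_eq_integral) simp
        also have "\<dots> \<le> ennreal (2 * (S - P N))"
          by (intro ennreal_leI sq_norm_le) (use \<open>N \<le> r i\<close> in auto)
        finally show ?case .
      qed
    qed simp
    finally show ?thesis .
  qed
  have di: "integrable per_measure (\<lambda>x. (cmod (u x - psum c N x))\<^sup>2)" for N
    by (rule integrableI_bounded) (use bound[of N] in \<open>simp_all, metis ennreal_less_top order_le_less_trans\<close>)
  have dL2: "L2_fun (\<lambda>x. u x - psum c N x)" for N using di by (simp add: L2_fun_per_measure)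
  have sq_norm_bd: "norm (sq_norm (\<lambda>x. u x - psum c N x)) \<le> 2 * (S - P N)" for N
  proof -
    have "ennreal (sq_norm (\<lambda>x. u x - psum c N x)) = (\<integral>\<^sup>+x. ennreal ((cmod (u x - psum c N x))\<^sup>2) \<partial>per_measure)"
      unfolding sq_norm_def by (rule nn_integral_eq_integral[OF di, symmetric]) simp
    also have "\<dots> \<le> ennreal (2 * (S - P N))" by (rule bound)
    finally show ?thesis using PS[of N] by (simp add: ennreal_le_iff)
  qed
  have "(\<lambda>N. 2 * (S - P N)) \<longlonglongrightarrow> 2 * (S - S)" by (intro tendsto_intros Plim)
  then have lim0: "(\<lambda>N. 2 * (S - P N)) \<longlonglongrightarrow> 0" by simp
  have "(\<lambda>N. sq_norm (\<lambda>x. u x - psum c N x)) \<longlonglongrightarrow> 0"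
    by (rule Lim_null_comparison[OF always_eventually[OF allI[OF sq_norm_bd]] lim0])
  moreover have "L2_fun u"
    using L2_add[OF dL2[of 0] pL2[of 0]] by simp
  ultimately show ?thesis by blast
qed

text \<open>The inner product is continuous in the square mean.\<close>

lemma limit_inner:
  assumes u: "L2_fun u" "(\<lambda>N. sq_norm (\<lambda>x. u x - psum c N x)) \<longlonglongrightarrow> 0" and g: "L2_fun g"
  shows "(\<lambda>N. 2 * (\<Sum>m\<in>{- int N..int N}. c m * cnj (fourier g m))) \<longlonglongrightarrow> L2_inner u g"
proof -
  have pL2: "L2_fun (psum c N)" for N by (rule L2_trig_sum) simp
  have e: "2 * (\<Sum>m\<in>{- int N..int N}. c m * cnj (fourier g m)) = (LINT x|per_measure. psum c N x * cnj (g x))" for N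
    by (rule trig_sum_inner[symmetric]) (use g in auto)
  have d: "L2_inner u g - (LINT x|per_measure. psum c N x * cnj (g x)) = (LINT x|per_measure. (u x - psum c N x) * cnj (g x))" for N
    unfolding L2_inner_per_measure left_diff_distrib
    by (rule Bochner_Integration.integral_diff[symmetric]) (intro L2_product_integrable u pL2 L2_cnj g)+
  have "(\<lambda>N. L2_inner u g - (LINT x|per_measure. psum c N x * cnj (g x))) \<longlonglongrightarrow> 0"
  proof (rule Lim_null_comparison)
    have "(\<lambda>N. sqrt (sq_norm (\<lambda>x. u x - psum c N x) * sq_norm (\<lambda>x. cnj (g x)))) \<longlonglongrightarrow> sqrt (0 * sq_norm (\<lambda>x. cnj (g x)))"
      by (intro tendsto_intros u)
    then show "(\<lambda>N. sqrt (sq_norm (\<lambda>x. u x - psum c N x) * sq_norm (\<lambda>x. cnj (g x)))) \<longlonglongrightarrow> 0" by simp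
    show "\<forall>\<^sub>F N in sequentially. norm (L2_inner u g - (LINT x|per_measure. psum c N x * cnj (g x))) \<le> sqrt (sq_norm (\<lambda>x. u x - psum c N x) * sq_norm (\<lambda>x. cnj (g x)))"
      unfolding d by (intro always_eventually allI real_le_rsqrt L2_CS L2_diff u pL2 L2_cnj g)
  qed
  then have "(\<lambda>N. L2_inner u g - (L2_inner u g - (LINT x|per_measure. psum c N x * cnj (g x)))) \<longlonglongrightarrow> L2_inner u g - 0"
    by (intro tendsto_intros)
  then show ?thesis unfolding e by simp
qed

lemma fourier_limit:
  assumes u: "L2_fun u" "(\<lambda>N. sq_norm (\<lambda>x. u x - psum c N x)) \<longlonglongrightarrow> 0"
  shows "fourier u m = c m"
proof -
  have 1: "(\<lambda>N. 2 * (\<Sum>k\<in>{- int N..int N}. c k * cnj (fourier (efun m) k))) \<longlonglongrightarrow> L2_inner u (efun m)"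
    by (rule limit_inner[OF u L2_efun])
  have 2: "\<forall>\<^sub>F N in sequentially. 2 * (\<Sum>k\<in>{- int N..int N}. c k * cnj (fourier (efun m) k)) = 2 * c m"
    using eventually_ge_at_top[of "nat \<bar>m\<bar>"]
  proof eventually_elim
    case (elim N)
    have "(\<Sum>k\<in>{- int N..int N}. c k * cnj (fourier (efun m) k)) = (\<Sum>k\<in>{- int N..int N}. if k = m then c k else 0)"
      by (intro sum.cong) (auto simp: fourier_def efun_orth)
    also have "\<dots> = c m" using elim by auto
    finally show ?case by simp
  qed
  have "L2_inner u (efun m) = 2 * c m"
    by (rule LIMSEQ_unique[OF 1 tendsto_eventually[OF 2]])
  then show ?thesis by (simp add: fourier_def L2_inner_per_measure)
qed

theorem parseval:
  assumes "L2_fun u" "L2_fun g"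
  shows "L2_inner u g = 2 * (\<Sum>\<^sub>\<infinity>m. fourier u m * cnj (fourier g m))"
proof -
  obtain u' where u': "L2_fun u'" "(\<lambda>N. sq_norm (\<lambda>x. u' x - psum (fourier u) N x)) \<longlonglongrightarrow> 0"
    using riesz_fischer[OF bessel[OF assms(1)]] by blast
  have fcu: "fourier u' m = fourier u m" for m by (rule fourier_limit[OF u'])
  have "AE x in per_measure. u x - u' x = 0"
  proof (rule complete[OF L2_diff[OF assms(1) u'(1)]])
    fix m
    have "integrable per_measure (\<lambda>x. u x * cnj (efun m x))" "integrable per_measure (\<lambda>x. u' x * cnj (efun m x))"
      by (intro L2_product_integrable assms u' L2_cnj L2_efun)+
    then have "fourier (\<lambda>x. u x - u' x) m = fourier u m - fourier u' m"
      by (simp add: fourier_def left_diff_distrib diff_divide_distrib)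
    then show "fourier (\<lambda>x. u x - u' x) m = 0" using fcu by simp
  qed
  then have ae: "AE x in per_measure. u x = u' x" by simp
  have "L2_inner u g = L2_inner u' g"
    unfolding L2_inner_per_measure by (rule L2_AE_cong[OF ae]) (use assms u' L2_cnj[OF assms(2)] in \<open>auto simp: L2_fun_per_measure\<close>)
  moreover have 1: "(\<lambda>N. 2 * (\<Sum>m\<in>{- int N..int N}. fourier u m * cnj (fourier g m))) \<longlonglongrightarrow> L2_inner u' g"
    by (rule limit_inner[OF u' assms(2)])
  moreover have 2: "(\<lambda>N. 2 * (\<Sum>m\<in>{- int N..int N}. fourier u m * cnj (fourier g m))) \<longlonglongrightarrow> 2 * (\<Sum>\<^sub>\<infinity>m. fourier u m * cnj (fourier g m))"
    by (intro tendsto_intros infsum_int_limit seq_inner_summable bessel assms)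
  ultimately show ?thesis using LIMSEQ_unique[OF 1 2] by simp
qed

section \<open>The Hill operator in Fourier space\<close>

text \<open>For \<open>x \<in> h1\<close> the series converges absolutely (\<open>h1_summable\<close>), so this is an everywhere defined function rather than
  a class modulo null sets, as the representation of \<open>H1\<close> by continuous functions requires.\<close>

definition synth :: "(int \<Rightarrow> complex) \<Rightarrow> real \<Rightarrow> complex" where
  "synth x t = (\<Sum>\<^sub>\<infinity>m. x m * efun m t)"

lemma h1_summable:
  assumes "x \<in> h1" shows "(\<lambda>m. cmod (x m)) summable_on UNIV"
  using l2_CS(1)[OF l2_inv_bracket, of "\<lambda>m. bracket m * cmod (x m)"] assms by (simp add: h1_def)

lemma synth_summable:
  assumes "x \<in> h1" shows "(\<lambda>m. x m * efun m t) summable_on UNIV"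
  by (rule abs_summable_summable) (use h1_summable[OF assms] in \<open>simp add: norm_mult\<close>)

lemma synth_bound:
  assumes "x \<in> h1" shows "cmod (synth x t) \<le> (\<Sum>\<^sub>\<infinity>m. cmod (x m))"
  using norm_infsum_bound[of "\<lambda>m. x m * efun m t" UNIV] h1_summable[OF assms] by (simp add: synth_def norm_mult)

lemma psum_limit:
  assumes "x \<in> h1" shows "(\<lambda>N. psum x N t) \<longlonglongrightarrow> synth x t"
  using infsum_int_limit[OF synth_summable[OF assms, of t]] by (simp add: trig_sum_def synth_def)

lemma psum_bound:
  assumes "x \<in> h1" shows "cmod (psum x N t) \<le> (\<Sum>\<^sub>\<infinity>m. cmod (x m))"
proof -
  have "cmod (psum x N t) \<le> (\<Sum>m\<in>{- int N..int N}. cmod (x m))"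
    unfolding trig_sum_def by (rule order_trans[OF norm_sum]) (simp add: norm_mult)
  also have "\<dots> \<le> (\<Sum>\<^sub>\<infinity>m. cmod (x m))" by (rule finite_sum_le_infsum[OF h1_summable[OF assms]]) auto
  finally show ?thesis .
qed

lemma synth_measurable:
  assumes "x \<in> h1" shows "synth x \<in> borel_measurable per_measure"
proof (rule borel_measurable_LIMSEQ_metric)
  show "psum x N \<in> borel_measurable per_measure" for N using L2_trig_sum[of "{- int N..int N}" x] by (simp add: L2_fun_per_measure)
  show "(\<lambda>N. psum x N t) \<longlonglongrightarrow> synth x t" for t by (rule psum_limit[OF assms])
qed

lemma L2_synth: "x \<in> h1 \<Longrightarrow> L2_fun (synth x)"
  by (rule L2_bounded[OF synth_measurable synth_bound])

lemma synth_sq_norm_limit: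
  assumes x: "x \<in> h1" shows "(\<lambda>N. sq_norm (\<lambda>t. synth x t - psum x N t)) \<longlonglongrightarrow> 0"
proof -
  define B where "B = (\<Sum>\<^sub>\<infinity>m. cmod (x m))"
  have [measurable]: "synth x \<in> borel_measurable per_measure" "psum x N \<in> borel_measurable per_measure" for N
    using synth_measurable[OF x] L2_trig_sum[of "{- int N..int N}" x] by (auto simp: L2_fun_per_measure)
  have "(\<lambda>N. LINT t|per_measure. (cmod (synth x t - psum x N t))\<^sup>2) \<longlonglongrightarrow> (LINT t|per_measure. 0)"
  proof (rule integral_dominated_convergence[where w="\<lambda>_. (2 * B)\<^sup>2"])
    show "AE t in per_measure. (\<lambda>N. (cmod (synth x t - psum x N t))\<^sup>2) \<longlonglongrightarrow> 0"
    proof (rule AE_I2)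
      fix t
      have "(\<lambda>N. (cmod (synth x t - psum x N t))\<^sup>2) \<longlonglongrightarrow> (cmod (synth x t - synth x t))\<^sup>2"
        by (intro tendsto_intros psum_limit x)
      then show "(\<lambda>N. (cmod (synth x t - psum x N t))\<^sup>2) \<longlonglongrightarrow> 0" by simp
    qed
    show "AE t in per_measure. norm ((cmod (synth x t - psum x N t))\<^sup>2) \<le> (2 * B)\<^sup>2" for N
    proof (rule AE_I2)
      fix t
      have "cmod (synth x t - psum x N t) \<le> 2 * B"
        using norm_triangle_ineq4[of "synth x t" "psum x N t"] synth_bound[OF x, of t] psum_bound[OF x, of N t] unfolding B_def by argo
      from power_mono[OF this norm_ge_zero, of 2] show "norm ((cmod (synth x t - psum x N t))\<^sup>2) \<le> (2 * B)\<^sup>2" by simp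
    qed
  qed simp_all
  then show ?thesis by (simp add: sq_norm_def)
qed

lemma fourier_synth: "x \<in> h1 \<Longrightarrow> fourier (synth x) = x"
  by (rule ext) (rule fourier_limit[OF L2_synth synth_sq_norm_limit])

lemma synth_inj: "x \<in> h1 \<Longrightarrow> y \<in> h1 \<Longrightarrow> synth x = synth y \<Longrightarrow> x = y"
  by (metis fourier_synth)

lemma synth_add: "x \<in> h1 \<Longrightarrow> y \<in> h1 \<Longrightarrow> synth (\<lambda>m. x m + y m) t = synth x t + synth y t"
  unfolding synth_def distrib_right by (intro infsum_add synth_summable)

lemma synth_scale: "x \<in> h1 \<Longrightarrow> synth (\<lambda>m. c * x m) t = c * synth x t"
  unfolding synth_def mult.assoc by (intro infsum_cmult_right synth_summable)

lemma synth_zero: "synth (\<lambda>_. 0) t = 0" by (simp add: synth_def)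

lemma synth_sum:
  assumes "finite J" "\<And>j. j \<in> J \<Longrightarrow> e j \<in> h1"
  shows "synth (\<lambda>m. \<Sum>j\<in>J. c j * e j m) t = (\<Sum>j\<in>J. c j * synth (e j) t)"
  using assms
proof (induction J rule: finite_induct)
  case (insert j J)
  then show ?case
    using synth_add[OF h1_scale[of "e j" "c j"] seq_inner.sum_mem[of J e c]] by (simp add: synth_scale)
qed (simp add: synth_zero)

lemma synth_periodic: "synth x (t + 2) = synth x t" by (simp add: synth_def efun_periodic)

lemma periodic_int:
  fixes f :: "real \<Rightarrow> 'a" and x :: real and k :: int
  assumes "\<And>x. f (x + 2) = f x" shows "f (x + 2 * of_int k) = f x"
proof (cases k)
  case (nonneg n)
  have "f (x + 2 * real n) = f x" for x :: real
  proof (induction n arbitrary: x)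
    case (Suc n x)
    have "f (x + 2 * real (Suc n)) = f ((x + 2) + 2 * real n)" by (simp add: algebra_simps)
    then show ?case using Suc[of "x + 2"] assms[of x] by simp
  qed simp
  then show ?thesis by (simp add: nonneg)
next
  case (neg n)
  have "f (x + 2 * real n) = f x" for x :: real and n :: nat
  proof (induction n arbitrary: x)
    case (Suc n x)
    have "f (x + 2 * real (Suc n)) = f ((x + 2) + 2 * real n)" by (simp add: algebra_simps)
    then show ?case using Suc[of "x + 2"] assms[of x] by simp
  qed simp
  from this[of "x + 2 * of_int k" "Suc n"] show ?thesis by (simp add: neg)
qed

lemma periodic_eqI:
  fixes f g :: "real \<Rightarrow> 'a"
  assumes "\<And>x. f (x + 2) = f x" "\<And>x. g (x + 2) = g x" "\<And>x. x \<in> {0..2} \<Longrightarrow> f x = g x"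
  shows "f = g"
proof
  fix x :: real
  define k where "k = \<lfloor>x / 2\<rfloor>"
  define y where "y = x - 2 * of_int k"
  have "of_int k \<le> x / 2" "x / 2 < of_int k + 1" unfolding k_def by linarith+
  then have "y \<in> {0..2}" by (auto simp: y_def)
  then have "f y = g y" by (rule assms(3))
  moreover have "x = y + 2 * of_int k" by (simp add: y_def)
  ultimately show "f x = g x" using periodic_int[of f y k, OF assms(1)] periodic_int[of g y k, OF assms(2)] by simp
qed

text \<open>Parseval's identity for \<open>u\<close> and the indicator of \<open>[0, t]\<close>; it allows integrating a Fourier series termwise
  although it need not converge pointwise.\<close>

lemma integral_fourier:
  assumes u: "L2_fun u" and t: "t \<in> {0..2}"
  shows "(LINT s:{0..t}|lborel. u s) = (\<Sum>\<^sub>\<infinity>m. fourier u m * (if m = 0 then of_real t else (efun m t - 1) / (\<i> * of_real (pi * of_int m))))"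
proof -
  define g where "g s = complex_of_real (indicator {0..t} s)" for s
  have "(\<lambda>s. complex_of_real (indicator {0..t} s)) \<in> borel_measurable per_measure"
    unfolding per_measure_def by (rule measurable_restrict_space1) simp
  then have g: "L2_fun g" unfolding g_def by (rule L2_bounded[of _ 1]) (simp add: indicator_def)
  have "L2_inner u g = (LINT s:{0..t}|lborel. u s)"
    unfolding L2_inner_def set_lebesgue_integral_def
    by (intro Bochner_Integration.integral_cong) (use t in \<open>auto simp: g_def indicator_def\<close>)
  moreover have "2 * cnj (fourier g m) = (if m = 0 then of_real t else (efun m t - 1) / (\<i> * of_real (pi * of_int m)))" for m
  proof -
    have "2 * fourier g m = (\<integral>s. indicator {0..t} s *\<^sub>R efun (- m) s \<partial>lborel)"
      unfolding fourier_def per_measure_def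
      by (subst integral_restrict_space) (use t in \<open>auto simp: g_def indicator_def efun_cnj intro!: Bochner_Integration.integral_cong\<close>)
    also have "\<dots> = (if m = 0 then of_real t else (efun (- m) t - 1) / (\<i> * of_real (pi * of_int (- m))))"
      using efun_integral_Icc[of "- m" t] t by (simp add: scaleR_conv_of_real)
    finally have "cnj (2 * fourier g m) = cnj (if m = 0 then of_real t else (efun (- m) t - 1) / (\<i> * of_real (pi * of_int (- m))))" by simp
    then show ?thesis by (simp add: efun_cnj)
  qed
  moreover have "2 * (\<Sum>\<^sub>\<infinity>m. fourier u m * cnj (fourier g m)) = (\<Sum>\<^sub>\<infinity>m. fourier u m * (2 * cnj (fourier g m)))"
    by (subst infsum_cmult_right[symmetric]) (auto intro!: seq_inner_summable bessel u g infsum_cong)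
  ultimately show ?thesis using parseval[OF u g] by simp
qed

lemma synth_diff_0:
  assumes "x \<in> h1" shows "synth x t - synth x 0 = (\<Sum>\<^sub>\<infinity>m. x m * (efun m t - 1))"
proof -
  have 0: "(\<lambda>m. - (x m * efun m 0)) summable_on UNIV"
    unfolding summable_on_uminus by (rule synth_summable[OF assms])
  have "(\<Sum>\<^sub>\<infinity>m. x m * efun m t + - (x m * efun m 0)) = synth x t + - synth x 0"
    unfolding synth_def infsum_add[OF synth_summable[OF assms] 0] infsum_uminus ..
  then show ?thesis by (simp add: right_diff_distrib)
qed

lemma derivative_coefficients:
  assumes x: "x \<in> h1" and u: "L2_fun u" "\<And>m. fourier u m = \<i> * of_real (pi * of_int m) * x m" and t: "t \<in> {0..2}"
  shows "synth x t = synth x 0 + (LINT s:{0..t}|lborel. u s)"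
proof -
  have "(LINT s:{0..t}|lborel. u s) = (\<Sum>\<^sub>\<infinity>m. x m * (efun m t - 1))"
    unfolding integral_fourier[OF u(1) t] u(2) by (intro infsum_cong) auto
  then show ?thesis using synth_diff_0[OF x, of t] by (simp add: algebra_simps)
qed

lemma synth_H1:
  assumes x: "x \<in> h1" shows "synth x \<in> H1"
proof -
  define c where "c m = \<i> * of_real (pi * of_int m) * x m" for m
  have "l2 c"
  proof (rule l2_mono(1))
    show "l2 (\<lambda>m. pi * (bracket m * cmod (x m)))" using x l2_scale(1) by (auto simp: h1_def)
    show "norm (c m) \<le> norm (pi * (bracket m * cmod (x m)))" for m
    proof -
      have "pi * \<bar>of_int m\<bar> * cmod (x m) \<le> pi * bracket m * cmod (x m)"
        by (intro mult_right_mono mult_left_mono) (auto simp: bracket_def)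
      then show ?thesis by (simp add: c_def norm_mult abs_mult mult.assoc)
    qed
  qed
  then obtain u where u: "L2_fun u" "(\<lambda>N. sq_norm (\<lambda>x. u x - psum c N x)) \<longlonglongrightarrow> 0" using riesz_fischer by blast
  have "fourier u m = \<i> * of_real (pi * of_int m) * x m" for m using fourier_limit[OF u, of m] by (simp add: c_def)
  then have "has_L2_deriv (synth x) u"
    unfolding has_L2_deriv_def using u(1) derivative_coefficients[OF x u(1)] by blast
  then show ?thesis unfolding H1_def using synth_periodic by blast
qed

text \<open>The coefficients of \<open>f'\<close> are divided by \<open>\<i> \<pi> m\<close>; the mean of \<open>f'\<close> is zero by periodicity, and the constant
  mode is adjusted to match \<open>f 0\<close>.\<close>

lemma H1_coefficients:
  assumes f: "\<And>t. f (t + 2) = f t" and d: "has_L2_deriv f f'"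
  shows "\<exists>x\<in>h1. f = synth x \<and> (\<forall>m. fourier f' m = \<i> * of_real (pi * of_int m) * x m)"
proof -
  define y where "y m = (if m = 0 then 0 else fourier f' m / (\<i> * of_real (pi * of_int m)))" for m
  have f': "L2_fun f'" and ft: "\<And>t. t \<in> {0..2} \<Longrightarrow> f t = f 0 + (LINT s:{0..t}|lborel. f' s)"
    using d unfolding has_L2_deriv_def by blast+
  have "f 2 = f 0" using f[of 0] by simp
  then have "(LINT s:{0..2}|lborel. f' s) = 0" using ft[of 2] by simp
  then have c0: "fourier f' 0 = 0" by (simp add: fourier_def set_integral_per_measure)
  have y: "y \<in> h1" unfolding h1_def mem_Collect_eq
  proof (rule l2_mono(1)[OF bessel[OF f']])
    fix m
    show "norm (bracket m * cmod (y m)) \<le> norm (fourier f' m)"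
    proof (cases "m = 0")
      case False
      then have j: "bracket m = \<bar>of_int m\<bar>" by (simp add: bracket_def)
      have "cmod (fourier f' m) * 1 \<le> cmod (fourier f' m) * pi" using pi_ge_two by (intro mult_left_mono) auto
      then show ?thesis using False by (simp add: j y_def norm_divide norm_mult abs_mult divide_le_eq)
    qed (simp add: y_def)
  qed
  have coef: "fourier f' m = \<i> * of_real (pi * of_int m) * y m" for m using c0 by (simp add: y_def)
  define a where "a = f 0 - synth y 0"
  define d0 where "d0 m = (if m = (0::int) then 1 else 0 :: complex)" for m
  have d0: "d0 \<in> h1" by (rule h1_finite_support, rule finite_subset[of _ "{0}"]) (auto simp: d0_def)
  have sd0: "synth d0 t = 1" for t
  proof -
    have "synth d0 t = (\<Sum>\<^sub>\<infinity>m\<in>{0}. d0 m * efun m t)"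
      unfolding synth_def by (rule infsum_cong_neutral) (auto simp: d0_def)
    then show ?thesis by (simp add: d0_def)
  qed
  define x where "x m = y m + a * d0 m" for m
  have x: "x \<in> h1" unfolding x_def by (intro h1_add h1_scale y d0)
  have sx: "synth x t = synth y t + a" for t
    unfolding x_def using synth_add[OF y h1_scale[OF d0, of a], of t] synth_scale[OF d0, of a t] by (simp add: sd0)
  have "f = synth x"
  proof (rule periodic_eqI)
    fix t :: real assume t: "t \<in> {0..2}"
    show "f t = synth x t" unfolding sx using ft[OF t] derivative_coefficients[OF y f' coef t] by (simp add: a_def)
  qed (rule f synth_periodic)+
  moreover have "fourier f' m = \<i> * of_real (pi * of_int m) * x m" for m using coef[of m] by (cases "m = 0") (auto simp: x_def d0_def)
  ultimately show ?thesis using x by blast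
qed

lemma H1_eq: "H1 = synth ` h1"
proof
  show "H1 \<subseteq> synth ` h1"
  proof
    fix f assume "f \<in> H1"
    then obtain f' where "\<And>t. f (t + 2) = f t" "has_L2_deriv f f'" unfolding H1_def by blast
    from H1_coefficients[OF this] show "f \<in> synth ` h1" by blast
  qed
qed (use synth_H1 in blast)

lemma fourier_L2_deriv:
  assumes x: "x \<in> h1"
  shows "L2_fun (L2_deriv (synth x))" "fourier (L2_deriv (synth x)) m = \<i> * of_real (pi * of_int m) * x m"
proof -
  have "\<exists>f'. has_L2_deriv (synth x) f'" using synth_H1[OF x] by (simp add: H1_def)
  then have d: "has_L2_deriv (synth x) (L2_deriv (synth x))"
    unfolding L2_deriv_def by (rule someI_ex)
  then show "L2_fun (L2_deriv (synth x))" by (simp add: has_L2_deriv_def)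
  obtain y where y: "y \<in> h1" "synth x = synth y" "\<And>m. fourier (L2_deriv (synth x)) m = \<i> * of_real (pi * of_int m) * y m"
    using H1_coefficients[OF synth_periodic d] by blast
  then show "fourier (L2_deriv (synth x)) m = \<i> * of_real (pi * of_int m) * x m" using synth_inj[OF x y(1,2)] by simp
qed

lemma L2_inner_synth: "x \<in> h1 \<Longrightarrow> y \<in> h1 \<Longrightarrow> L2_inner (synth x) (synth y) = 2 * seq_inner x y"
  using parseval[OF L2_synth L2_synth] by (simp add: fourier_synth seq_inner_def)

lemma L2_inner_deriv:
  assumes "x \<in> h1" "y \<in> h1"
  shows "L2_inner (L2_deriv (synth x)) (L2_deriv (synth y)) = 2 * (\<Sum>\<^sub>\<infinity>m. of_real (pi\<^sup>2 * (of_int m)\<^sup>2) * x m * cnj (y m))"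
proof -
  have "\<i> * of_real (pi * of_int m) * x m * cnj (\<i> * of_real (pi * of_int m) * y m) = of_real (pi\<^sup>2 * (of_int m)\<^sup>2) * x m * cnj (y m)" for m
    by (simp add: power2_eq_square algebra_simps)
  then show ?thesis using parseval[OF fourier_L2_deriv(1) fourier_L2_deriv(1)] assms by (simp add: fourier_L2_deriv(2))
qed

text \<open>Multiplication by the exponential shifts the Fourier coefficients of \<open>synth y\<close> by \<open>2 k\<close>.\<close>

lemma exp_moment:
  assumes x: "x \<in> h1" and y: "y \<in> h1"
  shows "(LINT t:{0..2}|lborel. synth x t * cnj (synth y t) * cis (2 * pi * of_int k * t)) = 2 * (\<Sum>\<^sub>\<infinity>m. x m * cnj (y (m + 2 * k)))"
proof -
  define g where "g t = synth y t * efun (- (2 * k)) t" for t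
  have gm: "g \<in> borel_measurable per_measure"
    unfolding g_def by (intro borel_measurable_times synth_measurable y) (use L2_efun in \<open>auto simp: L2_fun_per_measure\<close>)
  have g: "L2_fun g"
    by (rule L2_bounded[OF gm, of "\<Sum>\<^sub>\<infinity>m. cmod (y m)"]) (use synth_bound[OF y] in \<open>simp add: g_def norm_mult\<close>)
  have "fourier g m = fourier (synth y) (m + 2 * k)" for m
  proof -
    have "g t * cnj (efun m t) = synth y t * cnj (efun (m + 2 * k) t)" for t
      using efun_mult[of "- (2 * k)" t "- m"] by (simp add: g_def efun_cnj mult.assoc add.commute)
    then show ?thesis by (simp add: fourier_def)
  qed
  moreover have "(LINT t:{0..2}|lborel. synth x t * cnj (synth y t) * cis (2 * pi * of_int k * t)) = L2_inner (synth x) g"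
    unfolding L2_inner_def by (intro arg_cong[where f="set_lebesgue_integral lborel {0..2}"] ext)
      (simp add: g_def efun_cnj, simp add: efun_def mult_ac)
  ultimately show ?thesis using parseval[OF L2_synth[OF x] g] by (simp add: fourier_synth x y)
qed

section \<open>Periodic distributions as matrix entries\<close>

text \<open>The function \<open>exp (2 \<pi> \<i> k x)\<close> is the exponential of index \<open>2 k\<close> on the circle of length two.\<close>

definition potential_seq :: "((real \<Rightarrow> real) \<Rightarrow> real) \<Rightarrow> int \<Rightarrow> complex" where
  "potential_seq q j = (if even j then fourier_coeff q (j div 2) else 0)"

lemma potential_seq_double [simp]: "potential_seq q (2 * k) = fourier_coeff q k" by (simp add: potential_seq_def)
lemma potential_seq_odd: "odd j \<Longrightarrow> potential_seq q j = 0" by (simp add: potential_seq_def)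

text \<open>Written with a phase, all derivatives of the sine and the cosine keep one form; it shows at once that both are
  test functions.\<close>

lemma sin_derivatives: "(deriv ^^ n) (\<lambda>x. sin (a * x + b)) = (\<lambda>x::real. a ^ n * sin (a * x + b + n * (pi / 2)))"
proof (induction n)
  case (Suc n)
  have "deriv (\<lambda>x. a ^ n * sin (a * x + b + n * (pi / 2))) x = a ^ Suc n * sin (a * x + b + Suc n * (pi / 2))" for x
  proof (rule DERIV_imp_deriv)
    have "a * x + b + Suc n * (pi / 2) = (a * x + b + n * (pi / 2)) + pi / 2" by (simp add: algebra_simps)
    then have "sin (a * x + b + Suc n * (pi / 2)) = cos (a * x + b + n * (pi / 2))" by (simp only: sin_add) simp
    then show "((\<lambda>x. a ^ n * sin (a * x + b + n * (pi / 2))) has_real_derivative a ^ Suc n * sin (a * x + b + Suc n * (pi / 2))) (at x)"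
      by (auto intro!: derivative_eq_intros)
  qed
  then show ?case by (simp add: Suc fun_eq_iff)
qed simp

lemma test_function_sin:
  "test_function (\<lambda>x. sin (2 * pi * of_int k * x + b))"
  unfolding test_function_def
proof (intro conjI allI)
  fix x :: real
  have "sin (2 * pi * of_int k * (x + 1) + b) = sin (2 * pi * of_int k * x + b + 2 * pi * of_int k)" by (simp add: algebra_simps)
  also have "\<dots> = sin (2 * pi * of_int k * x + b)" by (simp add: sin_add cos_int_2pin sin_int_2pin)
  finally show "sin (2 * pi * of_int k * (x + 1) + b) = sin (2 * pi * of_int k * x + b)" .
  show "(deriv ^^ n) (\<lambda>x. sin (2 * pi * of_int k * x + b)) differentiable at x" for n
    unfolding sin_derivatives real_differentiable_def by (rule exI) (auto intro!: derivative_eq_intros)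
qed

lemma fourier_coeff_minus:
  assumes "distribution q" shows "fourier_coeff q (- k) = cnj (fourier_coeff q k)"
proof -
  define \<phi> where "\<phi> = (\<lambda>x::real. sin (2 * pi * of_int k * x))"
  have "test_function \<phi>" using test_function_sin[of k 0] by (simp add: \<phi>_def)
  then have "q (\<lambda>x. (-1) * \<phi> x + 0 * \<phi> x) = (-1) * q \<phi> + 0 * q \<phi>" using assms unfolding distribution_def by blast
  then have "q (\<lambda>x. - \<phi> x) = - q \<phi>" by simp
  then show ?thesis by (simp add: fourier_coeff_def complex_eq_iff \<phi>_def)
qed

lemma summable_even:
  fixes f :: "int \<Rightarrow> real"
  assumes "\<And>j. odd j \<Longrightarrow> f j = 0"
  shows "f summable_on UNIV \<longleftrightarrow> (\<lambda>k. f (2 * k)) summable_on UNIV"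
proof -
  have "f summable_on UNIV \<longleftrightarrow> f summable_on (range (\<lambda>k. 2 * k))"
    by (rule summable_on_cong_neutral) (use assms in \<open>auto elim!: evenE\<close>)
  also have "\<dots> \<longleftrightarrow> (\<lambda>k. f (2 * k)) summable_on UNIV"
    by (subst summable_on_reindex) (auto simp: inj_on_def o_def)
  finally show ?thesis .
qed

text \<open>The weights \<open>1 + k\<^sup>2\<close> and \<open>bracket (2 * k)\<close> squared are comparable, with constants \<open>1/4\<close> and \<open>1/2\<close>; as
  \<open>\<alpha> \<le> 0\<close>, powers reverse the inequalities.\<close>

lemma sobolev_potential_seq:
  assumes d: "distribution q" and \<alpha>: "\<alpha> \<le> 0"
  shows "q \<in> sobolev \<alpha> \<longleftrightarrow> l2 (\<lambda>j. bracket j powr (\<alpha> + 1) * (cmod (potential_seq q j) / bracket j))"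
proof -
  define a where "a k = (cmod (fourier_coeff q k))\<^sup>2" for k
  have a0: "0 \<le> a k" for k by (simp add: a_def)
  have j0: "0 < (bracket j)\<^sup>2" for j by simp
  have k0: "0 < 1 + (real_of_int k)\<^sup>2" for k by (simp add: add_pos_nonneg)
  have "l2 (\<lambda>j. bracket j powr (\<alpha> + 1) * (cmod (potential_seq q j) / bracket j)) \<longleftrightarrow>
    (\<lambda>k. (bracket (2 * k) powr (\<alpha> + 1) * (cmod (potential_seq q (2 * k)) / bracket (2 * k)))\<^sup>2) summable_on UNIV"
    unfolding l2_def real_norm_def power2_abs
    by (rule summable_even) (simp add: potential_seq_odd)
  also have "(\<lambda>k. (bracket (2 * k) powr (\<alpha> + 1) * (cmod (potential_seq q (2 * k)) / bracket (2 * k)))\<^sup>2) = (\<lambda>k. ((bracket (2 * k))\<^sup>2) powr \<alpha> * a k)"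
  proof
    fix k
    have "((bracket (2 * k))\<^sup>2) powr \<alpha> = (bracket (2 * k) powr \<alpha>)\<^sup>2" by (simp add: power2_eq_square powr_mult)
    then show "(bracket (2 * k) powr (\<alpha> + 1) * (cmod (potential_seq q (2 * k)) / bracket (2 * k)))\<^sup>2 = ((bracket (2 * k))\<^sup>2) powr \<alpha> * a k"
      by (simp add: a_def powr_add power_mult_distrib power_divide)
  qed
  also have "(\<lambda>k. ((bracket (2 * k))\<^sup>2) powr \<alpha> * a k) summable_on UNIV \<longleftrightarrow> (\<lambda>k. (1 + (of_int k)\<^sup>2) powr \<alpha> * a k) summable_on UNIV"
  proof
    assume s: "(\<lambda>k. ((bracket (2 * k))\<^sup>2) powr \<alpha> * a k) summable_on UNIV"
    have s4: "(\<lambda>k. (1/4) powr \<alpha> * (((bracket (2 * k))\<^sup>2) powr \<alpha> * a k)) summable_on UNIV"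
      by (rule summable_on_cmult_right[OF s])
    show "(\<lambda>k. (1 + (of_int k)\<^sup>2) powr \<alpha> * a k) summable_on UNIV"
    proof (rule summable_on_comparison_test[OF s4])
      fix k
      have "1/4 * (bracket (2 * k))\<^sup>2 \<le> 1 + (real_of_int k)\<^sup>2" by (simp add: bracket_def max_def power_mult_distrib)
      then have "(1 + (of_int k)\<^sup>2) powr \<alpha> \<le> (1/4 * (bracket (2 * k))\<^sup>2) powr \<alpha>" using \<alpha> j0 by (intro powr_mono2') auto
      also have "\<dots> = (1/4) powr \<alpha> * ((bracket (2 * k))\<^sup>2) powr \<alpha>" by (rule powr_mult)
      finally show "(1 + (of_int k)\<^sup>2) powr \<alpha> * a k \<le> (1/4) powr \<alpha> * (((bracket (2 * k))\<^sup>2) powr \<alpha> * a k)"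
        using a0[of k] by (simp add: mult.assoc[symmetric] mult_right_mono)
    qed (use a0 in auto)
  next
    assume s: "(\<lambda>k. (1 + (of_int k)\<^sup>2) powr \<alpha> * a k) summable_on UNIV"
    have s4: "(\<lambda>k. (1/2) powr \<alpha> * ((1 + (of_int k)\<^sup>2) powr \<alpha> * a k)) summable_on UNIV"
      by (rule summable_on_cmult_right[OF s])
    show "(\<lambda>k. ((bracket (2 * k))\<^sup>2) powr \<alpha> * a k) summable_on UNIV"
    proof (rule summable_on_comparison_test[OF s4])
      fix k :: int
      have "1/2 * (1 + (real_of_int k)\<^sup>2) \<le> (bracket (2 * k))\<^sup>2"
      proof (cases "k = 0")
        case False
        then have "1 \<le> \<bar>k\<bar>" by simp
        then have "1 \<le> \<bar>real_of_int k\<bar>" by (metis of_int_1_le_iff of_int_abs)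
        then have "1\<^sup>2 \<le> \<bar>real_of_int k\<bar>\<^sup>2" by (intro power_mono) auto
        moreover have "(2 * real_of_int k)\<^sup>2 \<le> (bracket (2 * k))\<^sup>2" using sq_le_bracket[of "2 * k"] by simp
        ultimately show ?thesis by (simp add: power_mult_distrib)
      qed (simp add: bracket_def)
      then have "((bracket (2 * k))\<^sup>2) powr \<alpha> \<le> (1/2 * (1 + (of_int k)\<^sup>2)) powr \<alpha>" using \<alpha> k0[of k] by (intro powr_mono2') auto
      also have "\<dots> = (1/2) powr \<alpha> * (1 + (of_int k)\<^sup>2) powr \<alpha>" by (rule powr_mult)
      finally show "((bracket (2 * k))\<^sup>2) powr \<alpha> * a k \<le> (1/2) powr \<alpha> * ((1 + (of_int k)\<^sup>2) powr \<alpha> * a k)"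
        using a0[of k] by (simp add: mult.assoc[symmetric] mult_right_mono)
    qed (use a0 in auto)
  qed
  finally show ?thesis using d by (simp add: sobolev_def a_def)
qed

section \<open>Periodic eigenvalues\<close>

locale hill =
  fixes q :: "(real \<Rightarrow> real) \<Rightarrow> real"
  assumes q: "q \<in> sobolev (- 1)"
begin

lemma q_distribution: "distribution q" using q by (simp add: sobolev_def)

sublocale singular_potential "potential_seq q"
proof
  show "potential_seq q (- m) = cnj (potential_seq q m)" for m
  proof (cases "even m")
    case True
    then obtain k where "m = 2 * k" by (rule evenE)
    then show ?thesis using fourier_coeff_minus[OF q_distribution, of k] potential_seq_double[of q "- k"] by simp
  qed (simp add: potential_seq_odd)
  show "l2 (\<lambda>j. cmod (potential_seq q j) / bracket j)"
    using sobolev_potential_seq[OF q_distribution, of "- 1"] q by simp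
qed

text \<open>The substitution \<open>(k, m) \<mapsto> (m + 2 k, m)\<close> sorts the double series for \<open>V\<close> by diagonals; the odd diagonals
  vanish.\<close>

lemma pairing_eq:
  assumes x: "x \<in> h1" and y: "y \<in> h1"
  shows "pairing q (\<lambda>t. synth x t * cnj (synth y t)) = 2 * V x y"
proof -
  define g where "g p = (snd p + 2 * fst p, snd p)" for p :: "int \<times> int"
  have inj: "inj g" by (auto simp: inj_on_def g_def)
  have vg: "vterm x y (g p) = fourier_coeff q (fst p) * (x (snd p) * cnj (y (snd p + 2 * fst p)))" for p
    by (simp add: vterm_def g_def mult.assoc)
  have out: "vterm x y p = 0" if "p \<notin> range g" for p
  proof -
    have "odd (fst p - snd p)"
    proof
      assume "even (fst p - snd p)"
      then obtain k where "fst p - snd p = 2 * k" by (rule evenE)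
      then have "p = g (k, snd p)" by (simp add: g_def prod_eq_iff)
      then show False using that by blast
    qed
    then show ?thesis by (simp add: vterm_def case_prod_unfold potential_seq_odd)
  qed
  have "vterm x y summable_on range g"
    by (rule summable_on_subset_banach[OF vterm_summable'[OF x y]]) simp
  then have s: "(\<lambda>p. vterm x y (g p)) summable_on UNIV"
    by (subst (asm) summable_on_reindex[OF inj]) (simp add: o_def)
  have "V x y = infsum (vterm x y) (range g)"
    unfolding V_def by (rule infsum_cong_neutral) (use out in auto)
  also have "\<dots> = (\<Sum>\<^sub>\<infinity>p. vterm x y (g p))" by (subst infsum_reindex[OF inj]) (simp add: o_def)
  also have "\<dots> = (\<Sum>\<^sub>\<infinity>k. \<Sum>\<^sub>\<infinity>m. vterm x y (g (k, m)))"
    using infsum_Sigma_banach[of "\<lambda>p. vterm x y (g p)" UNIV "\<lambda>_. UNIV"] s by simp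
  also have "\<dots> = (\<Sum>\<^sub>\<infinity>k. fourier_coeff q k * (\<Sum>\<^sub>\<infinity>m. x m * cnj (y (m + 2 * k))))"
  proof (intro infsum_cong)
    fix k
    have "l2 (\<lambda>m. y (m + 2 * k))" using l2_bij(1)[OF bij_add_int(1), of y "2 * k"] h1_l2[OF y] by simp
    then show "(\<Sum>\<^sub>\<infinity>m. vterm x y (g (k, m))) = fourier_coeff q k * (\<Sum>\<^sub>\<infinity>m. x m * cnj (y (m + 2 * k)))"
      unfolding vg by (subst infsum_cmult_right[symmetric]) (auto intro!: seq_inner_summable h1_l2 x)
  qed
  finally have V: "V x y = (\<Sum>\<^sub>\<infinity>k. fourier_coeff q k * (\<Sum>\<^sub>\<infinity>m. x m * cnj (y (m + 2 * k))))" .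
  have "pairing q (\<lambda>t. synth x t * cnj (synth y t)) = (\<Sum>\<^sub>\<infinity>k. 2 * (fourier_coeff q k * (\<Sum>\<^sub>\<infinity>m. x m * cnj (y (m + 2 * k)))))"
    unfolding pairing_def exp_moment[OF x y] by (intro infsum_cong) simp
  also have "\<dots> = 2 * V x y" unfolding V by (rule infsum_cmult_right')
  finally show ?thesis .
qed

text \<open>The factor \<open>2\<close> is the length of the circle; it occurs in \<open>L2_inner_synth\<close> too, so the eigenvalue equations agree.\<close>

lemma hill_form_eq: "x \<in> h1 \<Longrightarrow> y \<in> h1 \<Longrightarrow> hill_form q (synth x) (synth y) = 2 * A x y"
  by (simp add: hill_form_def L2_inner_deriv pairing_eq A_def)

lemma hill_operator_iff:
  assumes "x \<in> h1" shows "hill_operator q (synth x) (\<lambda>t. of_real \<mu> * synth x t) \<longleftrightarrow> H.eigenpair x \<mu>"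
proof -
  have "L2_inner (\<lambda>t. of_real \<mu> * synth x t) (synth y) = 2 * (of_real \<mu> * seq_inner x y)" if "y \<in> h1" for y
  proof -
    have "L2_inner (\<lambda>t. of_real \<mu> * synth x t) (synth y) = of_real \<mu> * L2_inner (synth x) (synth y)"
      by (simp add: L2_inner_per_measure mult.assoc)
    then show ?thesis using L2_inner_synth[OF assms that] by simp
  qed
  then show ?thesis
    unfolding hill_operator_def H.eigenpair_def H1_eq
    using assms L2_scale[OF L2_synth[OF assms], of "of_real \<mu>"] by (auto simp: hill_form_eq)
qed

lemma eigenspace_eq: "eigenspace q \<mu> = synth ` {x. H.eigenpair x \<mu>}"
proof
  show "eigenspace q \<mu> \<subseteq> synth ` {x. H.eigenpair x \<mu>}"
  proof
    fix f assume f: "f \<in> eigenspace q \<mu>"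
    then have "f \<in> H1" by (simp add: eigenspace_def hill_operator_def)
    then obtain x where x: "x \<in> h1" "f = synth x" by (auto simp: H1_eq)
    then show "f \<in> synth ` {x. H.eigenpair x \<mu>}" using f hill_operator_iff[OF x(1)] by (auto simp: eigenspace_def)
  qed
  show "synth ` {x. H.eigenpair x \<mu>} \<subseteq> eigenspace q \<mu>"
    using hill_operator_iff by (auto simp: eigenspace_def H.eigenpair_def)
qed

lemma eigenvalues_unbounded:
  assumes seq: "H.spectral_sequence l e" shows "\<exists>J. \<mu> < l J"
proof -
  obtain N where N: "\<And>n. n \<ge> N \<Longrightarrow> 0 < n \<and> l2norm (kern n w) < 1"
    using small_kernel[of 1] by (auto simp: eventually_sequentially)
  define n where "n = max (Suc N) (nat \<lceil>\<bar>\<mu>\<bar>\<rceil>)"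
  have n: "0 < n" "l2norm (kern n w) \<le> 1" "\<mu> \<le> real n" using N[of n] unfolding n_def by linarith+
  have pos: "0 < pi\<^sup>2 * (real n)\<^sup>2" using n by simp
  have "real n < window_top n"
  proof -
    have "1 * real n \<le> pi\<^sup>2 * real n" using pi2_ge by (intro mult_right_mono) auto
    then show ?thesis using pos by (simp add: distrib_left)
  qed
  then have "\<mu> < l (2 * n + 1)" using eigenvalue_count(2)[OF seq n(1,2)] n(3) by simp
  then show ?thesis by blast
qed

lemma fun_sum_apply: "(\<Sum>j\<in>J. F j) t = (\<Sum>j\<in>J. (F j :: real \<Rightarrow> complex) t)"
  by (induction J rule: infinite_finite_induct) auto

text \<open>The functions \<open>synth (e j)\<close> with \<open>l j = \<mu>\<close> form a basis of the eigenspace: they span it by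
  \<open>eigenpair_expansion\<close> and are independent by orthonormality.\<close>

lemma multiplicity:
  assumes seq: "H.spectral_sequence l e"
  shows "finite {j. l j = \<mu>}" "multiplicity_of q \<mu> = card {j. l j = \<mu>}"
proof -
  define J where "J = {j. l j = \<mu>}"
  obtain K where K: "\<mu> < l K" using eigenvalues_unbounded[OF seq] by blast
  note e_mem = H.seq_mem[OF seq]
  have "{j. l j = \<mu>} \<subseteq> {..<K}" using K H.seq_mono[OF seq, of K] by (force simp: not_less[symmetric])
  then have fin: "finite J" unfolding J_def by (rule finite_subset) simp
  then show "finite {j. l j = \<mu>}" by (simp add: J_def)
  define b where "b j = synth (e j)" for j
  have inj: "inj_on b J"
  proof (rule inj_onI)
    fix i j assume "b i = b j"
    then have "e i = e j" using synth_inj[OF e_mem e_mem] by (simp add: b_def)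
    then show "i = j" using H.seq_orth[OF seq, of i j] H.seq_orth[OF seq, of i i] by (auto split: if_splits)
  qed
  have comb: "synth (\<lambda>m. \<Sum>j\<in>J. c j * e j m) = (\<Sum>j\<in>J. scale_fun (c j) (b j))" for c
    by (rule ext) (simp add: synth_sum[OF fin e_mem] fun_sum_apply scale_fun_def b_def)
  have "cfun.dim (eigenspace q \<mu>) = card J"
  proof (rule cfun.dim_unique)
    show "b ` J \<subseteq> eigenspace q \<mu>"
      using seq by (auto simp: eigenspace_eq b_def J_def H.spectral_sequence_def)
    show "eigenspace q \<mu> \<subseteq> cfun.span (b ` J)"
    proof
      fix f assume "f \<in> eigenspace q \<mu>"
      then obtain x where x: "H.eigenpair x \<mu>" "f = synth x" by (auto simp: eigenspace_eq)
      have "f = (\<Sum>j\<in>J. scale_fun (seq_inner x (e j)) (b j))"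
        unfolding x(2) comb[symmetric] using H.eigenpair_expansion(2)[OF seq x(1) K] by (simp add: J_def)
      then show "f \<in> cfun.span (b ` J)"
        by (rule ssubst) (intro cfun.span_sum cfun.span_scale cfun.span_base imageI)
    qed
    show "cfun.independent (b ` J)"
    proof (rule cfun.independent_if_scalars_zero)
      fix c f assume z: "(\<Sum>f\<in>b ` J. scale_fun (c f) f) = 0" and f: "f \<in> b ` J"
      obtain j where j: "j \<in> J" "f = b j" using f by blast
      have "synth (\<lambda>m. \<Sum>j\<in>J. c (b j) * e j m) = synth (\<lambda>_. 0)"
        unfolding comb using z by (subst (asm) sum.reindex[OF inj]) (simp add: fun_eq_iff synth_zero)
      then have "(\<lambda>m. \<Sum>j\<in>J. c (b j) * e j m) = (\<lambda>_. 0)"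
        by (rule synth_inj[rotated 2]) (use e_mem in \<open>auto intro: seq_inner.sum_mem[OF fin] h1_zero\<close>)
      then show "c f = 0"
        using H.ip_combination[OF seq fin j(1), of "\<lambda>j. c (b j)"] seq_inner.zero_left[OF e_mem[of j]] by (simp add: j(2))
    qed (use fin in simp)
    show "card (b ` J) = card J" by (rule card_image[OF inj])
  qed
  then show "multiplicity_of q \<mu> = card {j. l j = \<mu>}" by (simp add: multiplicity_of_def J_def)
qed

end

text \<open>At the first index where the sequences differ, the smaller of the two values is taken more often by its sequence
  than by the other.\<close>

lemma listing_unique:
  fixes l l' :: "nat \<Rightarrow> real"
  assumes l: "mono l" "\<And>\<mu>. finite {n. l n = \<mu>}" and l': "mono l'" "\<And>\<mu>. finite {n. l' n = \<mu>}"
    and card: "\<And>\<mu>. card {n. l n = \<mu>} = card {n. l' n = \<mu>}"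
  shows "l = l'"
proof -
  have wlog: "\<not> a n < b n" if eq: "\<And>k. k < n \<Longrightarrow> a k = b k" and a: "finite {k. a k = a n}"
    and b: "mono b" and c: "card {k. a k = a n} = card {k. b k = a n}" for a b :: "nat \<Rightarrow> real" and n
  proof
    assume less: "a n < b n"
    have ps: "{k. b k = a n} \<subset> {k. a k = a n}"
    proof
      have "k < n" if "b k = a n" for k
        using less that monoD[OF b, of n k] by (cases "k < n") auto
      then show "{k. b k = a n} \<subseteq> {k. a k = a n}" using eq by auto
      have "n \<in> {k. a k = a n}" "n \<notin> {k. b k = a n}" using less by auto
      then show "{k. b k = a n} \<noteq> {k. a k = a n}" by blast
    qed
    show False using psubset_card_mono[OF a ps] c by simp
  qed
  have "l n = l' n" for n
  proof (induction n rule: less_induct)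
    case (less n)
    have "\<not> l n < l' n" by (rule wlog[of n l l']) (use less l l' card in auto)
    moreover have "\<not> l' n < l n" by (rule wlog[of n l' l]) (use less l l' card in auto)
    ultimately show ?case by simp
  qed
  then show ?thesis by blast
qed

context hill
begin

lemma periodic_eigenvalue_eq:
  assumes seq: "H.spectral_sequence l e" shows "periodic_eigenvalue q = l"
  unfolding periodic_eigenvalue_def
proof (rule the_equality)
  show "lists_spectrum q l"
    unfolding lists_spectrum_def using multiplicity[OF seq] seq by (auto simp: H.spectral_sequence_def)
  fix l' assume "lists_spectrum q l'"
  then show "l' = l"
    unfolding lists_spectrum_def using multiplicity[OF seq] seq
    by (intro listing_unique) (auto simp: H.spectral_sequence_def)
qed

end

theorem theorem2:
  fixes q :: "(real \<Rightarrow> real) \<Rightarrow> real" and \<alpha> :: real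
  assumes "q \<in> sobolev (- 1)"
    and "- 1 \<le> \<alpha>" and "\<alpha> \<le> 0"
  shows "q \<in> sobolev \<alpha> \<longleftrightarrow> gap_length q \<in> weighted_l2 \<alpha>"
proof -
  interpret hill q by unfold_locales (rule assms)
  obtain l e where seq: "H.spectral_sequence l e" using H.spectral_sequence_exists by blast
  define f where "f n = (real n powr (\<alpha> + 1) * scaled_gap l n)\<^sup>2" for n
  have "q \<in> sobolev \<alpha> \<longleftrightarrow> l2 (\<lambda>j. bracket j powr (\<alpha> + 1) * w j)"
    using sobolev_potential_seq[OF q_distribution assms(3)] by (simp add: w_def)
  also have "\<dots> \<longleftrightarrow> summable f"
    unfolding f_def by (rule weighted_gap_characterization[OF seq]) (use assms in \<open>auto simp: potential_seq_odd\<close>)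
  also have "\<dots> \<longleftrightarrow> f summable_on UNIV"
    by (rule summable_on_UNIV_nonneg_real_iff[symmetric]) (simp add: f_def)
  also have "\<dots> \<longleftrightarrow> (\<lambda>k. real k powr (2 * \<alpha>) * (gap_length q k)\<^sup>2) summable_on {1..}"
  proof (rule summable_on_cong_neutral)
    fix k :: nat assume "k \<in> UNIV - {1..}"
    then show "f k = 0" by (simp add: f_def scaled_gap_def)
  next
    fix k :: nat assume "k \<in> UNIV \<inter> {1..}"
    then have k: "0 < k" by simp
    have "gap_length q k = l (2 * k) - l (2 * k - 1)" by (simp add: gap_length_def periodic_eigenvalue_eq[OF seq])
    moreover have "real k powr (2 * \<alpha>) = (real k powr \<alpha>)\<^sup>2" using k by (simp add: power2_eq_square powr_add[symmetric])
    ultimately show "f k = real k powr (2 * \<alpha>) * (gap_length q k)\<^sup>2"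
      using k by (simp add: f_def scaled_gap_def powr_add power_mult_distrib power_divide)
  qed auto
  finally show ?thesis by (simp add: weighted_l2_def)
qed

end
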